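(* Consider a sequence of linear models $y = X\beta + z$ satisfying the working assumption stated in the context. Then, for each of the three procedures forward stepwise regression, the lasso, and least angle regression, the rank $T$ of the first noise variable selected by the procedure satisfies $$\log T \le (1+o_{\mathbb P}(1))\left[\sqrt{\frac{2n\log p}{k}} - \frac{n}{2k} + \log\frac{n}{2p\log p}\right].$$
   Context: Asymptotics. We consider a sequence of problems indexed by $(k_l,n_l,p_l)$ with $k_l,n_l,p_l\to\infty$ as $l\to\infty$; the index $l$ is suppressed. All limits are as $l\to\infty$. $o_{\mathbb P}(1)$ denotes a sequence of random variables converging to zero in probability. Constants do not depend on $l$. Working assumption. $y=X\beta+z$, where $X\in\mathbb R^{n\times p}$ has independent $\mathcal N(0,1/n)$ entries, $z\in\mathbb R^n$ has independent $\mathcal N(0,\sigma^2)$ entries ($\sigma=0$ allowed), and $X$ and $z$ are independent. The (nonrandom) vector $\beta\in\mathbb R^p$ has $k$ fixed components equal to some $M\neq 0$ and the rest are zero. The nonrandom parameters $\sigma\ge 0$ and $M$ may vary with $l$. Moreover $c_1 p/\log^{c_2}p\le n\le c_3p$ and $c_4 n\le k\le\min\{0.99p,\; c_5 n\log^{0.99}p\}$ for arbitrary positive constants $c_1,\dots,c_5$. Signal and noise variables. Variable $j$ (column $X_j$) is a signal variable if $\beta_j\ne0$ and a noise (spurious) variable if $\beta_j=0$. Procedures (no intercept, no normalization of columns). - Forward stepwise: start from the empty set; at each step add the variable that, together with the variables already selected, gives the smallest least-squares residual sum of squares for $y$. - Lasso: the path of minimizers of $\frac12\|y-Xb\|_2^2+\lambda\|b\|_1$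 over $b\in\mathbb R^p$ as $\lambda$ decreases from $\infty$ to $0$; a variable is selected when its coefficient first becomes nonzero along the path. - Least angle regression: start with zero coefficients and with the variable having the largest absolute inner product with $y$; move the coefficients of the included variables in their joint least-squares direction (for the current residual) until an unselected variable has as large an absolute inner product with the current residual; that variable is included in the next step; continue until the residual is zero or all variables are included. (Removing a variable from the active set whenever its coefficient hits zero yields the lasso path.) Rank. For a given procedure, $T$ is the rank of the first noise variable: one plus the number of signal variables selected before the first noise variable. *)

theory Defs
  imports "HOL-Probability.Probability"
begin

text \<open>
  The dimensions vary with the index of the sequence, so they are natural-number parameters.
  A vector in \<open>R^n\<close> is a function on \<open>nat\<close> of which only the values at indices below \<open>n\<close> are used,
  and an \<open>n\<close> by \<open>p\<close> matrix \<open>X\<close> has entries \<open>X i j\<close> for \<open>i < n\<close> and \<open>j < p\<close>.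
\<close>

section \<open>The random model\<close>

definition gaussian :: "real \<Rightarrow> real measure" where
  "gaussian s = (if s = 0 then return borel 0 else density lborel (normal_density 0 s))"
  \<comment> \<open>the parameter is the standard deviation; \<open>s = 0\<close> gives the point mass at zero\<close>

text \<open>
  Mutual independence of the combined family of all entries of \<open>X\<close> and all entries of \<open>z\<close> says that
  the entries of \<open>X\<close> are independent, those of \<open>z\<close> are independent, and \<open>X\<close> and \<open>z\<close> are independent.
\<close>

definition gaussian_design_and_noise ::
  "'a measure \<Rightarrow> nat \<Rightarrow> nat \<Rightarrow> real \<Rightarrow> ('a \<Rightarrow> nat \<Rightarrow> nat \<Rightarrow> real) \<Rightarrow> ('a \<Rightarrow> nat \<Rightarrow> real) \<Rightarrow> bool"
where
  "gaussian_design_and_noise P n p \<sigma> X z \<longleftrightarrow>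
     prob_space P \<and>
     prob_space.indep_vars P (\<lambda>_. borel)
       (case_sum (\<lambda>(i, j) \<omega>. X \<omega> i j) (\<lambda>i \<omega>. z \<omega> i))
       (({..<n} \<times> {..<p}) <+> {..<n}) \<and>
     (\<forall>i<n. \<forall>j<p. distr P borel (\<lambda>\<omega>. X \<omega> i j) = gaussian (sqrt (1 / real n))) \<and>
     (\<forall>i<n. distr P borel (\<lambda>\<omega>. z \<omega> i) = gaussian \<sigma>)"

definition fitted :: "nat \<Rightarrow> (nat \<Rightarrow> nat \<Rightarrow> real) \<Rightarrow> (nat \<Rightarrow> real) \<Rightarrow> nat \<Rightarrow> real" where
  "fitted p X b i = (\<Sum>j<p. X i j * b j)"

text \<open>
  Random variables may take infinite values here, because with positive probability
  a procedure may stop without ever selecting a noise variable.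
\<close>

definition vanishes_in_probability :: "(nat \<Rightarrow> 'a measure) \<Rightarrow> (nat \<Rightarrow> 'a \<Rightarrow> ereal) \<Rightarrow> bool" where
  "vanishes_in_probability P \<epsilon> \<longleftrightarrow>
     (\<forall>l. \<epsilon> l \<in> borel_measurable (P l)) \<and>
     (\<forall>\<delta>>0. (\<lambda>l. measure (P l) {\<omega> \<in> space (P l). \<bar>\<epsilon> l \<omega>\<bar> > ereal \<delta>}) \<longlonglongrightarrow> 0)"

section \<open>Least squares\<close>

definition sq_norm :: "nat \<Rightarrow> (nat \<Rightarrow> real) \<Rightarrow> real" where
  "sq_norm n v = (\<Sum>i<n. (v i)\<^sup>2)"

definition residual ::
  "nat \<Rightarrow> (nat \<Rightarrow> nat \<Rightarrow> real) \<Rightarrow> (nat \<Rightarrow> real) \<Rightarrow> (nat \<Rightarrow> real) \<Rightarrow> nat \<Rightarrow> real"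
where
  "residual p X y b = (\<lambda>i. y i - fitted p X b i)"

definition least_squares ::
  "nat \<Rightarrow> nat \<Rightarrow> (nat \<Rightarrow> nat \<Rightarrow> real) \<Rightarrow> (nat \<Rightarrow> real) \<Rightarrow> nat set \<Rightarrow> nat \<Rightarrow> real"
where
  "least_squares n p X y A =
     arg_min_on (\<lambda>b. sq_norm n (residual p X y b)) {b. \<forall>j. j \<notin> A \<longrightarrow> b j = 0}"

definition rss ::
  "nat \<Rightarrow> nat \<Rightarrow> (nat \<Rightarrow> nat \<Rightarrow> real) \<Rightarrow> (nat \<Rightarrow> real) \<Rightarrow> nat set \<Rightarrow> real"
where
  "rss n p X y A = sq_norm n (residual p X y (least_squares n p X y A))"

section \<open>The three procedures\<close>

text \<open>
  Each procedure is described by the entry time of every variable \<open>j < p\<close>, which is \<open>\<infinity>\<close> if the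
  variable is never selected. Ties are broken by Hilbert choice.
\<close>

primrec fs_selected ::
  "nat \<Rightarrow> nat \<Rightarrow> (nat \<Rightarrow> nat \<Rightarrow> real) \<Rightarrow> (nat \<Rightarrow> real) \<Rightarrow> nat \<Rightarrow> nat set"
where
  "fs_selected n p X y 0 = {}"
| "fs_selected n p X y (Suc m) =
     (let A = fs_selected n p X y m in
      if A = {..<p} then A
      else insert (arg_min_on (\<lambda>j. rss n p X y (insert j A)) ({..<p} - A)) A)"

definition fs_entry ::
  "nat \<Rightarrow> nat \<Rightarrow> (nat \<Rightarrow> nat \<Rightarrow> real) \<Rightarrow> (nat \<Rightarrow> real) \<Rightarrow> nat \<Rightarrow> ereal"
where
  "fs_entry n p X y j = (INF m \<in> {m. j \<in> fs_selected n p X y m}. ereal (real m))"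

definition lasso ::
  "nat \<Rightarrow> nat \<Rightarrow> (nat \<Rightarrow> nat \<Rightarrow> real) \<Rightarrow> (nat \<Rightarrow> real) \<Rightarrow> real \<Rightarrow> nat \<Rightarrow> real"
where
  "lasso n p X y lam =
     arg_min_on (\<lambda>b. 1 / 2 * sq_norm n (residual p X y b) + lam * (\<Sum>j<p. \<bar>b j\<bar>))
       {b. \<forall>j\<ge>p. b j = 0}"

text \<open>The lasso path is traversed with decreasing \<open>lam\<close>, so time is measured by \<open>- lam\<close>.\<close>

definition lasso_entry ::
  "nat \<Rightarrow> nat \<Rightarrow> (nat \<Rightarrow> nat \<Rightarrow> real) \<Rightarrow> (nat \<Rightarrow> real) \<Rightarrow> nat \<Rightarrow> ereal"
where
  "lasso_entry n p X y j = (INF lam \<in> {lam. lam > 0 \<and> lasso n p X y lam j \<noteq> 0}. ereal (- lam))"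

definition abs_corr :: "nat \<Rightarrow> (nat \<Rightarrow> nat \<Rightarrow> real) \<Rightarrow> (nat \<Rightarrow> real) \<Rightarrow> nat \<Rightarrow> real" where
  "abs_corr n X r j = \<bar>\<Sum>i<n. X i j * r i\<bar>"

text \<open>
  A state of least angle regression consists of the active set and the current coefficients.
  After moving by \<open>g * d\<close>, where \<open>d\<close> is the joint least-squares direction, the inner products of the
  active variables with the residual are multiplied by \<open>1 - g\<close>. Hence some inactive variable (if there
  is any) catches up for some \<open>g\<close> in \<open>[0, 1]\<close>; the move stops at the first such \<open>g\<close>.
\<close>

definition lar_step ::
  "nat \<Rightarrow> nat \<Rightarrow> (nat \<Rightarrow> nat \<Rightarrow> real) \<Rightarrow> (nat \<Rightarrow> real) \<Rightarrow>
   nat set \<times> (nat \<Rightarrow> real) \<Rightarrow> nat set \<times> (nat \<Rightarrow> real)"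
where
  "lar_step n p X y = (\<lambda>(A, b).
     let d = least_squares n p X (residual p X y b) A;
         move = (\<lambda>g j. b j + g * d j);
         caught_up = (\<lambda>g. {j \<in> {..<p} - A. \<forall>a\<in>A.
            abs_corr n X (residual p X y (move g)) j \<ge> abs_corr n X (residual p X y (move g)) a});
         g = Inf {g \<in> {0..1}. caught_up g \<noteq> {}}
     in if A = {..<p} then (A, b)
        else if \<forall>i<n. residual p X y (move g) i = 0 then (A, move g)
        else (insert (SOME j. j \<in> caught_up g) A, move g))"

primrec lar ::
  "nat \<Rightarrow> nat \<Rightarrow> (nat \<Rightarrow> nat \<Rightarrow> real) \<Rightarrow> (nat \<Rightarrow> real) \<Rightarrow> nat \<Rightarrow> nat set \<times> (nat \<Rightarrow> real)"
where
  "lar n p X y 0 = ({arg_max_on (abs_corr n X y) {..<p}}, (\<lambda>_. 0))"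
| "lar n p X y (Suc m) = lar_step n p X y (lar n p X y m)"

definition lar_entry ::
  "nat \<Rightarrow> nat \<Rightarrow> (nat \<Rightarrow> nat \<Rightarrow> real) \<Rightarrow> (nat \<Rightarrow> real) \<Rightarrow> nat \<Rightarrow> ereal"
where
  "lar_entry n p X y j = (INF m \<in> {m. j \<in> fst (lar n p X y m)}. ereal (real m))"

section \<open>Rank of the first noise variable\<close>

text \<open>The rank is \<open>\<infinity>\<close> if no noise variable is ever selected.\<close>

definition first_noise_rank :: "nat \<Rightarrow> (nat \<Rightarrow> real) \<Rightarrow> (nat \<Rightarrow> ereal) \<Rightarrow> enat" where
  "first_noise_rank p \<beta> entry =
     (let t = (INF j \<in> {j. j < p \<and> \<beta> j = 0}. entry j) in
      if t = \<infinity> then \<infinity>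
      else enat (1 + card {j. j < p \<and> \<beta> j \<noteq> 0 \<and> entry j < t}))"

definition ln_enat :: "enat \<Rightarrow> ereal" where
  "ln_enat T = (case T of enat t \<Rightarrow> ereal (ln (real t)) | \<infinity> \<Rightarrow> \<infinity>)"

end

theory Submission
  imports Defs "HOL-Real_Asymp.Real_Asymp"
begin

text \<open>
  The bracket in the theorem is $(1 + o(1)) \sqrt{2 n \log p / k}$: the upper bound on $k$
  makes $n \log p / k$ at least of order $(\log p)^{0.01}$, whereas the two other terms are
  $O(\log \log p)$. So it suffices to bound $\log T$ by this leading term up to an additive
  $O(\log \log p)$.

  The first idea is that selection during the first few steps only depends on the
  correlations $X_j^T y$. The leading term is $O(\sqrt{\log p})$, so the number of steps to
  be followed is $p^{o(1)}$, whereas $n$ equals $p$ up to powers of $\log p$ and distinct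
  columns have inner products below $n^{-1/4}$. The coefficients fitted in so few steps are
  small in $\ell_1$ norm, and the correlation of an unselected variable with the current
  residual is still its correlation with $y$, up to a negligible error
  (\<open>correlation_persists\<close>). Each of the three procedures prefers a variable of
  larger correlation with the residual. Hence, as long as only signal variables have
  entered, each of them has a correlation with $y$ that is at least the largest one of a
  noise variable, up to a negligible amount. So $T$ is at most one plus the number of
  variables that reach that level (\<open>forward_stepwise_rank\<close>,
  \<open>lasso_rank\<close>, \<open>lar_rank\<close>). This part is deterministic.

  The second idea is to count these variables. Put $s = \|y\| / \sqrt n$. Given $y$, the
  correlations of the noise variables are independent $N(0, s^2)$, and there are at least
  $0.01 p$ of them, so the largest one exceeds $a s$ with $a = \sqrt{2 \log p - 4 \log \log
  p}$ (\<open>noise_columns_maximum\<close>). For every variable, $X_j^T y$ is $\beta_j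
  \|X_j\|^2$ plus a Gaussian of standard deviation close to $s$, and $|\beta_j|$ is at most
  $(1 + o(1)) s \sqrt{n / k}$ since the signal alone has energy $k M^2$. Therefore the level
  $a s$ is reached with probability at most about $2 \exp (- (a - \sqrt{n / k})^2 / 2)$,
  which is $\log^2 p \cdot \exp (\sqrt{2 n \log p / k}) / p$ up to a constant factor. By
  Markov's inequality at most $\log^3 p \cdot \exp (\sqrt{2 n \log p / k})$ variables reach
  it, with probability tending to one.

  The procedures involve arbitrary choices, so that $T$ need not be measurable. The events
  used are conditions on $X$ and $z$ alone (\<open>typical\<close>); on their complement the
  error term is infinite.
\<close>

section \<open>Least squares with nearly orthogonal columns\<close>

definition dot :: "nat \<Rightarrow> (nat \<Rightarrow> real) \<Rightarrow> (nat \<Rightarrow> real) \<Rightarrow> real" where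
  "dot n u v = (\<Sum>i<n. u i * v i)"

definition col :: "(nat \<Rightarrow> nat \<Rightarrow> real) \<Rightarrow> nat \<Rightarrow> nat \<Rightarrow> real" where
  "col X j = (\<lambda>i. X i j)"

lemma sq_norm_eq_dot: "sq_norm n v = dot n v v"
  by (simp add: sq_norm_def dot_def power2_eq_square)

lemma sq_norm_nonneg [simp]: "0 \<le> sq_norm n v"
  by (simp add: sq_norm_def sum_nonneg)

lemma abs_corr_eq_dot: "abs_corr n X r j = \<bar>dot n (col X j) r\<bar>"
  by (simp add: abs_corr_def dot_def col_def)

lemma dot_diff_right: "dot n u (\<lambda>i. v i - w i) = dot n u v - dot n u w"
  by (simp add: dot_def algebra_simps sum_subtractf)

lemma dot_residual: "dot n u (residual p X y b) = dot n u y - dot n u (fitted p X b)"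
  by (simp add: residual_def dot_diff_right)

lemma residual_add:
  "residual p X y (\<lambda>j. b j + d j) = residual p X (residual p X y b) d"
  by (simp add: residual_def fitted_def fun_eq_iff algebra_simps sum.distrib)

lemma fitted_scale: "fitted p X (\<lambda>j. g * d j) i = g * fitted p X d i"
  by (simp add: fitted_def sum_distrib_left algebra_simps)

lemma residual_zero: "residual p X y (\<lambda>_. 0) = y"
  by (simp add: residual_def fitted_def)

lemma sq_norm_residual:
  "sq_norm n (residual p X r d) = sq_norm n r - 2 * dot n r (fitted p X d) + sq_norm n (fitted p X d)"
proof -
  have "(\<Sum>i<n. (r i - f i)\<^sup>2) = (\<Sum>i<n. (r i)\<^sup>2) - 2 * (\<Sum>i<n. r i * f i) + (\<Sum>i<n. (f i)\<^sup>2)" for f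
    by (simp add: power2_diff sum.distrib sum_subtractf sum_distrib_left algebra_simps)
  thus ?thesis by (simp add: sq_norm_def dot_def residual_def)
qed

text \<open>
  The set over which \<open>least_squares\<close> minimises.
\<close>

definition supported_on :: "nat set \<Rightarrow> (nat \<Rightarrow> real) set" where
  "supported_on A = {b. \<forall>j. j \<notin> A \<longrightarrow> b j = 0}"

lemma supported_on_outside: "b \<in> supported_on A \<Longrightarrow> j \<notin> A \<Longrightarrow> b j = 0"
  by (simp add: supported_on_def)

lemma dot_fitted:
  assumes "A \<subseteq> {..<p}" "b \<in> supported_on A"
  shows "dot n u (fitted p X b) = (\<Sum>j\<in>A. b j * dot n (col X j) u)"
proof -
  have "dot n u (fitted p X b) = (\<Sum>i<n. \<Sum>j<p. u i * (X i j * b j))"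
    by (simp add: dot_def fitted_def sum_distrib_left)
  also have "\<dots> = (\<Sum>j<p. b j * dot n (col X j) u)"
    by (subst sum.swap) (simp add: dot_def col_def sum_distrib_left algebra_simps)
  also have "\<dots> = (\<Sum>j\<in>A. b j * dot n (col X j) u)"
    using assms by (intro sum.mono_neutral_right) (auto simp: supported_on_def)
  finally show ?thesis .
qed

text \<open>
  Coercivity confines the competitors of the zero vector to a box, which is compact in the
  product topology by Tychonoff's theorem.
\<close>

lemma minimizer_exists:
  fixes F :: "(nat \<Rightarrow> real) \<Rightarrow> real"
  assumes cont: "continuous_on UNIV F"
    and coercive: "\<And>b j. b \<in> supported_on A \<Longrightarrow> F b \<le> F (\<lambda>_. 0) \<Longrightarrow> \<bar>b j\<bar> \<le> R"
  obtains b where "b \<in> supported_on A" "\<And>b'. b' \<in> supported_on A \<Longrightarrow> F b \<le> F b'"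
proof -
  define K where "K = PiE UNIV (\<lambda>j. if j \<in> A then {- R..R} else {0::real})"
  have R: "0 \<le> R" using coercive[of "\<lambda>_. 0" 0] by (simp add: supported_on_def)
  have "compactin (product_topology (\<lambda>_. euclidean) UNIV) K"
    unfolding K_def by (subst compactin_PiE) auto
  hence "compact K"
    unfolding euclidean_product_topology compactin_euclidean_iff .
  moreover have "K \<noteq> {}"
    unfolding K_def using R by (simp add: PiE_eq_empty_iff)
  ultimately obtain b where b: "b \<in> K" "\<And>b'. b' \<in> K \<Longrightarrow> F b \<le> F b'"
    using continuous_attains_inf[of K F] continuous_on_subset[OF cont] by blast
  have K_iff: "x \<in> K \<longleftrightarrow> (\<forall>j. if j \<in> A then \<bar>x j\<bar> \<le> R else x j = 0)" for x
    unfolding K_def PiE_UNIV_domain Pi_iff by (auto simp: abs_le_iff minus_le_iff split: if_splits)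
  have K_supp: "K \<subseteq> supported_on A"
    unfolding supported_on_def subset_iff mem_Collect_eq K_iff by metis
  have in_K: "b' \<in> K" if "b' \<in> supported_on A" "\<And>j. \<bar>b' j\<bar> \<le> R" for b'
    using that unfolding K_iff supported_on_def by simp
  have "F b \<le> F b'" if s: "b' \<in> supported_on A" for b'
  proof (cases "F b' \<le> F (\<lambda>_. 0)")
    case True
    thus ?thesis using b(2) in_K coercive s by blast
  next
    case False
    have "(\<lambda>_. 0) \<in> K" using R by (intro in_K) (auto simp: supported_on_def)
    thus ?thesis using b(2) False by fastforce
  qed
  with b(1) K_supp that show ?thesis by blast
qed

lemma continuous_on_sq_norm_residual:
  "continuous_on UNIV (\<lambda>b. sq_norm n (residual p X y b))"
  unfolding sq_norm_def residual_def fitted_def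
  by (intro continuous_intros continuous_on_product_coordinates)

lemma arg_min_on_attained:
  fixes F :: "'b \<Rightarrow> real"
  assumes "b \<in> S" "\<And>b'. b' \<in> S \<Longrightarrow> F b \<le> F b'"
  shows "arg_min_on F S \<in> S" "\<And>b'. b' \<in> S \<Longrightarrow> F (arg_min_on F S) \<le> F b'"
proof -
  have "is_arg_min F (\<lambda>x. x \<in> S) b"
    using assms by (auto simp: is_arg_min_def not_less)
  hence "is_arg_min F (\<lambda>x. x \<in> S) (arg_min_on F S)"
    unfolding arg_min_on_def arg_min_def by (rule someI)
  thus "arg_min_on F S \<in> S" "\<And>b'. b' \<in> S \<Longrightarrow> F (arg_min_on F S) \<le> F b'"
    by (auto simp: is_arg_min_def not_less)
qed

text \<open>
  The Gram matrix is close to the identity entry by entry. For the Gaussian design the true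
  size of \<open>\<mu>\<close> is $\sqrt{\log p / n}$, but as an upper bound any negative
  power of $n$ does: only $p^{o(1)}$ columns are ever used at the same time.
\<close>

locale nearly_orthogonal =
  fixes n p :: nat and X :: "nat \<Rightarrow> nat \<Rightarrow> real" and \<mu> :: real
  assumes off_diagonal:
      "\<And>i j. i < p \<Longrightarrow> j < p \<Longrightarrow> i \<noteq> j \<Longrightarrow> \<bar>dot n (col X i) (col X j)\<bar> \<le> \<mu>"
    and diagonal: "\<And>j. j < p \<Longrightarrow> \<bar>dot n (col X j) (col X j) - 1\<bar> \<le> \<mu>"
begin

lemma mu_nonneg: "0 < p \<Longrightarrow> 0 \<le> \<mu>"
  using diagonal[of 0] by linarith

lemma off_support_bound:
  assumes "A \<subseteq> {..<p}" "b \<in> supported_on A" "j < p" "j \<notin> A"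
  shows "\<bar>dot n (col X j) (fitted p X b)\<bar> \<le> \<mu> * (\<Sum>i\<in>A. \<bar>b i\<bar>)"
proof -
  have "\<bar>\<Sum>i\<in>A. b i * dot n (col X i) (col X j)\<bar> \<le> (\<Sum>i\<in>A. \<bar>b i\<bar> * \<mu>)"
    using assms by (intro order_trans[OF sum_abs] sum_mono)
      (auto simp: abs_mult intro!: mult_left_mono off_diagonal)
  thus ?thesis using assms by (simp add: dot_fitted sum_distrib_left mult.commute)
qed

text \<open>
  On its support the Gram matrix acts as the identity, up to \<open>\<mu>\<close> times the
  $\ell_1$ norm.
\<close>

lemma on_support_bound:
  assumes "A \<subseteq> {..<p}" "b \<in> supported_on A" "a \<in> A"
  shows "\<bar>dot n (col X a) (fitted p X b) - b a\<bar> \<le> \<mu> * (\<Sum>i\<in>A. \<bar>b i\<bar>)"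
proof -
  have fin: "finite A" using assms(1) finite_subset by blast
  have "dot n (col X a) (fitted p X b) - b a =
      b a * (dot n (col X a) (col X a) - 1)
        + (\<Sum>i\<in>A-{a}. b i * dot n (col X i) (col X a))"
    using assms fin by (simp add: dot_fitted sum.remove algebra_simps)
  also have "\<bar>\<dots>\<bar> \<le> \<bar>b a\<bar> * \<mu> + (\<Sum>i\<in>A-{a}. \<bar>b i\<bar> * \<mu>)"
    using assms diagonal[of a]
    by (intro order_trans[OF abs_triangle_ineq] add_mono order_trans[OF sum_abs] sum_mono)
      (auto simp: abs_mult intro!: mult_left_mono off_diagonal)
  also have "\<dots> = \<mu> * (\<Sum>i\<in>A. \<bar>b i\<bar>)"
    using assms fin by (simp add: sum.remove sum_distrib_left mult.commute algebra_simps)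
  finally show ?thesis .
qed

text \<open>
  Diagonal dominance: summing \<open>on_support_bound\<close> over \<open>A\<close>, the
  error term absorbs at most half of the $\ell_1$ norm.
\<close>

lemma coefficients_l1_bound:
  assumes A: "A \<subseteq> {..<p}" "b \<in> supported_on A" and small: "real (card A) * \<mu> \<le> 1 / 2"
    and bound: "\<And>a. a \<in> A \<Longrightarrow> \<bar>dot n (col X a) (fitted p X b)\<bar> \<le> R"
  shows "(\<Sum>a\<in>A. \<bar>b a\<bar>) \<le> 2 * real (card A) * R"
proof -
  define S where "S = (\<Sum>a\<in>A. \<bar>b a\<bar>)"
  have S0: "0 \<le> S" by (simp add: S_def sum_nonneg)
  have "\<bar>b a\<bar> \<le> R + \<mu> * S" if "a \<in> A" for a
    using on_support_bound[OF A that] bound[OF that] by (simp add: S_def)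
  hence "S \<le> (\<Sum>a\<in>A. R + \<mu> * S)"
    unfolding S_def by (intro sum_mono) auto
  also have "\<dots> = real (card A) * R + (real (card A) * \<mu>) * S"
    by (simp add: algebra_simps)
  also have "(real (card A) * \<mu>) * S \<le> 1 / 2 * S"
    using small S0 by (intro mult_right_mono)
  finally show ?thesis by (simp add: S_def)
qed

text \<open>
  The off-diagonal part of the quadratic form is at most \<open>\<mu>\<close> times the
  squared $\ell_1$ norm, which Cauchy--Schwarz compares with the sum of squares.
\<close>

lemma sq_norm_fitted_lower:
  assumes A: "A \<subseteq> {..<p}" "b \<in> supported_on A"
  shows "(1 - real (card A) * \<mu>) * (\<Sum>a\<in>A. (b a)\<^sup>2) \<le> sq_norm n (fitted p X b)"
proof (cases "A = {}")
  case False
  then have mu: "0 \<le> \<mu>" using A mu_nonneg by fastforce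
  define S where "S = (\<Sum>a\<in>A. \<bar>b a\<bar>)"
  have "sq_norm n (fitted p X b) = (\<Sum>a\<in>A. b a * dot n (col X a) (fitted p X b))"
    using dot_fitted[OF A] by (simp add: sq_norm_eq_dot)
  also have "\<dots> \<ge> (\<Sum>a\<in>A. (b a)\<^sup>2 - \<bar>b a\<bar> * (\<mu> * S))"
  proof (intro sum_mono)
    fix a assume a: "a \<in> A"
    let ?e = "dot n (col X a) (fitted p X b) - b a"
    have "\<bar>b a * ?e\<bar> \<le> \<bar>b a\<bar> * (\<mu> * S)"
      using on_support_bound[OF A a] unfolding abs_mult S_def by (intro mult_left_mono) auto
    moreover have "b a * dot n (col X a) (fitted p X b) = (b a)\<^sup>2 + b a * ?e"
      by (simp add: power2_eq_square algebra_simps)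
    ultimately show "(b a)\<^sup>2 - \<bar>b a\<bar> * (\<mu> * S) \<le> b a * dot n (col X a) (fitted p X b)"
      by linarith
  qed
  also have "(\<Sum>a\<in>A. (b a)\<^sup>2 - \<bar>b a\<bar> * (\<mu> * S)) = (\<Sum>a\<in>A. (b a)\<^sup>2) - \<mu> * S\<^sup>2"
    by (simp add: sum_subtractf S_def power2_eq_square sum_distrib_left[symmetric]
        sum_distrib_right[symmetric])
  also have "\<dots> \<ge> (\<Sum>a\<in>A. (b a)\<^sup>2) - \<mu> * (real (card A) * (\<Sum>a\<in>A. (b a)\<^sup>2))"
  proof -
    have "S\<^sup>2 \<le> real (card A) * (\<Sum>a\<in>A. (b a)\<^sup>2)"
      unfolding S_def using sum_squared_le_sum_of_squares[of "\<lambda>a. \<bar>b a\<bar>" A] 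
      by (simp add: mult.commute)
    thus ?thesis using mu by (intro diff_left_mono mult_left_mono)
  qed
  finally show ?thesis by (simp add: algebra_simps)
qed simp

end

lemma sq_norm_fitted_le:
  "sq_norm n (fitted p X b) \<le> 2 * sq_norm n (residual p X y b) + 2 * sq_norm n y"
proof -
  have "(fitted p X b i)\<^sup>2 \<le> 2 * (residual p X y b i)\<^sup>2 + 2 * (y i)\<^sup>2" for i
    using zero_le_power2[of "fitted p X b i - 2 * y i"]
    by (simp add: residual_def power2_eq_square algebra_simps)
  hence "(\<Sum>i<n. (fitted p X b i)\<^sup>2) \<le> (\<Sum>i<n. 2 * (residual p X y b i)\<^sup>2 + 2 * (y i)\<^sup>2)"
    by (intro sum_mono)
  thus ?thesis by (simp add: sq_norm_def sum.distrib sum_distrib_left)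
qed

lemma sq_norm_residual_single:
  assumes "a < p"
  shows "sq_norm n (residual p X y (\<lambda>j. b j + (if j = a then t else 0))) =
    sq_norm n (residual p X y b) - 2 * t * dot n (col X a) (residual p X y b)
      + t\<^sup>2 * dot n (col X a) (col X a)"
proof -
  let ?d = "\<lambda>j. if j = a then t else 0"
  have "fitted p X ?d i = t * col X a i" for i
    using assms by (simp add: fitted_def col_def sum.delta if_distrib cong: if_cong)
  hence d: "fitted p X ?d = (\<lambda>i. t * col X a i)" by blast
  have "sq_norm n (\<lambda>i. t * col X a i) = t\<^sup>2 * dot n (col X a) (col X a)"
    by (simp add: sq_norm_def dot_def sum_distrib_left power2_eq_square ac_simps)
  moreover have "dot n r (\<lambda>i. t * col X a i) = t * dot n (col X a) r" for r
    by (simp add: dot_def sum_distrib_left algebra_simps)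
  ultimately show ?thesis
    unfolding residual_add sq_norm_residual d by simp
qed

text \<open>
  The first-order condition at a minimum, in the form that serves both for the normal
  equations and for the nonzero coefficients of the lasso.
\<close>

lemma linear_coefficient_vanishes:
  fixes v g e :: real
  assumes "e > 0" "g \<ge> 0" and nonneg: "\<And>t. \<bar>t\<bar> \<le> e \<Longrightarrow> 0 \<le> t * v + t\<^sup>2 * g"
  shows "v = 0"
proof (rule ccontr)
  assume v: "v \<noteq> 0"
  \<comment> \<open>A step against the sign of \<open>v\<close>, short enough for the linear
    term to dominate.\<close>
  define s where "s = min (e / \<bar>v\<bar>) (1 / (2 * g + 1))"
  have s: "s > 0" "s \<le> e / \<bar>v\<bar>" "s \<le> 1 / (2 * g + 1)"
    using assms v by (auto simp: s_def)
  have "s * \<bar>v\<bar> \<le> e" using s v by (simp add: pos_le_divide_eq)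
  hence "0 \<le> (- s * v) * v + (- s * v)\<^sup>2 * g"
    using nonneg[of "- s * v"] s by (simp add: abs_mult)
  hence "0 \<le> s * v\<^sup>2 * (s * g - 1)" by (simp add: power2_eq_square algebra_simps)
  moreover have "s * g < 1"
  proof -
    have "s * (2 * g + 1) \<le> 1" using s assms by (simp add: pos_le_divide_eq)
    moreover have "s * g \<ge> 0" using s assms by simp
    ultimately show ?thesis using s by (simp add: algebra_simps)
  qed
  hence "s * v\<^sup>2 * (s * g - 1) < 0" using s v by (intro mult_pos_neg) auto
  ultimately show False by simp
qed

context nearly_orthogonal
begin

text \<open>
  The value of \<open>least_squares\<close> is a Hilbert choice, of which nothing is known
  until a minimiser exists; near-orthogonality makes the objective coercive.
\<close>

lemma least_squares_attained:
  assumes A: "A \<subseteq> {..<p}" and small: "real (card A) * \<mu> \<le> 1 / 2"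
  shows "least_squares n p X y A \<in> supported_on A"
    and "\<And>b. b \<in> supported_on A \<Longrightarrow> rss n p X y A \<le> sq_norm n (residual p X y b)"
proof -
  let ?F = "\<lambda>b. sq_norm n (residual p X y b)"
  have coercive: "\<bar>b j\<bar> \<le> sqrt (8 * sq_norm n y)"
    if b: "b \<in> supported_on A" "?F b \<le> ?F (\<lambda>_. 0)" for b j
  proof (cases "j \<in> A")
    case True
    have fin: "finite A" using A finite_subset by blast
    have "1 / 2 * (b j)\<^sup>2 \<le> 1 / 2 * (\<Sum>a\<in>A. (b a)\<^sup>2)"
      using fin True by (intro mult_left_mono member_le_sum) auto
    also have "\<dots> \<le> (1 - real (card A) * \<mu>) * (\<Sum>a\<in>A. (b a)\<^sup>2)"
      using small by (intro mult_right_mono sum_nonneg) auto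
    also have "\<dots> \<le> sq_norm n (fitted p X b)"
      using sq_norm_fitted_lower[OF A b(1)] .
    also have "\<dots> \<le> 4 * sq_norm n y"
      using sq_norm_fitted_le[of n p X b y] b(2) unfolding residual_zero by linarith
    finally show ?thesis by (intro real_le_rsqrt) simp
  next
    case False
    thus ?thesis using b(1) by (simp add: supported_on_def)
  qed
  have "\<exists>b\<in>supported_on A. \<forall>b'\<in>supported_on A. ?F b \<le> ?F b'"
    by (rule minimizer_exists[of ?F A "sqrt (8 * sq_norm n y)"], rule continuous_on_sq_norm_residual)
      (use coercive in auto)
  then obtain b where "b \<in> supported_on A" "\<And>b'. b' \<in> supported_on A \<Longrightarrow> ?F b \<le> ?F b'"
    by blast
  from arg_min_on_attained[of b "supported_on A" ?F, OF this]
  show "least_squares n p X y A \<in> supported_on A"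
    and "\<And>b. b \<in> supported_on A \<Longrightarrow> rss n p X y A \<le> sq_norm n (residual p X y b)"
    unfolding rss_def least_squares_def supported_on_def by auto
qed

lemma least_squares_normal_equations:
  assumes A: "A \<subseteq> {..<p}" and small: "real (card A) * \<mu> \<le> 1 / 2" and a: "a \<in> A"
  shows "dot n (col X a) (residual p X y (least_squares n p X y A)) = 0"
proof -
  let ?b = "least_squares n p X y A"
  let ?q = "dot n (col X a) (residual p X y ?b)" and ?g = "dot n (col X a) (col X a)"
  note ls = least_squares_attained[OF A small, where y = y]
  have "0 \<le> t * (- 2 * ?q) + t\<^sup>2 * ?g" for t
  proof -
    have "(\<lambda>j. ?b j + (if j = a then t else 0)) \<in> supported_on A"
      using ls(1) a by (auto simp: supported_on_def)
    from ls(2)[OF this] show ?thesis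
      using sq_norm_residual_single[of a p n X y ?b t] a A unfolding rss_def by fastforce
  qed
  moreover have "0 \<le> ?g" by (simp add: sq_norm_eq_dot[symmetric])
  ultimately have "- 2 * ?q = 0" by (intro linear_coefficient_vanishes[of 1]) auto
  thus ?thesis by simp
qed

text \<open>
  Changing the coefficient of \<open>j\<close> alone, by the step that is optimal in this
  direction, already achieves the gain.
\<close>

lemma rss_insert_le:
  assumes A: "insert j A \<subseteq> {..<p}" and small: "(real (card A) + 1) * \<mu> \<le> 1 / 2"
    and mu: "\<mu> < 1"
  shows "rss n p X y (insert j A) \<le> rss n p X y A
    - (dot n (col X j) (residual p X y (least_squares n p X y A)))\<^sup>2 / (1 + \<mu>)"
proof -
  let ?b = "least_squares n p X y A"
  let ?q = "dot n (col X j) (residual p X y ?b)" and ?g = "dot n (col X j) (col X j)"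
  have j: "j < p" and fin: "finite A" using A finite_subset by auto
  have mu0: "0 \<le> \<mu>" using mu_nonneg j by simp
  have card: "real (card (insert j A)) * \<mu> \<le> 1 / 2" "real (card A) * \<mu> \<le> 1 / 2"
  proof -
    have "real (card (insert j A)) \<le> real (card A) + 1"
      using fin by (simp add: card_insert_if)
    from mult_right_mono[OF this mu0] small show "real (card (insert j A)) * \<mu> \<le> 1 / 2" by linarith
    show "real (card A) * \<mu> \<le> 1 / 2" using small mu0 by (simp add: algebra_simps)
  qed
  have g: "1 - \<mu> \<le> ?g" "?g \<le> 1 + \<mu>" using diagonal[OF j] by auto
  define t where "t = ?q / ?g"
  have gpos: "?g > 0" using g mu by linarith
  have "(\<lambda>i. ?b i + (if i = j then t else 0)) \<in> supported_on (insert j A)"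
    using least_squares_attained(1)[of A y] A card by (auto simp: supported_on_def)
  from least_squares_attained(2)[OF A card(1) this]
  have "rss n p X y (insert j A) \<le> rss n p X y A - 2 * t * ?q + t\<^sup>2 * ?g"
    unfolding sq_norm_residual_single[OF j] by (simp add: rss_def)
  also have "- 2 * t * ?q + t\<^sup>2 * ?g = - ?q\<^sup>2 / ?g"
    using gpos by (simp add: t_def power2_eq_square field_simps)
  hence "rss n p X y A - 2 * t * ?q + t\<^sup>2 * ?g = rss n p X y A - ?q\<^sup>2 / ?g"
    by simp
  also have "\<dots> \<le> rss n p X y A - ?q\<^sup>2 / (1 + \<mu>)"
    using g gpos mu0 by (intro diff_left_mono divide_left_mono) auto
  finally show ?thesis .
qed

text \<open>
  The residual of the fit on \<open>A\<close> is orthogonal to the columns in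
  \<open>A\<close>. So only the coefficient of \<open>j\<close> yields a gain of first
  order, against a quadratic loss that \<open>sq_norm_fitted_lower\<close> bounds below.
\<close>

lemma rss_insert_ge:
  assumes A: "insert j A \<subseteq> {..<p}" "j \<notin> A" and small: "(real (card A) + 1) * \<mu> \<le> 1 / 2"
  shows "rss n p X y A
      - (dot n (col X j) (residual p X y (least_squares n p X y A)))\<^sup>2 / (1 - (real (card A) + 1) * \<mu>)
    \<le> rss n p X y (insert j A)"
proof -
  let ?b = "least_squares n p X y A" and ?b' = "least_squares n p X y (insert j A)"
  let ?r = "residual p X y ?b"
  let ?q = "dot n (col X j) ?r" and ?v = "1 - (real (card A) + 1) * \<mu>"
  have fin: "finite A" using A finite_subset by auto
  have mu0: "0 \<le> \<mu>" using mu_nonneg A by auto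
  have card: "real (card (insert j A)) * \<mu> \<le> 1 / 2" "real (card A) * \<mu> \<le> 1 / 2"
    using fin A small mu0 by (auto simp: card_insert_if algebra_simps)
  define d where "d = (\<lambda>i. ?b' i - ?b i)"
  have supp: "?b \<in> supported_on A" "?b' \<in> supported_on (insert j A)"
    using least_squares_attained(1) A card by auto
  hence d: "d \<in> supported_on (insert j A)"
    by (auto simp: d_def supported_on_def)
  have b': "?b' = (\<lambda>i. ?b i + d i)" by (simp add: d_def)
  have eq: "rss n p X y (insert j A) = sq_norm n ?r - 2 * dot n ?r (fitted p X d) + sq_norm n (fitted p X d)"
    unfolding rss_def by (subst b') (simp only: residual_add sq_norm_residual)
  have cross: "dot n ?r (fitted p X d) = d j * ?q"
    using dot_fitted[OF A(1) d] A fin least_squares_normal_equations[of A _ y] card by simp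
  have quad: "?v * (d j)\<^sup>2 \<le> sq_norm n (fitted p X d)"
  proof -
    have "?v * (d j)\<^sup>2 \<le> ?v * (\<Sum>a\<in>insert j A. (d a)\<^sup>2)"
      using fin small by (intro mult_left_mono member_le_sum) auto
    also have "\<dots> \<le> sq_norm n (fitted p X d)"
      using sq_norm_fitted_lower[OF A(1) d] fin A(2) by (simp add: add.commute)
    finally show ?thesis .
  qed
  have square: "2 * (x * q) - v * x\<^sup>2 \<le> q\<^sup>2 / v" if "v > 0" for v x q :: real
  proof -
    have "0 \<le> (v * x - q)\<^sup>2 / v" using that by simp
    also have "\<dots> = v * x\<^sup>2 - 2 * (x * q) + q\<^sup>2 / v"
      using that by (simp add: power2_eq_square field_simps)
    finally show ?thesis by simp
  qed
  have "?v > 0" using small by linarith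
  from square[OF this, of "d j" ?q] quad eq[unfolded cross] show ?thesis
    by (simp only: rss_def[of n p X y A])
qed

end

section \<open>Selection by the correlation with the response\<close>

text \<open>
  The deterministic situation in which all three procedures are analysed. Here
  \<open>W\<close> bounds all correlations with \<open>y\<close>, some noise variable
  \<open>i0\<close> has correlation at least \<open>\<tau>\<close>, and at most
  \<open>N\<close> variables reach \<open>\<tau> - \<delta>\<close>. Fitting at most
  \<open>N + 1\<close> variables changes the other correlations by at most \<open>2 / 5 *
  \<delta>\<close>. The constant \<open>10\<close> lets the margin \<open>\<delta>\<close>
  cover two such changes, one for \<open>i0\<close> and one for the selected variable, and
  in forward stepwise regression another \<open>1 / 5 * \<delta>\<close> for the different
  lengths of the projected columns.
\<close>

locale separated_noise = nearly_orthogonal +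
  fixes y \<beta> :: "nat \<Rightarrow> real" and \<tau> W \<delta> :: real and N i0 :: nat
  assumes corr_le: "\<And>j. j < p \<Longrightarrow> \<bar>dot n (col X j) y\<bar> \<le> W"
    and noise: "i0 < p" "\<beta> i0 = 0" "\<tau> \<le> \<bar>dot n (col X i0) y\<bar>"
    and few: "card {j. j < p \<and> \<tau> - \<delta> \<le> \<bar>dot n (col X j) y\<bar>} \<le> N"
    and mu_small: "(real N + 1) * \<mu> \<le> 1 / 4"
    and delta: "10 * (real N + 1) * \<mu> * W \<le> \<delta>" "0 < \<delta>" "\<delta> < \<tau>"
begin

definition candidates :: "nat set" where
  "candidates = {j. j < p \<and> \<tau> - \<delta> \<le> \<bar>dot n (col X j) y\<bar>}"

lemma few_candidates: "finite candidates" "candidates \<subseteq> {..<p}" "card candidates \<le> N"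
  using few by (auto simp: candidates_def)

lemma mu_ge_0: "0 \<le> \<mu>" using noise mu_nonneg by auto

lemma W_pos: "0 < W" "\<tau> \<le> W"
  using noise corr_le[of i0] delta by auto

lemma small_set: "card A \<le> N + 1 \<Longrightarrow> real (card A) * \<mu> \<le> 1 / 4"
  using mult_right_mono[of "real (card A)" "real N + 1" \<mu>] mu_ge_0 mu_small by linarith

text \<open>
  The reason why sequential selection agrees with marginal screening. If the correlations of
  the fitted variables with the residual are still at most \<open>W\<close>, then the fit
  itself has correlations at most \<open>2 * W\<close>; by diagonal dominance its $\ell_1$
  norm is of order \<open>N * W\<close>, and every other column sees only the fraction
  \<open>\<mu>\<close> of it. The bound on the correlations holds for all three procedures:
  they are zero for least squares, and at most the current level for the lasso and least
  angle regression.
\<close>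

lemma correlation_persists:
  assumes A: "A \<subseteq> {..<p}" "card A \<le> N + 1" "b \<in> supported_on A"
    and bound: "\<And>a. a \<in> A \<Longrightarrow> \<bar>dot n (col X a) (residual p X y b)\<bar> \<le> W"
    and j: "j < p" "j \<notin> A"
  shows "\<bar>dot n (col X j) (residual p X y b) - dot n (col X j) y\<bar> \<le> 2 / 5 * \<delta>"
proof -
  have "\<bar>dot n (col X a) (fitted p X b)\<bar> \<le> 2 * W" if "a \<in> A" for a
    using bound[OF that] corr_le[of a] that A(1) by (auto simp: dot_residual)
  hence "(\<Sum>a\<in>A. \<bar>b a\<bar>) \<le> 2 * real (card A) * (2 * W)"
    using small_set[OF A(2)] by (intro coefficients_l1_bound A) auto
  also have "\<dots> \<le> 2 * (real N + 1) * (2 * W)"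
    using A(2) W_pos by (intro mult_right_mono) auto
  finally have "\<mu> * (\<Sum>a\<in>A. \<bar>b a\<bar>) \<le> \<mu> * (2 * (real N + 1) * (2 * W))"
    using mu_ge_0 by (intro mult_left_mono)
  also have "\<dots> \<le> 2 / 5 * \<delta>" using delta(1) by (simp add: algebra_simps)
  finally show ?thesis
    using off_support_bound[OF A(1,3) j] by (simp add: dot_residual)
qed

text \<open>
  It remains to show for each procedure that some noise variable enters and that every
  signal variable entering before all noise variables is a candidate. The time
  \<open>t\<close> stands for the first entry of a noise variable.
\<close>

lemma first_noise_rank_le:
  assumes i: "i < p" "\<beta> i = 0" "entry i < \<infinity>"
    and before: "\<And>j t. j < p \<Longrightarrow> \<beta> j \<noteq> 0 \<Longrightarrow> entry j < t \<Longrightarrow>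
      (\<And>i. i < p \<Longrightarrow> \<beta> i = 0 \<Longrightarrow> t \<le> entry i) \<Longrightarrow> j \<in> candidates"
  shows "first_noise_rank p \<beta> entry \<le> enat (N + 1)"
proof -
  let ?t = "INF i \<in> {i. i < p \<and> \<beta> i = 0}. entry i"
  have "?t \<le> entry i" using i by (intro INF_lower) auto
  hence "?t \<noteq> \<infinity>" using i by auto
  moreover have "{j. j < p \<and> \<beta> j \<noteq> 0 \<and> entry j < ?t} \<subseteq> candidates"
  proof safe
    fix j assume j: "j < p" "\<beta> j \<noteq> 0" "entry j < ?t"
    show "j \<in> candidates"
      by (rule before[OF j]) (auto intro: INF_lower)
  qed
  hence "card {j. j < p \<and> \<beta> j \<noteq> 0 \<and> entry j < ?t} \<le> N"
    using card_mono[OF few_candidates(1)] few_candidates(3) le_trans by blast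
  ultimately show ?thesis by (simp add: first_noise_rank_def)
qed

section \<open>Forward stepwise regression\<close>

text \<open>
  The drop of the residual sum of squares is the squared correlation with the residual,
  divided by a factor that lies between \<open>1 - v\<close> and \<open>1 + \<mu>\<close>.
  So the selected variable \<open>j\<close> has nearly as large a correlation with the
  residual as \<open>i0\<close>, and by \<open>correlation_persists\<close> also with
  \<open>y\<close>.
\<close>

lemma forward_stepwise_choice:
  assumes A: "A \<subseteq> {..<p}" "card A \<le> N" "i0 \<notin> A"
    and j: "j < p" "j \<notin> A" "rss n p X y (insert j A) \<le> rss n p X y (insert i0 A)"
  shows "j \<in> candidates"
proof -
  let ?b = "least_squares n p X y A"
  let ?q = "\<lambda>i. dot n (col X i) (residual p X y ?b)"
  define v where "v = (real (card A) + 1) * \<mu>"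
  have v: "0 \<le> v" "v \<le> (real N + 1) * \<mu>" "\<mu> \<le> (real N + 1) * \<mu>"
    using A(2) mu_ge_0 mult_right_mono[of "real (card A)" "real N" \<mu>] by (auto simp: v_def algebra_simps)
  have v4: "v \<le> 1 / 4" "\<mu> \<le> 1 / 4" using v mu_small by linarith+
  have card: "real (card A) * \<mu> \<le> 1 / 2" using small_set[of A] A(2) by linarith
  have "(?q i0)\<^sup>2 / (1 + \<mu>) \<le> (?q j)\<^sup>2 / (1 - v)"
    using rss_insert_le[of i0 A y] rss_insert_ge[of j A y] A j noise v4
    by (auto simp: v_def) 
  hence "(?q i0)\<^sup>2 \<le> (?q j)\<^sup>2 / (1 - v) * (1 + \<mu>)"
    using mu_ge_0 by (simp add: pos_divide_le_eq)
  hence "(?q i0)\<^sup>2 * (1 - v) \<le> (?q j)\<^sup>2 * (1 + \<mu>)"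
    using v4 by (simp add: field_simps)
  hence "(?q i0)\<^sup>2 * (1 - v) * (1 - \<mu>) \<le> (?q j)\<^sup>2 * (1 + \<mu>) * (1 - \<mu>)"
    using v4 by (intro mult_right_mono) auto
  also have "(?q j)\<^sup>2 * (1 + \<mu>) * (1 - \<mu>) \<le> (?q j)\<^sup>2"
    using mult_left_mono[of "(1 + \<mu>) * (1 - \<mu>)" 1 "(?q j)\<^sup>2"] by (simp add: algebra_simps)
  finally have sq: "(?q i0)\<^sup>2 * ((1 - v) * (1 - \<mu>)) \<le> (?q j)\<^sup>2" by (simp add: mult.assoc)
  have "(\<bar>?q i0\<bar> * (1 - (v + \<mu>)))\<^sup>2 = (?q i0)\<^sup>2 * (1 - (v + \<mu>))\<^sup>2"
    by (simp add: power_mult_distrib)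
  also have "\<dots> \<le> (?q i0)\<^sup>2 * ((1 - v) * (1 - \<mu>))"
  proof (intro mult_left_mono)
    have "(1 - (v + \<mu>)) * (1 - (v + \<mu>)) \<le> (1 - v) * (1 - \<mu>)"
      using v v4 mu_ge_0 by (intro mult_mono) auto
    thus "(1 - (v + \<mu>))\<^sup>2 \<le> (1 - v) * (1 - \<mu>)" by (simp add: power2_eq_square)
  qed simp
  also note sq
  finally have qj: "\<bar>?q i0\<bar> * (1 - (v + \<mu>)) \<le> \<bar>?q j\<bar>"
    using abs_le_square_iff[of "\<bar>?q i0\<bar> * (1 - (v + \<mu>))" "?q j"] v4
    by (simp add: abs_mult)
  have pers: "\<bar>?q i - dot n (col X i) y\<bar> \<le> 2 / 5 * \<delta>" if "i < p" "i \<notin> A" for i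
    using A that least_squares_attained(1)[OF A(1) card] W_pos
      least_squares_normal_equations[OF A(1) card]
    by (intro correlation_persists[of A]) auto
  have q0: "\<tau> - 2 / 5 * \<delta> \<le> \<bar>?q i0\<bar>" using pers[of i0] noise A(3) by linarith
  have "(\<tau> - 2 / 5 * \<delta>) - 1 / 5 * \<delta> \<le> (\<tau> - 2 / 5 * \<delta>) * (1 - (v + \<mu>))"
  proof -
    have "(\<tau> - 2 / 5 * \<delta>) * (v + \<mu>) \<le> W * (2 * ((real N + 1) * \<mu>))"
      using v W_pos delta mu_ge_0 by (intro mult_mono) auto
    also have "\<dots> \<le> 1 / 5 * \<delta>" using delta(1) by (simp add: algebra_simps)
    finally show ?thesis unfolding right_diff_distrib mult_1_right by (rule diff_left_mono)
  qed
  also have "\<dots> \<le> \<bar>?q i0\<bar> * (1 - (v + \<mu>))"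
    using q0 v4 by (intro mult_right_mono) auto
  finally have "\<tau> - \<delta> \<le> \<bar>dot n (col X j) y\<bar>"
    using qj pers[of j] j by linarith
  thus ?thesis using j by (simp add: candidates_def)
qed

lemma fs_selected_step:
  assumes "fs_selected n p X y m \<noteq> {..<p}"
  shows "fs_selected n p X y (Suc m) =
    insert (arg_min_on (\<lambda>j. rss n p X y (insert j (fs_selected n p X y m)))
      ({..<p} - fs_selected n p X y m)) (fs_selected n p X y m)"
  using assms unfolding fs_selected.simps Let_def by (rule if_not_P)

lemma fs_selected_subset: "fs_selected n p X y m \<subseteq> {..<p}"
proof (induction m)
  case 0
  show ?case by simp
next
  case (Suc m)
  let ?A = "fs_selected n p X y m"
  show ?case
  proof (cases "?A = {..<p}")
    case True
    thus ?thesis by (simp only: fs_selected.simps Let_def if_P order_refl)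
  next
    case False
    hence "{..<p} - ?A \<noteq> {}" using Suc by blast
    hence "arg_min_on (\<lambda>j. rss n p X y (insert j ?A)) ({..<p} - ?A) \<in> {..<p} - ?A"
      by (intro arg_min_if_finite) auto
    thus ?thesis unfolding fs_selected_step[OF False] using Suc by blast
  qed
qed

text \<open>
  Every step adds a new candidate, so the first \<open>N + 1\<close> steps cannot all select
  signals.
\<close>

lemma fs_selected_signals:
  assumes "m \<le> N + 1" "\<forall>i\<in>fs_selected n p X y m. \<beta> i \<noteq> 0"
  shows "fs_selected n p X y m \<subseteq> candidates \<and> card (fs_selected n p X y m) = m"
  using assms
proof (induction m)
  case (Suc m)
  let ?A = "fs_selected n p X y m"
  let ?f = "\<lambda>j. rss n p X y (insert j ?A)"
  define j where "j = arg_min_on ?f ({..<p} - ?A)"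
  have "?A \<subseteq> fs_selected n p X y (Suc m)"
    unfolding fs_selected.simps Let_def by (simp split: if_split add: subset_insertI)
  hence sig: "\<forall>i\<in>?A. \<beta> i \<noteq> 0" using Suc.prems by blast
  hence IH: "?A \<subseteq> candidates" "card ?A = m" using Suc by auto
  have i0: "i0 \<in> {..<p} - ?A" using sig noise by auto
  have j: "j \<in> {..<p} - ?A" "?f j \<le> ?f i0"
    using arg_min_if_finite(1)[of "{..<p} - ?A" ?f] arg_min_least[of "{..<p} - ?A" i0 ?f] i0
    by (auto simp: j_def)
  have "j \<in> candidates"
    using fs_selected_subset[of m] IH Suc.prems i0 j by (intro forward_stepwise_choice[of ?A]) auto
  moreover have "fs_selected n p X y (Suc m) = insert j ?A"
    unfolding j_def using i0 by (intro fs_selected_step) blast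
  moreover have "finite ?A" using IH few_candidates finite_subset by blast
  ultimately show ?case using IH j by auto
qed simp

theorem forward_stepwise_rank: "first_noise_rank p \<beta> (fs_entry n p X y) \<le> enat (N + 1)"
proof -
  have "\<not> (\<forall>i\<in>fs_selected n p X y (N + 1). \<beta> i \<noteq> 0)"
    using fs_selected_signals[of "N + 1"] card_mono[OF few_candidates(1)] few_candidates(3) by fastforce
  then obtain i where i: "i \<in> fs_selected n p X y (N + 1)" "\<beta> i = 0" by blast
  have entry: "fs_entry n p X y j \<le> ereal (real m)" if "j \<in> fs_selected n p X y m" for j m
    unfolding fs_entry_def using that by (intro INF_lower) auto
  show ?thesis
  proof (rule first_noise_rank_le)
    show "i < p" using i fs_selected_subset by blast
    show "fs_entry n p X y i < \<infinity>" using entry[OF i(1)] by (rule le_less_trans) simp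
    fix j t assume lt: "fs_entry n p X y j < t" and t: "\<And>i. i < p \<Longrightarrow> \<beta> i = 0 \<Longrightarrow> t \<le> fs_entry n p X y i"
    obtain m where m: "j \<in> fs_selected n p X y m" "ereal (real m) < t"
      using lt by (auto simp: fs_entry_def INF_less_iff)
    have before: "m < m'" if "i' \<in> fs_selected n p X y m'" "\<beta> i' = 0" for i' m'
    proof -
      have "ereal (real m) < ereal (real m')"
        using m(2) t[of i'] entry[OF that(1)] that fs_selected_subset[of m'] 
        by (meson lessThan_iff less_le_trans subsetD)
      thus ?thesis by simp
    qed
    have "m \<le> N + 1" using before[OF i] by simp
    moreover have "\<forall>i\<in>fs_selected n p X y m. \<beta> i \<noteq> 0" using before by blast
    ultimately show "j \<in> candidates" using fs_selected_signals m(1) by blast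
  qed (use i in auto)
qed

end

section \<open>The lasso\<close>

definition lasso_objective ::
  "nat \<Rightarrow> nat \<Rightarrow> (nat \<Rightarrow> nat \<Rightarrow> real) \<Rightarrow> (nat \<Rightarrow> real) \<Rightarrow> real \<Rightarrow> (nat \<Rightarrow> real) \<Rightarrow> real"
where
  "lasso_objective n p X y lam b = 1 / 2 * sq_norm n (residual p X y b) + lam * (\<Sum>j<p. \<bar>b j\<bar>)"

lemma lasso_minimizer_exists:
  assumes lam: "lam > 0" and A: "A \<subseteq> {..<p}"
  obtains b where "b \<in> supported_on A"
    "\<And>b'. b' \<in> supported_on A \<Longrightarrow> lasso_objective n p X y lam b \<le> lasso_objective n p X y lam b'"
proof (rule minimizer_exists[of "lasso_objective n p X y lam" A "sq_norm n y / (2 * lam)"])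
  show "continuous_on UNIV (lasso_objective n p X y lam)"
    unfolding lasso_objective_def
    by (intro continuous_intros continuous_on_sq_norm_residual continuous_on_product_coordinates)
next
  fix b :: "nat \<Rightarrow> real" and j
  assume b: "b \<in> supported_on A"
    and le: "lasso_objective n p X y lam b \<le> lasso_objective n p X y lam (\<lambda>_. 0)"
  show "\<bar>b j\<bar> \<le> sq_norm n y / (2 * lam)"
  proof (cases "j \<in> A")
    case True
    have "lam * \<bar>b j\<bar> \<le> lam * (\<Sum>i<p. \<bar>b i\<bar>)"
      using True A lam by (intro mult_left_mono member_le_sum) auto
    also have "\<dots> \<le> lasso_objective n p X y lam b"
      by (simp add: lasso_objective_def)
    also have "\<dots> \<le> sq_norm n y / 2"
      using le by (simp add: lasso_objective_def residual_zero)
    finally show ?thesis using lam by (simp add: pos_le_divide_eq algebra_simps)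
  next
    case False
    thus ?thesis using b lam by (simp add: supported_on_def)
  qed
qed (use that in blast)

lemma lasso_minimizes:
  assumes "lam > 0"
  shows "lasso n p X y lam \<in> supported_on {..<p}"
    and "b \<in> supported_on {..<p} \<Longrightarrow>
      lasso_objective n p X y lam (lasso n p X y lam) \<le> lasso_objective n p X y lam b"
proof -
  obtain b0 where b0: "b0 \<in> supported_on {..<p}" "\<And>b'. b' \<in> supported_on {..<p} \<Longrightarrow>
      lasso_objective n p X y lam b0 \<le> lasso_objective n p X y lam b'"
    by (rule lasso_minimizer_exists[OF assms order_refl, where n = n and p = p and X = X and y = y]) blast
  have "lasso n p X y lam = arg_min_on (lasso_objective n p X y lam) (supported_on {..<p})"
    unfolding lasso_def supported_on_def lasso_objective_def[abs_def] by (simp add: not_less)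
  with arg_min_on_attained[of b0 "supported_on {..<p}" "lasso_objective n p X y lam"] b0
  show "lasso n p X y lam \<in> supported_on {..<p}"
    and "b \<in> supported_on {..<p} \<Longrightarrow>
      lasso_objective n p X y lam (lasso n p X y lam) \<le> lasso_objective n p X y lam b"
    by auto
qed

text \<open>
  The Karush--Kuhn--Tucker conditions, from perturbing a single coefficient. They are needed
  for minimisation over the vectors supported on a subset \<open>A\<close> as well.
\<close>

lemma lasso_optimality:
  assumes lam: "lam > 0" and A: "A \<subseteq> {..<p}" and b: "b \<in> supported_on A"
    and minimal: "\<And>b'. b' \<in> supported_on A \<Longrightarrow>
      lasso_objective n p X y lam b \<le> lasso_objective n p X y lam b'"
    and a: "a \<in> A"
  shows "\<bar>dot n (col X a) (residual p X y b)\<bar> \<le> lam"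
    and "b a * dot n (col X a) (residual p X y b) = lam * \<bar>b a\<bar>"
proof -
  let ?q = "dot n (col X a) (residual p X y b)" and ?g = "dot n (col X a) (col X a)"
  have ap: "a < p" using a A by auto
  have g: "0 \<le> ?g" by (simp add: sq_norm_eq_dot[symmetric])
  have perturb: "0 \<le> - t * ?q + t\<^sup>2 * ?g / 2 + lam * (\<bar>b a + t\<bar> - \<bar>b a\<bar>)" for t
  proof -
    let ?b = "\<lambda>j. b j + (if j = a then t else 0)"
    have "?b \<in> supported_on A" using b a by (auto simp: supported_on_def)
    from minimal[OF this] have "0 \<le> lasso_objective n p X y lam ?b - lasso_objective n p X y lam b"
      by simp
    also have "\<dots> = - t * ?q + t\<^sup>2 * ?g / 2 + lam * ((\<Sum>j<p. \<bar>?b j\<bar>) - (\<Sum>j<p. \<bar>b j\<bar>))"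
      unfolding lasso_objective_def sq_norm_residual_single[OF ap] by (simp add: algebra_simps)
    also have "(\<Sum>j<p. \<bar>?b j\<bar>) - (\<Sum>j<p. \<bar>b j\<bar>) = \<bar>b a + t\<bar> - \<bar>b a\<bar>"
      using ap by (simp add: sum.remove[of "{..<p}" a])
    finally show ?thesis .
  qed
  show bound: "\<bar>?q\<bar> \<le> lam"
  proof (rule ccontr)
    assume "\<not> \<bar>?q\<bar> \<le> lam"
    \<comment> \<open>A small step in the direction of the correlation would lower the
      objective.\<close>
    define e where "e = \<bar>?q\<bar> - lam"
    have e: "e > 0" using \<open>\<not> \<bar>?q\<bar> \<le> lam\<close> by (simp add: e_def)
    define s where "s = e / (?g + 1)"
    have s: "s > 0" "s * (?g + 1) = e" using e g by (auto simp: s_def)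
    define t where "t = s * sgn ?q"
    have q0: "?q \<noteq> 0" using e lam by (auto simp: e_def)
    have "t * ?q = s * \<bar>?q\<bar>" by (simp add: t_def abs_sgn[of ?q] mult.assoc mult.commute)
    moreover have "t\<^sup>2 = s\<^sup>2" using q0 by (simp add: t_def power_mult_distrib sgn_if)
    moreover have "\<bar>b a + t\<bar> - \<bar>b a\<bar> \<le> s"
      using s(1) q0 by (auto simp: t_def sgn_if)
    hence "lam * (\<bar>b a + t\<bar> - \<bar>b a\<bar>) \<le> lam * s" using lam by (intro mult_left_mono) auto
    ultimately have "0 \<le> - s * \<bar>?q\<bar> + s\<^sup>2 * ?g / 2 + lam * s"
      using perturb[of t] by simp
    also have "\<dots> = s * (s * ?g / 2 - e)"
      by (simp add: e_def power2_eq_square algebra_simps)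
    finally have "0 \<le> s * ?g / 2 - e" using s(1) by (simp add: zero_le_mult_iff)
    moreover have "s * ?g + s = e" using s(2) by (simp add: algebra_simps)
    moreover have "0 \<le> s * ?g" using s(1) g by simp
    ultimately show False using s(1) by linarith
  qed
  show "b a * ?q = lam * \<bar>b a\<bar>"
  proof (cases "b a = 0")
    case False
    have "lam * sgn (b a) - ?q = 0"
    proof (rule linear_coefficient_vanishes[of "\<bar>b a\<bar>" "?g / 2"])
      fix t assume t: "\<bar>t\<bar> \<le> \<bar>b a\<bar>"
      have "\<bar>b a + t\<bar> - \<bar>b a\<bar> = sgn (b a) * t"
        using t False by (auto simp: sgn_if)
      thus "0 \<le> t * (lam * sgn (b a) - ?q) + t\<^sup>2 * (?g / 2)"
        using perturb[of t] by (simp add: algebra_simps)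
    qed (use False g in auto)
    hence "?q = lam * sgn (b a)" by simp
    thus ?thesis by (simp add: sgn_if)
  qed simp
qed

text \<open>
  If the conditions hold for \<open>b'\<close>, strictly outside of its support set
  \<open>H\<close>, then convexity compares every competitor with it: the objective exceeds
  that of \<open>b'\<close> by at least the sum of the nonnegative gaps \<open>lam * \<bar>b
  j\<bar> - b j * q j\<close>, where \<open>q j\<close> is the correlation of the residual
  of \<open>b'\<close>. Hence all gaps vanish at every minimiser.
\<close>

lemma lasso_support:
  assumes H: "H \<subseteq> {..<p}" and b': "b' \<in> supported_on H"
    and on: "\<And>a. a \<in> H \<Longrightarrow> \<bar>dot n (col X a) (residual p X y b')\<bar> \<le> lam"
      "\<And>a. a \<in> H \<Longrightarrow> b' a * dot n (col X a) (residual p X y b') = lam * \<bar>b' a\<bar>"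
    and off: "\<And>j. j < p \<Longrightarrow> j \<notin> H \<Longrightarrow> \<bar>dot n (col X j) (residual p X y b')\<bar> < lam"
    and b: "b \<in> supported_on {..<p}"
      "lasso_objective n p X y lam b \<le> lasso_objective n p X y lam b'"
  shows "b \<in> supported_on H"
proof -
  let ?q = "\<lambda>j. dot n (col X j) (residual p X y b')"
  define d where "d = (\<lambda>j. b j - b' j)"
  have d: "d \<in> supported_on {..<p}" using b(1) b' H by (auto simp: d_def supported_on_def)
  have gap_nonneg: "0 \<le> lam * \<bar>b j\<bar> - b j * ?q j" if "j < p" for j
  proof -
    have "\<bar>?q j\<bar> \<le> lam" using on(1)[of j] off[of j] that by fastforce
    hence "\<bar>b j * ?q j\<bar> \<le> \<bar>b j\<bar> * lam" unfolding abs_mult by (intro mult_left_mono) auto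
    thus ?thesis by (simp add: mult.commute)
  qed
  have gap': "b' j * ?q j = lam * \<bar>b' j\<bar>" if "j < p" for j
    using on(2)[of j] b' by (cases "j \<in> H") (auto simp: supported_on_def)
  have "sq_norm n (residual p X y b) = sq_norm n (residual p X y b')
      - 2 * (\<Sum>j<p. d j * ?q j) + sq_norm n (fitted p X d)"
  proof -
    have "residual p X y b = residual p X (residual p X y b') d"
      using residual_add[of p X y b' d] by (simp add: d_def)
    thus ?thesis using dot_fitted[OF order_refl d] by (simp add: sq_norm_residual)
  qed
  hence "lasso_objective n p X y lam b - lasso_objective n p X y lam b' \<ge>
      lam * (\<Sum>j<p. \<bar>b j\<bar>) - lam * (\<Sum>j<p. \<bar>b' j\<bar>) - (\<Sum>j<p. d j * ?q j)"
    using sq_norm_nonneg[of n "fitted p X d"] unfolding lasso_objective_def by linarith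
  also have "lam * (\<Sum>j<p. \<bar>b j\<bar>) - lam * (\<Sum>j<p. \<bar>b' j\<bar>) - (\<Sum>j<p. d j * ?q j)
      = (\<Sum>j<p. lam * \<bar>b j\<bar> - b j * ?q j)"
    using gap' by (simp add: sum_distrib_left sum_subtractf[symmetric] d_def algebra_simps)
  finally have "(\<Sum>j<p. lam * \<bar>b j\<bar> - b j * ?q j) \<le> 0" using b(2) by linarith
  hence zero: "lam * \<bar>b j\<bar> - b j * ?q j = 0" if "j < p" for j
    using that gap_nonneg sum_nonneg_eq_0_iff[of "{..<p}" "\<lambda>j. lam * \<bar>b j\<bar> - b j * ?q j"]
      sum_nonneg[of "{..<p}" "\<lambda>j. lam * \<bar>b j\<bar> - b j * ?q j"] by force
  have "b j = 0" if "j \<notin> H" for j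
  proof (cases "j < p")
    case True
    have "lam * \<bar>b j\<bar> = b j * ?q j" using zero[OF True] by simp
    also have "\<dots> \<le> \<bar>b j\<bar> * \<bar>?q j\<bar>" using abs_ge_self[of "b j * ?q j"] by (simp add: abs_mult)
    finally have "\<bar>b j\<bar> * (lam - \<bar>?q j\<bar>) \<le> 0" by (simp add: algebra_simps)
    thus ?thesis using off[OF True that] by (simp add: mult_le_0_iff)
  qed (use b(1) in \<open>auto simp: supported_on_def\<close>)
  thus ?thesis by (simp add: supported_on_def)
qed

context separated_noise
begin

text \<open>
  A variable may leave the active set along the path, so every \<open>lam\<close> is treated
  on its own. The minimiser over the few candidates satisfies the optimality conditions on
  all variables, because its residual has correlations below \<open>lam\<close> elsewhere;
  by \<open>lasso_support\<close> it determines the support of the lasso. The threshold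
  \<open>\<tau> - \<delta> / 2\<close> is above what a variable that is no candidate can
  reach after a change by \<open>2 / 5 * \<delta>\<close>, and below what \<open>i0\<close>
  keeps.
\<close>

lemma lasso_supported_on_candidates:
  assumes lam: "\<tau> - \<delta> / 2 \<le> lam"
  shows "lasso n p X y lam \<in> supported_on candidates"
proof -
  have pos: "lam > 0" using lam delta by linarith
  show ?thesis
  proof (cases "W < lam")
    case True
    \<comment> \<open>Above all correlations the zero vector is the certificate.\<close>
    have "lasso n p X y lam \<in> supported_on {}"
      by (rule lasso_support[of "{}" p "\<lambda>_. 0" n X y lam])
        (use corr_le True lasso_minimizes[OF pos] in
          \<open>auto simp: supported_on_def residual_zero intro: le_less_trans\<close>)
    thus ?thesis by (auto simp: supported_on_def)
  next
    case False
    obtain b where b: "b \<in> supported_on candidates" "\<And>b'. b' \<in> supported_on candidates \<Longrightarrow>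
        lasso_objective n p X y lam b \<le> lasso_objective n p X y lam b'"
      by (rule lasso_minimizer_exists[OF pos few_candidates(2), where n = n and X = X and y = y]) blast
    note opt = lasso_optimality[OF pos few_candidates(2) b]
    have off: "\<bar>dot n (col X j) (residual p X y b)\<bar> < lam" if j: "j < p" "j \<notin> candidates" for j
    proof -
      have "\<bar>dot n (col X j) (residual p X y b) - dot n (col X j) y\<bar> \<le> 2 / 5 * \<delta>"
        using few_candidates b opt(1) False j by (intro correlation_persists[of candidates]) fastforce+
      moreover have "\<bar>dot n (col X j) y\<bar> < \<tau> - \<delta>" using j by (simp add: candidates_def)
      ultimately show ?thesis using lam delta by linarith
    qed
    have "b \<in> supported_on {..<p}" using b(1) few_candidates(2) by (auto simp: supported_on_def)
    from lasso_support[OF few_candidates(2) b(1) opt off lasso_minimizes(1)[OF pos] lasso_minimizes(2)[OF pos this]]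
    show ?thesis .
  qed
qed

text \<open>
  Otherwise the fit would be supported on few signals, the correlation of \<open>i0\<close>
  with the residual would exceed the penalty, and the optimality conditions would fail at
  \<open>i0\<close>.
\<close>

lemma lasso_selects_noise:
  obtains i where "i < p" "\<beta> i = 0" "lasso n p X y (\<tau> - \<delta> / 2) i \<noteq> 0"
proof (rule ccontr)
  let ?lam = "\<tau> - \<delta> / 2"
  let ?b = "lasso n p X y ?lam" and ?A = "{j\<in>candidates. \<beta> j \<noteq> 0}"
  assume contra: "\<not> thesis"
  note selected = that
  have none: "?b i = 0" if "i < p" "\<beta> i = 0" for i
    using selected contra that by blast
  have pos: "?lam > 0" using delta by linarith
  have b: "?b \<in> supported_on ?A"
    using lasso_supported_on_candidates[of ?lam] none few_candidates(2) by (auto simp: supported_on_def)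
  have opt: "\<bar>dot n (col X a) (residual p X y ?b)\<bar> \<le> ?lam" if "a < p" for a
    using lasso_optimality(1)[OF pos order_refl lasso_minimizes[OF pos]] that by blast
  have "\<bar>dot n (col X i0) (residual p X y ?b) - dot n (col X i0) y\<bar> \<le> 2 / 5 * \<delta>"
  proof (rule correlation_persists[of ?A])
    show "card ?A \<le> N + 1" using few_candidates card_mono[OF few_candidates(1), of ?A] by auto
    fix a assume "a \<in> ?A"
    hence "a < p" using few_candidates(2) by blast
    from opt[OF this] show "\<bar>dot n (col X a) (residual p X y ?b)\<bar> \<le> W"
      using W_pos delta by linarith
  qed (use few_candidates noise b in auto)
  thus False using opt[OF noise(1)] noise delta by linarith
qed

theorem lasso_rank: "first_noise_rank p \<beta> (lasso_entry n p X y) \<le> enat (N + 1)"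
proof -
  let ?lam = "\<tau> - \<delta> / 2"
  have pos: "?lam > 0" using delta by linarith
  obtain i where i: "i < p" "\<beta> i = 0" "lasso n p X y ?lam i \<noteq> 0"
    by (rule lasso_selects_noise)
  have entry: "lasso_entry n p X y i \<le> ereal (- ?lam)"
    unfolding lasso_entry_def using pos i(3) by (intro INF_lower) auto
  show ?thesis
  proof (rule first_noise_rank_le)
    show "lasso_entry n p X y i < \<infinity>" using entry by (rule le_less_trans) simp
    fix j t assume lt: "lasso_entry n p X y j < t"
      and t: "\<And>i. i < p \<Longrightarrow> \<beta> i = 0 \<Longrightarrow> t \<le> lasso_entry n p X y i"
    obtain lam where lam: "lasso n p X y lam j \<noteq> 0" "ereal (- lam) < t"
      using lt by (auto simp: lasso_entry_def INF_less_iff)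
    have "ereal (- lam) < ereal (- ?lam)"
      using lam(2) t[OF i(1,2)] entry by order
    hence "?lam \<le> lam" by simp
    thus "j \<in> candidates" using lasso_supported_on_candidates lam(1) supported_on_outside by blast
  qed (use i in auto)
qed

end

section \<open>Least angle regression\<close>

context separated_noise
begin

definition lar_state :: "nat set \<Rightarrow> (nat \<Rightarrow> real) \<Rightarrow> real \<Rightarrow> bool" where
  "lar_state A b lam \<longleftrightarrow> A \<subseteq> {..<p} \<and> A \<noteq> {} \<and> b \<in> supported_on A \<and> lam \<le> W \<and>
     (\<forall>a\<in>A. \<bar>dot n (col X a) (residual p X y b)\<bar> = lam) \<and>
     (\<forall>j<p. \<bar>dot n (col X j) (residual p X y b)\<bar> \<le> lam)"

text \<open>
  Along the joint least-squares direction all active correlations shrink by the factor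
  \<open>1 - g\<close>, and those of the other variables are affine in \<open>g\<close>. The
  first time at which one of them catches up exists because the set of such times is closed,
  and up to then none is ahead. The move cannot reach residual zero, since the correlation
  of \<open>i0\<close> with the residual does not vanish.
\<close>

lemma lar_step_state:
  assumes st: "lar_state A b lam" and card: "card A \<le> N + 1" and i0: "i0 \<notin> A"
  obtains j b' lam' where "lar_step n p X y (A, b) = (insert j A, b')"
    "j < p" "j \<notin> A" "b' \<in> supported_on A" "lar_state (insert j A) b' lam'"
proof -
  let ?r = "residual p X y b"
  define d where "d = least_squares n p X ?r A"
  define move where "move = (\<lambda>g j. b j + g * d j)"
  define caught where "caught = (\<lambda>g. {j \<in> {..<p} - A. \<forall>a\<in>A.
     abs_corr n X (residual p X y (move g)) j \<ge> abs_corr n X (residual p X y (move g)) a})"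
  define G where "G = {g \<in> {0..1::real}. caught g \<noteq> {}}"
  define g where "g = Inf G"
  define q where "q = (\<lambda>j. dot n (col X j) ?r)"
  define e where "e = (\<lambda>j. dot n (col X j) (fitted p X d))"
  have A: "A \<subseteq> {..<p}" "A \<noteq> {}" and b: "b \<in> supported_on A" and lamW: "lam \<le> W"
    and on: "\<And>a. a \<in> A \<Longrightarrow> \<bar>q a\<bar> = lam" and all: "\<And>j. j < p \<Longrightarrow> \<bar>q j\<bar> \<le> lam"
    using st by (auto simp: lar_state_def q_def)
  have small: "real (card A) * \<mu> \<le> 1 / 2" using small_set[OF card] by linarith
  have d: "d \<in> supported_on A" unfolding d_def by (rule least_squares_attained[OF A(1) small])
  have lam0: "0 \<le> lam" using all[OF noise(1)] by linarith
  have move_corr: "dot n (col X j) (residual p X y (move s)) = q j - s * e j" for j s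
  proof -
    have "residual p X y (move s) = residual p X ?r (\<lambda>j. s * d j)"
      unfolding move_def by (rule residual_add)
    moreover have "dot n (col X j) (fitted p X (\<lambda>j. s * d j)) = s * e j"
      by (simp add: e_def dot_def fitted_scale sum_distrib_left algebra_simps)
    ultimately show ?thesis by (simp add: dot_residual q_def)
  qed
  have e_on: "e a = q a" if "a \<in> A" for a
    using least_squares_normal_equations[OF A(1) small that, of ?r]
    by (simp add: dot_residual d_def[symmetric] e_def q_def)
  have move_on: "\<bar>q a - s * e a\<bar> = (1 - s) * lam" if "a \<in> A" "s \<le> 1" for a s
  proof -
    have "q a - s * e a = (1 - s) * q a" using e_on[OF that(1)] by (simp add: algebra_simps)
    thus ?thesis using on[OF that(1)] that(2) by (simp add: abs_mult)
  qed
  have caught_iff: "caught s = {j \<in> {..<p} - A. (1 - s) * lam \<le> \<bar>q j - s * e j\<bar>}" if "s \<le> 1" for s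
    using A(2) that by (auto simp: caught_def abs_corr_eq_dot move_corr move_on)
  have G_eq: "G = (\<Union>j\<in>{..<p} - A. {s \<in> {0..1}. (1 - s) * lam \<le> \<bar>q j - s * e j\<bar>})"
    unfolding G_def by (auto simp: caught_iff)
  have "closed {s \<in> {0..1}. (1 - s) * lam \<le> \<bar>q j - s * e j\<bar>}" for j
  proof -
    have "closed ({0..1} \<inter> {s. (1 - s) * lam \<le> \<bar>q j - s * e j\<bar>})"
      by (intro closed_Int closed_Collect_le continuous_intros closed_atLeastAtMost)
    thus ?thesis by (simp add: Int_def)
  qed
  hence "closed G" unfolding G_eq by (intro closed_UN) auto
  moreover have "1 \<in> G" unfolding G_eq using noise(1) i0 by auto
  moreover have "bdd_below G" by (rule bdd_belowI[of _ 0]) (auto simp: G_def)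
  ultimately have gG: "g \<in> G" and g_min: "\<And>s. s \<in> G \<Longrightarrow> g \<le> s"
    unfolding g_def by (auto intro: closed_contains_Inf cInf_lower)
  have g01: "0 \<le> g" "g \<le> 1" using gG by (auto simp: G_def)
  have move_all: "\<bar>q j - g * e j\<bar> \<le> (1 - g) * lam" if j: "j < p" for j
  proof (cases "j \<in> A")
    case True
    thus ?thesis using move_on g01 by simp
  next
    case False
    show ?thesis
    proof (rule ccontr)
      let ?h = "\<lambda>s. \<bar>q j - s * e j\<bar> - (1 - s) * lam"
      assume "\<not> ?thesis"
      hence pos: "0 < ?h g" by simp
      have "?h 0 \<le> 0" using all[OF j] by simp
      moreover have "continuous_on {0..g} ?h" by (intro continuous_intros)
      \<comment> \<open>If \<open>j\<close> were ahead at time \<open>g\<close>, it would have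
        caught up at an earlier time.\<close>
      ultimately obtain s where s: "0 \<le> s" "s \<le> g" "?h s = 0"
        using IVT'[of ?h 0 0 g] pos g01 by auto
      have "s \<in> G" unfolding G_eq using s g01 False j by (intro UN_I[of j]) auto
      with g_min s have "s = g" by fastforce
      thus False using s pos by simp
    qed
  qed
  have b': "move g \<in> supported_on A"
    using b d by (auto simp: supported_on_def move_def)
  have lamg: "(1 - g) * lam \<le> W"
    using mult_right_mono[of "1 - g" 1 lam] g01 lam0 lamW by auto
  have "\<bar>dot n (col X i0) (residual p X y (move g)) - dot n (col X i0) y\<bar> \<le> 2 / 5 * \<delta>"
    using move_on g01 lamg by (intro correlation_persists[OF A(1) card b'])
      (auto simp: move_corr noise i0)
  hence "dot n (col X i0) (residual p X y (move g)) \<noteq> 0" using noise delta by linarith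
  hence nonzero: "\<not> (\<forall>i<n. residual p X y (move g) i = 0)"
    unfolding dot_def by (metis (no_types, lifting) lessThan_iff mult_zero_right sum.neutral)
  have not_all: "A \<noteq> {..<p}" using noise i0 by auto
  define j where "j = (SOME j. j \<in> caught g)"
  have "j \<in> caught g" unfolding j_def using gG by (intro some_in_eq[THEN iffD2]) (simp add: G_def)
  hence j: "j < p" "j \<notin> A" "(1 - g) * lam \<le> \<bar>q j - g * e j\<bar>"
    using caught_iff g01 by auto
  have "lar_step n p X y (A, b) = (insert j A, move g)"
    using not_all nonzero
    unfolding lar_step_def Let_def prod.case j_def g_def G_def caught_def move_def d_def
    by (simp only: if_False)
  moreover have "lar_state (insert j A) (move g) ((1 - g) * lam)"
    using A j lamg b' move_on move_all g01
    by (auto simp: lar_state_def move_corr supported_on_def intro: antisym)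
  ultimately show thesis using that j b' by blast
qed

text \<open>
  The first variable is a candidate by its correlation with \<open>y\<close>. A later one
  ties with the active variables, so its correlation with the residual is at least that of
  \<open>i0\<close>; it has coefficient zero when it enters, so
  \<open>correlation_persists\<close> applies to it.
\<close>

lemma lar_signals:
  assumes "m \<le> N" "\<forall>i<p. i \<in> fst (lar n p X y m) \<longrightarrow> \<beta> i \<noteq> 0"
  shows "\<exists>lam. lar_state (fst (lar n p X y m)) (snd (lar n p X y m)) lam \<and>
    fst (lar n p X y m) \<subseteq> candidates \<and> card (fst (lar n p X y m)) = Suc m"
  using assms
proof (induction m)
  case 0
  define j where "j = arg_max_on (abs_corr n X y) {..<p}"
  have "is_arg_max (abs_corr n X y) (\<lambda>x. x \<in> {..<p}) j"
  proof -
    have fin: "finite (abs_corr n X y ` {..<p})" "abs_corr n X y ` {..<p} \<noteq> {}"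
      using noise by auto
    from Max_in[OF this] obtain x where x: "x < p" "abs_corr n X y x = Max (abs_corr n X y ` {..<p})"
      by auto
    hence "is_arg_max (abs_corr n X y) (\<lambda>x. x \<in> {..<p}) x"
      using fin by (auto simp: is_arg_max_def not_less)
    thus ?thesis unfolding j_def arg_max_on_def arg_max_def by (rule someI)
  qed
  hence j: "j < p" "\<And>i. i < p \<Longrightarrow> \<bar>dot n (col X i) y\<bar> \<le> \<bar>dot n (col X j) y\<bar>"
    by (auto simp: is_arg_max_def abs_corr_eq_dot)
  have "lar_state {j} (\<lambda>_. 0) \<bar>dot n (col X j) y\<bar>"
    using j corr_le by (auto simp: lar_state_def residual_zero supported_on_def)
  moreover have "j \<in> candidates" using j(1) j(2)[OF noise(1)] noise delta by (simp add: candidates_def)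
  moreover have "lar n p X y 0 = ({j}, \<lambda>_. 0)" by (simp add: j_def)
  ultimately show ?case by auto
next
  case (Suc m)
  obtain A b where Ab: "lar n p X y m = (A, b)" by fastforce
  have step: "lar n p X y (Suc m) = lar_step n p X y (A, b)" by (simp add: Ab)
  have "A \<subseteq> fst (lar_step n p X y (A, b))"
    unfolding lar_step_def Let_def by (simp split: if_split add: subset_insertI)
  hence sig: "\<forall>i<p. i \<in> A \<longrightarrow> \<beta> i \<noteq> 0" using Suc.prems unfolding step by blast
  then obtain lam where st: "lar_state A b lam" and IH: "A \<subseteq> candidates" "card A = Suc m"
    using Suc Ab by auto
  have card: "card A \<le> N + 1" and i0: "i0 \<notin> A" using IH Suc.prems sig noise by auto
  from lar_step_state[OF st card i0] obtain j b' lam' where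
    j: "lar_step n p X y (A, b) = (insert j A, b')" "j < p" "j \<notin> A"
    and b': "b' \<in> supported_on A" and st': "lar_state (insert j A) b' lam'" by blast
  have A: "A \<subseteq> {..<p}" "finite A" using st finite_subset by (auto simp: lar_state_def)
  have corr: "\<bar>dot n (col X i) (residual p X y b') - dot n (col X i) y\<bar> \<le> 2 / 5 * \<delta>"
    if "i < p" "i \<notin> A" for i
    using st' that by (intro correlation_persists[OF A(1) card b']) (auto simp: lar_state_def)
  have "\<bar>dot n (col X i0) (residual p X y b')\<bar> \<le> \<bar>dot n (col X j) (residual p X y b')\<bar>"
    using st' noise by (auto simp: lar_state_def)
  hence "\<tau> - \<delta> \<le> \<bar>dot n (col X j) y\<bar>"
    using corr[OF j(2,3)] corr[OF noise(1) i0] noise(3) delta(2) by linarith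
  hence "j \<in> candidates" using j by (simp add: candidates_def)
  moreover have "card (insert j A) = Suc (Suc m)" using A(2) j(3) IH(2) by simp
  ultimately show ?case
    unfolding step j(1) fst_conv snd_conv using st' IH(1)
    by (intro exI[of _ lam'] conjI insert_subsetI)
qed

theorem lar_rank: "first_noise_rank p \<beta> (lar_entry n p X y) \<le> enat (N + 1)"
proof -
  let ?sel = "\<lambda>m. fst (lar n p X y m)"
  have "\<not> (\<forall>i<p. i \<in> ?sel N \<longrightarrow> \<beta> i \<noteq> 0)"
  proof
    assume "\<forall>i<p. i \<in> ?sel N \<longrightarrow> \<beta> i \<noteq> 0"
    with lar_signals[of N] have "?sel N \<subseteq> candidates" "card (?sel N) = Suc N" by blast+
    thus False using card_mono[OF few_candidates(1), of "?sel N"] few_candidates(3) by linarith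
  qed
  then obtain i where i: "i < p" "i \<in> ?sel N" "\<beta> i = 0" by blast
  have entry: "lar_entry n p X y j \<le> ereal (real m)" if "j \<in> ?sel m" for j m
    unfolding lar_entry_def using that by (intro INF_lower) auto
  show ?thesis
  proof (rule first_noise_rank_le)
    show "lar_entry n p X y i < \<infinity>" using entry[OF i(2)] by (rule le_less_trans) simp
    fix j t assume lt: "lar_entry n p X y j < t"
      and t: "\<And>i. i < p \<Longrightarrow> \<beta> i = 0 \<Longrightarrow> t \<le> lar_entry n p X y i"
    obtain m where m: "j \<in> ?sel m" "ereal (real m) < t"
      using lt by (auto simp: lar_entry_def INF_less_iff)
    have before: "m < m'" if "i' < p" "i' \<in> ?sel m'" "\<beta> i' = 0" for i' m'
    proof -
      have "ereal (real m) < ereal (real m')"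
        using m(2) t[OF that(1,3)] entry[OF that(2)] by order
      thus ?thesis by simp
    qed
    have "m \<le> N" using before[OF i] by simp
    moreover have "\<forall>i<p. i \<in> ?sel m \<longrightarrow> \<beta> i \<noteq> 0" using before by blast
    ultimately show "j \<in> candidates" using lar_signals m(1) by blast
  qed (use i in auto)
qed

end

section \<open>Gaussian linear combinations and tails\<close>

text \<open>
  Every centred Gaussian law, the point mass at zero included, is an image of the standard
  one. So the case of no noise is included in all that follows.
\<close>

lemma gaussian_eq_distr:
  assumes "0 \<le> s"
  shows "gaussian s = distr std_normal_distribution borel (\<lambda>x. s * x)"
proof (cases "s = 0")
  case True
  interpret real_distribution std_normal_distribution by (rule real_dist_normal_dist)
  have "distr std_normal_distribution borel (\<lambda>_. 0) = return borel (0 :: real)"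
    by (rule distr_const) simp
  thus ?thesis using True by (simp add: gaussian_def)
next
  case False
  interpret real_distribution std_normal_distribution by (rule real_dist_normal_dist)
  have "distributed std_normal_distribution lborel (\<lambda>x. x) std_normal_density"
    by (simp add: distributed_def normal_density_nonneg distr_id2[unfolded id_def])
  hence "distributed std_normal_distribution lborel (\<lambda>x. 0 + s * x) (normal_density (0 + s * 0) (\<bar>s\<bar> * 1))"
    using assms False by (intro normal_density_affine) auto
  thus ?thesis using assms False
    by (simp add: gaussian_def distributed_def cong: distr_cong)
qed

lemma real_distribution_gaussian: "0 \<le> s \<Longrightarrow> real_distribution (gaussian s)"
  using prob_space.real_distribution_distr[OF real_distribution.axioms(1)[OF real_dist_normal_dist]]
  by (simp add: gaussian_eq_distr)

lemma sets_gaussian [simp, measurable_cong]: "sets (gaussian s) = sets borel"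
  by (simp add: gaussian_def)

lemma space_gaussian [simp]: "space (gaussian s) = UNIV"
  by (simp add: gaussian_def)

lemma char_distr_scale:
  assumes [measurable]: "f \<in> borel_measurable M"
  shows "char (distr M borel (\<lambda>x. c * f x)) t = char (distr M borel f) (c * t)"
  unfolding char_def by (simp add: integral_distr algebra_simps)

lemma char_gaussian:
  assumes "0 \<le> s"
  shows "char (gaussian s) t = exp (- ((s * t)\<^sup>2) / 2)"
proof -
  have "char (gaussian s) t = char (distr std_normal_distribution borel (\<lambda>x. x)) (s * t)"
    unfolding gaussian_eq_distr[OF assms] by (rule char_distr_scale) simp
  also have "distr std_normal_distribution borel (\<lambda>x. x) = std_normal_distribution"
    by (rule distr_id2) simp
  finally show ?thesis by (simp add: char_std_normal_distribution exp_of_real)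
qed

text \<open>
  By characteristic functions, which do not distinguish degenerate summands: vanishing
  coefficients and vanishing variances are allowed.
\<close>

lemma (in prob_space) distr_linear_combination_gaussian:
  assumes ind: "indep_vars (\<lambda>_. borel) Y J" and fin: "finite J"
    and law: "\<And>j. j \<in> J \<Longrightarrow> distr M borel (Y j) = gaussian (s j)" and s: "\<And>j. j \<in> J \<Longrightarrow> 0 \<le> s j"
  shows "distr M borel (\<lambda>\<omega>. \<Sum>j\<in>J. c j * Y j \<omega>) = gaussian (sqrt (\<Sum>j\<in>J. (c j * s j)\<^sup>2))"
proof (rule Levy_uniqueness)
  have meas [measurable]: "Y j \<in> borel_measurable M" if "j \<in> J" for j
    using ind that by (auto simp: indep_vars_def2)
  show "real_distribution (distr M borel (\<lambda>\<omega>. \<Sum>j\<in>J. c j * Y j \<omega>))"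
    by (intro real_distribution_distr) (auto intro!: borel_measurable_sum borel_measurable_times)
  show "real_distribution (gaussian (sqrt (\<Sum>j\<in>J. (c j * s j)\<^sup>2)))"
    by (intro real_distribution_gaussian) (simp add: sum_nonneg)
  show "char (distr M borel (\<lambda>\<omega>. \<Sum>j\<in>J. c j * Y j \<omega>)) = char (gaussian (sqrt (\<Sum>j\<in>J. (c j * s j)\<^sup>2)))"
  proof
    fix t
    have "indep_vars (\<lambda>_. borel) (\<lambda>j \<omega>. c j * Y j \<omega>) J"
      by (rule indep_vars_compose2[OF ind, of "\<lambda>j x. c j * x"]) simp
    hence "char (distr M borel (\<lambda>\<omega>. \<Sum>j\<in>J. c j * Y j \<omega>)) t =
        (\<Prod>j\<in>J. char (distr M borel (\<lambda>\<omega>. c j * Y j \<omega>)) t)"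
      by (rule char_distr_sum)
    also have "\<dots> = (\<Prod>j\<in>J. complex_of_real (exp (- ((c j * s j)\<^sup>2 * t\<^sup>2) / 2)))"
      by (intro prod.cong refl, subst char_distr_scale)
        (auto simp: law s char_gaussian power_mult_distrib algebra_simps)
    also have "\<dots> = complex_of_real (exp (\<Sum>j\<in>J. - ((c j * s j)\<^sup>2 * t\<^sup>2) / 2))"
      by (simp only: of_real_prod[symmetric] exp_sum[OF fin])
    also have "(\<Sum>j\<in>J. - ((c j * s j)\<^sup>2 * t\<^sup>2) / 2) = - ((\<Sum>j\<in>J. (c j * s j)\<^sup>2) * t\<^sup>2) / 2"
      by (simp add: sum_distrib_right sum_negf sum_divide_distrib)
    finally show "char (distr M borel (\<lambda>\<omega>. \<Sum>j\<in>J. c j * Y j \<omega>)) t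
        = char (gaussian (sqrt (\<Sum>j\<in>J. (c j * s j)\<^sup>2))) t"
      by (simp add: char_gaussian sum_nonneg power_mult_distrib)
  qed
qed

lemma (in prob_space) indep_vars_linear_combinations:
  assumes ind: "indep_vars (\<lambda>_. borel :: real measure) Y I" 
    and J: "\<And>k. k \<in> K \<Longrightarrow> J k \<subseteq> I" "disjoint_family_on J K"
  shows "indep_vars (\<lambda>_. borel) (\<lambda>k \<omega>. \<Sum>j\<in>J k. c k j * Y j \<omega>) K"
proof -
  have "indep_vars (\<lambda>_. borel) (\<lambda>k \<omega>. \<Sum>j\<in>J k. c k j * restrict (\<lambda>j. Y j \<omega>) (J k) j) K"
    by (rule indep_vars_compose2[OF indep_vars_restrict[OF ind J], of "\<lambda>k f. \<Sum>j\<in>J k. c k j * f j"])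
      (auto intro!: borel_measurable_sum borel_measurable_times)
  thus ?thesis by simp
qed

text \<open>
  Conditioning on \<open>V\<close>: by Fubini's theorem, a bound for each fixed value of
  \<open>V\<close> holds on average.
\<close>

lemma (in prob_space) prob_independent_le:
  assumes ind: "indep_var S U T V" and Q[measurable]: "Measurable.pred (S \<Otimes>\<^sub>M T) (\<lambda>(u, v). Q u v)"
    and bound: "\<And>v. v \<in> space T \<Longrightarrow> prob {\<omega> \<in> space M. Q (U \<omega>) v} \<le> q"
  shows "prob {\<omega> \<in> space M. Q (U \<omega>) (V \<omega>)} \<le> q"
proof -
  have [measurable]: "U \<in> measurable M S" "V \<in> measurable M T"
    using ind by (auto dest: indep_var_rv1 indep_var_rv2)
  obtain \<omega> where "\<omega> \<in> space M" using not_empty by blast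
  hence "V \<omega> \<in> space T" by (rule measurable_space[rotated]) measurable
  hence q: "0 \<le> q" using bound order_trans[OF measure_nonneg] by blast
  interpret SU: prob_space "distr M S U" by (rule prob_space_distr) simp
  interpret TV: prob_space "distr M T V" by (rule prob_space_distr) simp
  interpret ST: pair_prob_space "distr M S U" "distr M T V" ..
  define E where "E = {x \<in> space (S \<Otimes>\<^sub>M T). case x of (u, v) \<Rightarrow> Q u v}"
  have E[measurable]: "E \<in> sets (S \<Otimes>\<^sub>M T)" unfolding E_def by measurable
  have "emeasure M {\<omega> \<in> space M. Q (U \<omega>) (V \<omega>)} = emeasure M ((\<lambda>\<omega>. (U \<omega>, V \<omega>)) -` E \<inter> space M)"
    using measurable_space[of U M S] measurable_space[of V M T]
    by (intro arg_cong2[where f = emeasure]) (auto simp: E_def space_pair_measure)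
  also have "\<dots> = emeasure (distr M (S \<Otimes>\<^sub>M T) (\<lambda>\<omega>. (U \<omega>, V \<omega>))) E"
    by (subst emeasure_distr) auto
  also have "distr M (S \<Otimes>\<^sub>M T) (\<lambda>\<omega>. (U \<omega>, V \<omega>)) = distr M S U \<Otimes>\<^sub>M distr M T V"
    using ind by (simp add: indep_var_distribution_eq)
  also have "emeasure (distr M S U \<Otimes>\<^sub>M distr M T V) E
      = (\<integral>\<^sup>+v. emeasure (distr M S U) ((\<lambda>u. (u, v)) -` E) \<partial>distr M T V)"
    by (rule ST.emeasure_pair_measure_alt2) simp
  also have "\<dots> \<le> (\<integral>\<^sup>+v. ennreal q \<partial>distr M T V)"
  proof (rule nn_integral_mono)
    fix v assume "v \<in> space (distr M T V)"
    hence v: "v \<in> space T" by simp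
    have "(\<lambda>u. (u, v)) -` E \<in> sets S"
      using sets_Pair2[OF E, of v] by simp
    hence "emeasure (distr M S U) ((\<lambda>u. (u, v)) -` E) = emeasure M (U -` ((\<lambda>u. (u, v)) -` E) \<inter> space M)"
      by (intro emeasure_distr) auto
    also have "U -` ((\<lambda>u. (u, v)) -` E) \<inter> space M = {\<omega> \<in> space M. Q (U \<omega>) v}"
      using measurable_space[of U M S] v by (auto simp: E_def space_pair_measure)
    also have "emeasure M \<dots> \<le> ennreal q"
      using bound[OF v] by (simp add: emeasure_eq_measure ennreal_leI)
    finally show "emeasure (distr M S U) ((\<lambda>u. (u, v)) -` E) \<le> ennreal q" .
  qed
  also have "\<dots> = ennreal q" using TV.emeasure_space_1 by simp
  finally show ?thesis using q by (simp add: emeasure_eq_measure)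
qed

text \<open>
  Completing the square bounds the density on each half of the tail by \<open>exp (-
  u\<^sup>2 / 2)\<close> times a shifted normal density, of total mass one.
\<close>

lemma std_normal_tail_upper:
  assumes "0 \<le> u"
  shows "measure std_normal_distribution {x. u \<le> \<bar>x\<bar>} \<le> 2 * exp (- (u\<^sup>2) / 2)"
proof -
  interpret real_distribution std_normal_distribution by (rule real_dist_normal_dist)
  let ?c = "exp (- (u\<^sup>2) / 2)"
  have le: "std_normal_density x * indicator {x. u \<le> \<bar>x\<bar>} x
      \<le> ?c * normal_density u 1 x + ?c * normal_density (- u) 1 x" for x
  proof -
    have shift: "std_normal_density x \<le> ?c * normal_density v 1 x" if "u\<^sup>2 \<le> v * x" "v\<^sup>2 = u\<^sup>2" for v
    proof -
      have "exp (- x\<^sup>2 / 2) \<le> exp (- (u\<^sup>2) / 2 + - (x - v)\<^sup>2 / 2)"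
        using that by (simp add: power2_diff field_simps)
      also have "\<dots> = ?c * exp (- (x - v)\<^sup>2 / 2)" by (rule exp_add)
      finally show ?thesis by (simp add: normal_density_def field_simps)
    qed
    have nonneg: "0 \<le> ?c * normal_density v 1 x" for v by (simp add: normal_density_nonneg)
    show ?thesis
    proof (cases "u \<le> \<bar>x\<bar>")
      case True
      hence "u * u \<le> u * \<bar>x\<bar>" using assms by (rule mult_left_mono)
      hence "u\<^sup>2 \<le> u * x \<or> u\<^sup>2 \<le> (- u) * x" by (auto simp: power2_eq_square abs_if split: if_splits)
      thus ?thesis using shift[of u] shift[of "- u"] nonneg[of u] nonneg[of "- u"] True
        by (auto intro: add_increasing add_increasing2)
    qed (use nonneg[of u] nonneg[of "- u"] in simp)
  qed
  have "emeasure std_normal_distribution {x. u \<le> \<bar>x\<bar>}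
      = (\<integral>\<^sup>+x. ennreal (std_normal_density x * indicator {x. u \<le> \<bar>x\<bar>} x) \<partial>lborel)"
    by (subst emeasure_density) (auto simp: ennreal_mult' ennreal_indicator normal_density_nonneg)
  also have "\<dots> \<le> (\<integral>\<^sup>+x. ennreal (?c * normal_density u 1 x + ?c * normal_density (- u) 1 x) \<partial>lborel)"
    by (intro nn_integral_mono ennreal_leI le)
  also have "\<dots> = ennreal (\<integral>x. ?c * normal_density u 1 x + ?c * normal_density (- u) 1 x \<partial>lborel)"
    by (intro nn_integral_eq_integral) (auto simp: normal_density_nonneg)
  also have "(\<integral>x. ?c * normal_density u 1 x + ?c * normal_density (- u) 1 x \<partial>lborel) = 2 * ?c"
    by (subst Bochner_Integration.integral_add) auto
  finally show ?thesis by (simp add: emeasure_eq_measure)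
qed

text \<open>
  The interval from \<open>a\<close> to \<open>a + 1 / a\<close> carries enough mass: on it
  the exponent of the density differs from its value at \<open>a\<close> by at most \<open>3
  / 2\<close>.
\<close>

lemma std_normal_tail_lower:
  assumes "1 \<le> a"
  shows "exp (- 3 / 2) / sqrt (2 * pi) / a * exp (- (a\<^sup>2) / 2)
    \<le> measure std_normal_distribution {x. a \<le> \<bar>x\<bar>}"
proof -
  interpret real_distribution std_normal_distribution by (rule real_dist_normal_dist)
  let ?c = "exp (- 3 / 2) / sqrt (2 * pi) * exp (- (a\<^sup>2) / 2)"
  have c: "0 \<le> ?c" by simp
  have le: "?c * indicator {a..a + 1 / a} x \<le> std_normal_density x * indicator {x. a \<le> \<bar>x\<bar>} x" for x
  proof (cases "x \<in> {a..a + 1 / a}")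
    case True
    have "x\<^sup>2 \<le> (a + 1 / a)\<^sup>2" using True assms by (intro power_mono) auto
    also have "\<dots> = a\<^sup>2 + 2 + 1 / a\<^sup>2" using assms by (simp add: power2_eq_square field_simps)
    also have "1 / a\<^sup>2 \<le> 1" using assms by simp
    finally have "exp (- 3 / 2 + - (a\<^sup>2) / 2) \<le> exp (- x\<^sup>2 / 2)" by simp
    hence "exp (- 3 / 2) * exp (- (a\<^sup>2) / 2) \<le> exp (- x\<^sup>2 / 2)" by (simp only: exp_add)
    thus ?thesis using True assms by (simp add: normal_density_def field_simps)
  qed (simp add: normal_density_nonneg)
  have "ennreal (?c * (1 / a)) = (\<integral>\<^sup>+x. ennreal ?c * indicator {a..a + 1 / a} x \<partial>lborel)"
    using assms by (subst nn_integral_cmult_indicator) (auto simp: ennreal_mult'[symmetric])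
  also have "\<dots> = (\<integral>\<^sup>+x. ennreal (?c * indicator {a..a + 1 / a} x) \<partial>lborel)"
    using c by (simp only: ennreal_mult ennreal_indicator indicator_pos_le)
  also have "\<dots> \<le> (\<integral>\<^sup>+x. ennreal (std_normal_density x * indicator {x. a \<le> \<bar>x\<bar>} x) \<partial>lborel)"
    by (intro nn_integral_mono ennreal_leI le)
  also have "\<dots> = emeasure std_normal_distribution {x. a \<le> \<bar>x\<bar>}"
    by (subst emeasure_density) (auto simp: ennreal_mult' ennreal_indicator normal_density_nonneg)
  finally show ?thesis by (simp add: emeasure_eq_measure field_simps)
qed

text \<open>
  The strict inequality makes the estimate true for the point mass at zero, too; the weak
  inequality of \<open>gaussian_tail_lower\<close> has the same purpose.
\<close>

lemma gaussian_tail_upper: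
  assumes "0 \<le> s" "0 \<le> u"
  shows "measure (gaussian s) {x. u * s < \<bar>x\<bar>} \<le> 2 * exp (- (u\<^sup>2) / 2)"
proof -
  interpret real_distribution std_normal_distribution by (rule real_dist_normal_dist)
  have "measure (gaussian s) {x. u * s < \<bar>x\<bar>} = prob {x. u * s < \<bar>s * x\<bar>}"
    unfolding gaussian_eq_distr[OF assms(1)] by (subst measure_distr) auto
  also have "\<dots> \<le> prob {x. u \<le> \<bar>x\<bar>}"
  proof (rule finite_measure_mono)
    show "{x. u * s < \<bar>s * x\<bar>} \<subseteq> {x. u \<le> \<bar>x\<bar>}"
      using assms by (auto simp: abs_mult mult.commute[of _ s] mult_less_cancel_left)
  qed auto
  also note std_normal_tail_upper[OF assms(2)]
  finally show ?thesis .
qed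

lemma gaussian_tail_lower:
  assumes "0 \<le> s" "1 \<le> a"
  shows "exp (- 3 / 2) / sqrt (2 * pi) / a * exp (- (a\<^sup>2) / 2) \<le> measure (gaussian s) {x. a * s \<le> \<bar>x\<bar>}"
proof -
  interpret real_distribution std_normal_distribution by (rule real_dist_normal_dist)
  note std_normal_tail_lower[OF assms(2)]
  also have "prob {x. a \<le> \<bar>x\<bar>} \<le> prob {x. a * s \<le> \<bar>s * x\<bar>}"
  proof (rule finite_measure_mono)
    show "{x. a \<le> \<bar>x\<bar>} \<subseteq> {x. a * s \<le> \<bar>s * x\<bar>}"
      using assms(1) by (auto simp: abs_mult mult.commute[of _ s] intro: mult_left_mono)
  qed auto
  also have "\<dots> = measure (gaussian s) {x. a * s \<le> \<bar>x\<bar>}"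
    unfolding gaussian_eq_distr[OF assms(1)] by (subst measure_distr) auto
  finally show ?thesis .
qed

text \<open>
  The exponential factor turns the standard normal density into a multiple of another one,
  so the integral is \<open>1 / sqrt (1 - 2 * t)\<close>.
\<close>

lemma std_normal_square_mgf:
  assumes "\<bar>t\<bar> \<le> 1 / 4"
  shows "(\<integral>\<^sup>+x. ennreal (exp (t * x\<^sup>2)) \<partial>std_normal_distribution) \<le> ennreal (exp (t + 4 * t\<^sup>2))"
proof -
  define v where "v = 1 / sqrt (1 - 2 * t)"
  have t: "0 < 1 - 2 * t" using assms by (auto simp: abs_le_iff)
  have v: "0 < v" "v\<^sup>2 = 1 / (1 - 2 * t)" using t by (auto simp: v_def power_divide)
  have dens: "std_normal_density x * exp (t * x\<^sup>2) = v * normal_density 0 v x" for x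
  proof -
    have "exp (- x\<^sup>2 / 2) * exp (t * x\<^sup>2) = exp (- x\<^sup>2 / (2 * v\<^sup>2))"
      unfolding exp_add[symmetric] v(2) using t by (simp add: field_simps)
    thus ?thesis using v(1) by (simp add: normal_density_def real_sqrt_mult field_simps)
  qed
  have "(\<integral>\<^sup>+x. ennreal (exp (t * x\<^sup>2)) \<partial>std_normal_distribution)
      = (\<integral>\<^sup>+x. ennreal (v * normal_density 0 v x) \<partial>lborel)"
    by (subst nn_integral_density) (auto simp: ennreal_mult'[symmetric] normal_density_nonneg dens)
  also have "\<dots> = ennreal (\<integral>x. v * normal_density 0 v x \<partial>lborel)"
    using v(1) by (intro nn_integral_eq_integral) (auto simp: normal_density_nonneg)
  also have "(\<integral>x. v * normal_density 0 v x \<partial>lborel) = v" using v(1) by simp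
  also have "v = exp (- (1 / 2 * ln (1 - 2 * t)))"
  proof -
    have "v = inverse (exp (ln (sqrt (1 - 2 * t))))" using t by (simp add: v_def divide_inverse)
    thus ?thesis using t by (simp only: exp_minus[symmetric] ln_sqrt) simp
  qed
  also have "\<dots> \<le> exp (t + 4 * t\<^sup>2)"
  proof -
    have "- (2 * t) - 2 * (2 * t)\<^sup>2 \<le> ln (1 - 2 * t)"
    proof (cases "0 \<le> t")
      case True
      thus ?thesis using assms by (intro ln_one_minus_pos_lower_bound) auto
    next
      case False
      hence "(- 2 * t) - (- 2 * t)\<^sup>2 \<le> ln (1 + (- 2 * t))"
        using assms by (intro ln_one_plus_pos_lower_bound) auto
      moreover have "(- 2 * t)\<^sup>2 = (2 * t)\<^sup>2" "1 + (- 2 * t) = 1 - 2 * t" by simp_all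
      ultimately have "- 2 * t - (2 * t)\<^sup>2 \<le> ln (1 - 2 * t)" by metis
      thus ?thesis using zero_le_power2[of "2 * t"] by linarith
    qed
    thus ?thesis by (simp add: power_mult_distrib)
  qed
  finally show ?thesis by (simp add: ennreal_leI)
qed

text \<open>
  Chernoff's method for both tails, with the exponents \<open>\<mu> / 8\<close> and \<open>-
  \<mu> / 8\<close>.
\<close>

lemma (in prob_space) gaussian_sum_squares_concentration:
  assumes ind: "indep_vars (\<lambda>_. borel) G {..<n}"
    and law: "\<And>i. i < n \<Longrightarrow> distr M borel (G i) = gaussian s" and s: "0 < s"
    and \<mu>: "0 \<le> \<mu>" "\<mu> \<le> 1"
  shows "prob {\<omega> \<in> space M. \<mu> * (real n * s\<^sup>2) < \<bar>(\<Sum>i<n. (G i \<omega>)\<^sup>2) - real n * s\<^sup>2\<bar>}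
    \<le> 2 * exp (- (real n * \<mu>\<^sup>2) / 16)"
proof -
  have G[measurable]: "G i \<in> borel_measurable M" if "i < n" for i
    using ind that by (auto simp: indep_vars_def2)
  define Q where "Q = (\<lambda>\<omega>. \<Sum>i<n. (G i \<omega>)\<^sup>2)"
  have Q[measurable]: "Q \<in> borel_measurable M" unfolding Q_def by measurable
  have mgf: "(\<integral>\<^sup>+\<omega>. ennreal (exp (t / s\<^sup>2 * Q \<omega>)) \<partial>M) \<le> ennreal (exp (real n * (t + 4 * t\<^sup>2)))"
    if t: "\<bar>t\<bar> \<le> 1 / 4" for t
  proof -
    have "(\<integral>\<^sup>+\<omega>. ennreal (exp (t / s\<^sup>2 * Q \<omega>)) \<partial>M)
        = (\<integral>\<^sup>+\<omega>. (\<Prod>i<n. ennreal (exp (t / s\<^sup>2 * (G i \<omega>)\<^sup>2))) \<partial>M)"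
      by (simp add: Q_def sum_distrib_left exp_sum prod_ennreal)
    also have "\<dots> = (\<Prod>i<n. \<integral>\<^sup>+\<omega>. ennreal (exp (t / s\<^sup>2 * (G i \<omega>)\<^sup>2)) \<partial>M)"
      by (intro indep_vars_nn_integral indep_vars_compose2[OF ind, of "\<lambda>i x. ennreal (exp (t / s\<^sup>2 * x\<^sup>2))"]) auto
    also have "\<dots> \<le> (\<Prod>i<n. ennreal (exp (t + 4 * t\<^sup>2)))"
    proof (intro prod_mono_ennreal)
      fix i assume "i \<in> {..<n}"
      hence i: "i < n" by simp
      have "(\<integral>\<^sup>+\<omega>. ennreal (exp (t / s\<^sup>2 * (G i \<omega>)\<^sup>2)) \<partial>M)
          = (\<integral>\<^sup>+x. ennreal (exp (t / s\<^sup>2 * x\<^sup>2)) \<partial>gaussian s)"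
        using i by (subst law[OF i, symmetric], subst nn_integral_distr) auto
      also have "\<dots> = (\<integral>\<^sup>+x. ennreal (exp (t * x\<^sup>2)) \<partial>std_normal_distribution)"
        using s by (simp add: gaussian_eq_distr nn_integral_distr power_mult_distrib)
      also note std_normal_square_mgf[OF t]
      finally show "(\<integral>\<^sup>+\<omega>. ennreal (exp (t / s\<^sup>2 * (G i \<omega>)\<^sup>2)) \<partial>M) \<le> ennreal (exp (t + 4 * t\<^sup>2))" .
    qed
    also have "\<dots> = ennreal (exp (real n * (t + 4 * t\<^sup>2)))"
      by (simp add: ennreal_power exp_of_nat_mult)
    finally show ?thesis .
  qed
  have side: "prob {\<omega> \<in> space M. real n * (t + 4 * t\<^sup>2) + r \<le> t / s\<^sup>2 * Q \<omega>} \<le> exp (- r)"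
    if t: "\<bar>t\<bar> \<le> 1 / 4" for t r :: real
  proof -
    let ?m = "real n * (t + 4 * t\<^sup>2)"
    have "emeasure M {\<omega> \<in> space M. 1 \<le> ennreal (exp (- (?m + r))) * ennreal (exp (t / s\<^sup>2 * Q \<omega>))}
        \<le> ennreal (exp (- (?m + r))) * (\<integral>\<^sup>+\<omega>. ennreal (exp (t / s\<^sup>2 * Q \<omega>)) * indicator (space M) \<omega> \<partial>M)"
      by (rule nn_integral_Markov_inequality) auto
    also have "(\<integral>\<^sup>+\<omega>. ennreal (exp (t / s\<^sup>2 * Q \<omega>)) * indicator (space M) \<omega> \<partial>M)
        = (\<integral>\<^sup>+\<omega>. ennreal (exp (t / s\<^sup>2 * Q \<omega>)) \<partial>M)"
      by (intro nn_integral_cong) simp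
    also have "ennreal (exp (- (?m + r))) * \<dots> \<le> ennreal (exp (- (?m + r))) * ennreal (exp ?m)"
      by (intro mult_left_mono mgf[OF t]) simp
    also have "\<dots> = ennreal (exp (- r))"
      by (simp add: ennreal_mult'[symmetric] exp_add[symmetric])
    also have "{\<omega> \<in> space M. 1 \<le> ennreal (exp (- (?m + r))) * ennreal (exp (t / s\<^sup>2 * Q \<omega>))}
        = {\<omega> \<in> space M. ?m + r \<le> t / s\<^sup>2 * Q \<omega>}"
      by (intro Collect_cong conj_cong refl) (simp add: ennreal_mult'[symmetric] exp_add[symmetric], linarith)
    finally show ?thesis by (simp add: emeasure_eq_measure)
  qed
  let ?r = "real n * \<mu>\<^sup>2 / 16"
  let ?U = "{\<omega> \<in> space M. real n * (\<mu> / 8 + 4 * (\<mu> / 8)\<^sup>2) + ?r \<le> (\<mu> / 8) / s\<^sup>2 * Q \<omega>}"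
  let ?L = "{\<omega> \<in> space M. real n * (- \<mu> / 8 + 4 * (- \<mu> / 8)\<^sup>2) + ?r \<le> (- \<mu> / 8) / s\<^sup>2 * Q \<omega>}"
  have "{\<omega> \<in> space M. \<mu> * (real n * s\<^sup>2) < \<bar>Q \<omega> - real n * s\<^sup>2\<bar>} \<subseteq> ?U \<union> ?L"
  proof
    fix \<omega> assume *: "\<omega> \<in> {\<omega> \<in> space M. \<mu> * (real n * s\<^sup>2) < \<bar>Q \<omega> - real n * s\<^sup>2\<bar>}"
    define x where "x = Q \<omega> / s\<^sup>2"
    have Qx: "Q \<omega> = x * s\<^sup>2" using s by (simp add: x_def)
    have "\<mu> * real n * s\<^sup>2 < \<bar>x - real n\<bar> * s\<^sup>2"
    proof -
      have "\<bar>Q \<omega> - real n * s\<^sup>2\<bar> = \<bar>(x - real n) * s\<^sup>2\<bar>" by (simp add: Qx left_diff_distrib)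
      thus ?thesis using * by (simp add: abs_mult mult.assoc)
    qed
    hence "\<mu> * real n < \<bar>x - real n\<bar>" using s by (simp add: mult_less_cancel_right)
    hence "\<mu> * real n \<le> x - real n \<or> \<mu> * real n \<le> real n - x" by linarith
    hence "\<mu> * (\<mu> * real n) \<le> \<mu> * (x - real n) \<or> \<mu> * (\<mu> * real n) \<le> \<mu> * (real n - x)"
      using \<mu>(1) by (auto intro: mult_left_mono)
    hence cases: "\<mu> * (\<mu> * real n) + \<mu> * real n \<le> \<mu> * x \<or> \<mu> * (\<mu> * real n) - \<mu> * real n \<le> - (\<mu> * x)"
      unfolding right_diff_distrib by linarith
    have upper: "real n * (\<mu> / 8 + 4 * (\<mu> / 8)\<^sup>2) + ?r = (\<mu> * (\<mu> * real n) + \<mu> * real n) / 8"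
      and lower: "real n * (- \<mu> / 8 + 4 * (- \<mu> / 8)\<^sup>2) + ?r = (\<mu> * (\<mu> * real n) - \<mu> * real n) / 8"
      by (simp_all add: power2_eq_square field_simps)
    have "real n * (\<mu> / 8 + 4 * (\<mu> / 8)\<^sup>2) + ?r \<le> \<mu> / 8 * x
        \<or> real n * (- \<mu> / 8 + 4 * (- \<mu> / 8)\<^sup>2) + ?r \<le> - \<mu> / 8 * x"
      using cases unfolding upper lower by (simp only: times_divide_eq_left divide_le_cancel) simp
    moreover have "\<mu> / 8 / s\<^sup>2 * Q \<omega> = \<mu> / 8 * x" "- \<mu> / 8 / s\<^sup>2 * Q \<omega> = - \<mu> / 8 * x"
      using s by (simp_all add: x_def)
    ultimately show "\<omega> \<in> ?U \<union> ?L" using * unfolding Un_iff mem_Collect_eq by metis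
  qed
  hence "prob {\<omega> \<in> space M. \<mu> * (real n * s\<^sup>2) < \<bar>Q \<omega> - real n * s\<^sup>2\<bar>} \<le> prob (?U \<union> ?L)"
    by (intro finite_measure_mono) auto
  also have "\<dots> \<le> prob ?U + prob ?L" by (intro measure_Un_le) auto
  also have "\<dots> \<le> exp (- ?r) + exp (- ?r)" using \<mu> by (intro add_mono side) auto
  finally show ?thesis by (simp add: Q_def)
qed

section \<open>The Gaussian linear model\<close>

locale gaussian_model = prob_space P for P :: "'a measure" +
  fixes n p :: nat and \<sigma> :: real
    and X :: "'a \<Rightarrow> nat \<Rightarrow> nat \<Rightarrow> real" and z :: "'a \<Rightarrow> nat \<Rightarrow> real" and \<beta> :: "nat \<Rightarrow> real"
  assumes model: "gaussian_design_and_noise P n p \<sigma> X z"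
    and n_pos: "0 < n" and \<sigma>_nonneg: "0 \<le> \<sigma>"
begin

text \<open>
  The entries of the design and of the noise form one independent family, and everything
  below is a linear combination of blocks of it.
\<close>

definition entry :: "nat \<times> nat + nat \<Rightarrow> 'a \<Rightarrow> real" where
  "entry = case_sum (\<lambda>(i, j) \<omega>. X \<omega> i j) (\<lambda>i \<omega>. z \<omega> i)"

definition entry_sd :: "nat \<times> nat + nat \<Rightarrow> real" where
  "entry_sd = case_sum (\<lambda>_. sqrt (1 / real n)) (\<lambda>_. \<sigma>)"

abbreviation indices :: "(nat \<times> nat + nat) set" where
  "indices \<equiv> ({..<n} \<times> {..<p}) <+> {..<n}"

lemma entry_simps [simp]: "entry (Inl (i, j)) \<omega> = X \<omega> i j" "entry (Inr i) \<omega> = z \<omega> i"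
  by (simp_all add: entry_def)

lemma entry_sd_simps [simp]: "entry_sd (Inl x) = sqrt (1 / real n)" "entry_sd (Inr i) = \<sigma>"
  by (simp_all add: entry_sd_def)

lemma entry_sd_nonneg: "0 \<le> entry_sd x"
  by (cases x) (simp_all add: \<sigma>_nonneg)

lemma indep_entries: "indep_vars (\<lambda>_. borel) entry indices"
  using model by (simp add: gaussian_design_and_noise_def entry_def)

lemma distr_entry: "x \<in> indices \<Longrightarrow> distr P borel (entry x) = gaussian (entry_sd x)"
  using model by (auto simp: gaussian_design_and_noise_def entry_def)

lemma measurable_entry: "x \<in> indices \<Longrightarrow> entry x \<in> borel_measurable P"
  using indep_entries by (auto simp: indep_vars_def2)

lemma measurable_X [measurable]: "i < n \<Longrightarrow> j < p \<Longrightarrow> (\<lambda>\<omega>. X \<omega> i j) \<in> borel_measurable P"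
  using measurable_entry[of "Inl (i, j)"] by (auto simp: entry_def InlI)

lemma measurable_z [measurable]: "i < n \<Longrightarrow> (\<lambda>\<omega>. z \<omega> i) \<in> borel_measurable P"
  using measurable_entry[of "Inr i"] by (auto simp: entry_def InrI)

text \<open>
  Combinations over disjoint blocks are independent. The blocks will be the rows of the
  design, each together with its noise, or the columns.
\<close>

lemma gaussian_block_combinations:
  assumes J: "\<And>k. k \<in> K \<Longrightarrow> J k \<subseteq> indices" "disjoint_family_on J K"
  shows "indep_vars (\<lambda>_. borel) (\<lambda>k \<omega>. \<Sum>x\<in>J k. c k x * entry x \<omega>) K"
    and "\<And>k. k \<in> K \<Longrightarrow> distr P borel (\<lambda>\<omega>. \<Sum>x\<in>J k. c k x * entry x \<omega>)
        = gaussian (sqrt (\<Sum>x\<in>J k. (c k x * entry_sd x)\<^sup>2))"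
proof -
  show "indep_vars (\<lambda>_. borel) (\<lambda>k \<omega>. \<Sum>x\<in>J k. c k x * entry x \<omega>) K"
    by (rule indep_vars_linear_combinations[OF indep_entries J])
  fix k assume k: "k \<in> K"
  show "distr P borel (\<lambda>\<omega>. \<Sum>x\<in>J k. c k x * entry x \<omega>)
        = gaussian (sqrt (\<Sum>x\<in>J k. (c k x * entry_sd x)\<^sup>2))"
    using J(1)[OF k] by (intro distr_linear_combination_gaussian indep_vars_subset[OF indep_entries])
      (auto intro: distr_entry finite_subset simp: entry_sd_nonneg)
qed

text \<open>
  The response (\<open>c = \<beta>\<close> and \<open>e = 1\<close>), a single column, and
  the sum or the difference of two columns (\<open>e = 0\<close>) are all of this form.
\<close>

definition row :: "(nat \<Rightarrow> real) \<Rightarrow> real \<Rightarrow> nat \<Rightarrow> 'a \<Rightarrow> real" where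
  "row c e i \<omega> = fitted p (X \<omega>) c i + e * z \<omega> i"

lemma row_combinations:
  shows "indep_vars (\<lambda>_. borel) (row c e) {..<n}"
    and "\<And>i. i < n \<Longrightarrow> distr P borel (row c e i)
      = gaussian (sqrt ((\<Sum>j<p. (c j)\<^sup>2) / real n + (e * \<sigma>)\<^sup>2))"
proof -
  let ?J = "\<lambda>i. Inl ` ({i} \<times> {..<p}) \<union> {Inr i :: nat \<times> nat + nat}"
  let ?c = "case_sum (\<lambda>(i, j). c j) (\<lambda>_. e)"
  have sum: "(\<Sum>x\<in>?J i. f x) = (\<Sum>j<p. f (Inl (i, j))) + f (Inr i)" for f :: "_ \<Rightarrow> real" and i
  proof -
    have "(\<Sum>x\<in>?J i. f x) = (\<Sum>x\<in>Inl ` ({i} \<times> {..<p}). f x) + f (Inr i)"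
      by (subst sum.union_disjoint) auto
    also have "(\<Sum>x\<in>Inl ` ({i} \<times> {..<p}). f x) = (\<Sum>j<p. f (Inl (i, j)))"
    proof -
      have "Inl ` ({i} \<times> {..<p}) = (\<lambda>j. Inl (i, j) :: nat \<times> nat + nat) ` {..<p}" by auto
      thus ?thesis by (simp add: sum.reindex inj_on_def)
    qed
    finally show ?thesis .
  qed
  have row: "(\<lambda>\<omega>. \<Sum>x\<in>?J i. ?c x * entry x \<omega>) = row c e i" for i
    unfolding sum by (simp add: fun_eq_iff row_def fitted_def mult.commute)
  have J: "\<And>i. i \<in> {..<n} \<Longrightarrow> ?J i \<subseteq> indices" "disjoint_family_on ?J {..<n}"
    by (auto simp: disjoint_family_on_def)
  note comb = gaussian_block_combinations[OF J, where c = "\<lambda>_. ?c", unfolded row, unfolded sum]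
  show "indep_vars (\<lambda>_. borel) (row c e) {..<n}" using comb(1) by simp
  show "distr P borel (row c e i) = gaussian (sqrt ((\<Sum>j<p. (c j)\<^sup>2) / real n + (e * \<sigma>)\<^sup>2))"
    if "i < n" for i
    using comb(2)[of i] that
    by (simp add: power_mult_distrib power_divide sum_divide_distrib)
qed

lemma sq_norm_row_concentration:
  fixes e :: real
  assumes s: "0 < (\<Sum>j<p. (c j)\<^sup>2)" and \<mu>: "0 \<le> \<mu>" "\<mu> \<le> 1"
  defines "v \<equiv> (\<Sum>j<p. (c j)\<^sup>2) + real n * (e * \<sigma>)\<^sup>2"
  shows "prob {\<omega> \<in> space P. \<mu> * v < \<bar>sq_norm n (\<lambda>i. row c e i \<omega>) - v\<bar>} \<le> 2 * exp (- (real n * \<mu>\<^sup>2) / 16)"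
proof -
  let ?s = "sqrt ((\<Sum>j<p. (c j)\<^sup>2) / real n + (e * \<sigma>)\<^sup>2)"
  have pos: "0 < (\<Sum>j<p. (c j)\<^sup>2) / real n + (e * \<sigma>)\<^sup>2"
    using s n_pos by (intro add_pos_nonneg) auto
  have "real n * ?s\<^sup>2 = v" using pos n_pos by (simp add: v_def algebra_simps)
  thus ?thesis
    using gaussian_sum_squares_concentration[OF row_combinations[where c = c and e = e] real_sqrt_gt_zero[OF pos] \<mu>]
    by (simp only: sq_norm_def)
qed

lemma measurable_row [measurable]: "i < n \<Longrightarrow> row c e i \<in> borel_measurable P"
  unfolding row_def fitted_def by measurable

lemma column_norm_concentration:
  assumes j: "j < p" and \<mu>: "0 \<le> \<mu>" "\<mu> \<le> 1"
  shows "prob {\<omega> \<in> space P. \<mu> < \<bar>dot n (col (X \<omega>) j) (col (X \<omega>) j) - 1\<bar>} \<le> 2 * exp (- (real n * \<mu>\<^sup>2) / 16)"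
proof -
  let ?c = "\<lambda>i. if i = j then 1 else 0 :: real"
  have "(\<Sum>i<p. (?c i)\<^sup>2) = (\<Sum>i<p. if i = j then 1 else 0)" by (intro sum.cong) auto
  hence "(\<Sum>i<p. (?c i)\<^sup>2) = 1" using j by simp
  moreover have "fitted p (X \<omega>) ?c i = (\<Sum>l<p. if l = j then X \<omega> i l else 0)" for i \<omega>
    unfolding fitted_def by (intro sum.cong) auto
  hence "row ?c 0 i \<omega> = X \<omega> i j" for i \<omega>
    using j by (simp add: row_def)
  ultimately show ?thesis
    using sq_norm_row_concentration[of ?c \<mu> 0] \<mu> by (simp add: sq_norm_eq_dot dot_def col_def)
qed

text \<open>
  Polarisation reduces the inner product to the squared norms of the sum and of the
  difference of the two columns. With \<open>c e\<close> the coefficient of column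
  \<open>j\<close> is the sign \<open>e\<close>.
\<close>

lemma column_dot_concentration:
  assumes ij: "i < p" "j < p" "i \<noteq> j" and \<mu>: "0 \<le> \<mu>" "\<mu> \<le> 1"
  shows "prob {\<omega> \<in> space P. \<mu> < \<bar>dot n (col (X \<omega>) i) (col (X \<omega>) j)\<bar>} \<le> 4 * exp (- (real n * \<mu>\<^sup>2) / 16)"
proof -
  define c where "c e = (\<lambda>l. (if l = i then 1 else 0) + (if l = j then e else 0 :: real))" for e
  have "(\<Sum>l<p. (c e l)\<^sup>2) = (\<Sum>l<p. (if l = i then 1 else 0) + (if l = j then e\<^sup>2 else 0))" for e
    using ij by (intro sum.cong) (auto simp: c_def)
  hence v: "(\<Sum>l<p. (c e l)\<^sup>2) = 1 + e\<^sup>2" for e using ij by (simp add: sum.distrib)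
  have "fitted p (X \<omega>) (c e) r
      = (\<Sum>l<p. (if l = i then X \<omega> r l else 0) + (if l = j then e * X \<omega> r l else 0))" for e r \<omega>
    unfolding fitted_def c_def by (intro sum.cong) (auto simp: algebra_simps)
  hence row: "row (c e) 0 r \<omega> = X \<omega> r i + e * X \<omega> r j" for e r \<omega>
    using ij by (simp add: row_def sum.distrib)
  define S where "S e \<omega> = sq_norm n (\<lambda>r. row (c e) 0 r \<omega>)" for e \<omega>
  let ?D = "\<lambda>\<omega>. dot n (col (X \<omega>) i) (col (X \<omega>) j)"
  have [measurable]: "S e \<in> borel_measurable P" for e
    unfolding S_def sq_norm_def by measurable
  have conc: "prob {\<omega> \<in> space P. \<mu> * (1 + e\<^sup>2) < \<bar>S e \<omega> - (1 + e\<^sup>2)\<bar>} \<le> 2 * exp (- (real n * \<mu>\<^sup>2) / 16)" for e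
    using sq_norm_row_concentration[of "c e" \<mu> 0] \<mu> unfolding v S_def by (simp add: add_pos_nonneg)
  have polar: "S 1 \<omega> - S (- 1) \<omega> = 4 * ?D \<omega>" for \<omega>
    unfolding S_def row sq_norm_def dot_def col_def sum_subtractf[symmetric] sum_distrib_left
    by (intro sum.cong) (auto simp: power2_eq_square algebra_simps)
  let ?E = "\<lambda>e. {\<omega> \<in> space P. \<mu> * (1 + e\<^sup>2) < \<bar>S e \<omega> - (1 + e\<^sup>2)\<bar>}"
  have "{\<omega> \<in> space P. \<mu> < \<bar>?D \<omega>\<bar>} \<subseteq> ?E 1 \<union> ?E (- 1)"
  proof
    fix \<omega> assume *: "\<omega> \<in> {\<omega> \<in> space P. \<mu> < \<bar>?D \<omega>\<bar>}"
    have "\<not> (\<bar>S 1 \<omega> - 2\<bar> \<le> 2 * \<mu> \<and> \<bar>S (- 1) \<omega> - 2\<bar> \<le> 2 * \<mu>)"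
      using polar[of \<omega>] * by auto
    thus "\<omega> \<in> ?E 1 \<union> ?E (- 1)" using * by auto
  qed
  hence "prob {\<omega> \<in> space P. \<mu> < \<bar>?D \<omega>\<bar>} \<le> prob (?E 1 \<union> ?E (- 1))"
    by (intro finite_measure_mono) auto
  also have "\<dots> \<le> prob (?E 1) + prob (?E (- 1))" by (intro measure_Un_le) auto
  also have "\<dots> \<le> 4 * exp (- (real n * \<mu>\<^sup>2) / 16)" using conc[of 1] conc[of "- 1"] by linarith
  finally show ?thesis .
qed

lemma column_combinations:
  shows "indep_vars (\<lambda>_. borel) (\<lambda>j \<omega>. dot n (col (X \<omega>) j) v) {..<p}"
    and "\<And>j. j < p \<Longrightarrow> distr P borel (\<lambda>\<omega>. dot n (col (X \<omega>) j) v) = gaussian (sqrt (sq_norm n v / real n))"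
proof -
  let ?J = "\<lambda>j. Inl ` ({..<n} \<times> {j}) :: (nat \<times> nat + nat) set"
  let ?c = "case_sum (\<lambda>(i, j). v i) (\<lambda>_. 0)"
  have sum: "(\<Sum>x\<in>?J j. f x) = (\<Sum>i<n. f (Inl (i, j)))" for f :: "_ \<Rightarrow> real" and j
  proof -
    have "?J j = (\<lambda>i. Inl (i, j)) ` {..<n}" by auto
    also have "(\<Sum>x\<in>(\<lambda>i. Inl (i, j)) ` {..<n}. f x) = (\<Sum>i<n. f (Inl (i, j)))"
      by (subst sum.reindex) (auto simp: inj_on_def)
    finally show ?thesis .
  qed
  have col: "(\<lambda>\<omega>. \<Sum>x\<in>?J j. ?c x * entry x \<omega>) = (\<lambda>\<omega>. dot n (col (X \<omega>) j) v)" for j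
    by (simp add: fun_eq_iff sum dot_def col_def mult.commute)
  have J: "\<And>j. j \<in> {..<p} \<Longrightarrow> ?J j \<subseteq> indices" "disjoint_family_on ?J {..<p}"
    by (auto simp: disjoint_family_on_def)
  note comb = gaussian_block_combinations[OF J, where c = "\<lambda>_. ?c", unfolded col]
  show "indep_vars (\<lambda>_. borel) (\<lambda>j \<omega>. dot n (col (X \<omega>) j) v) {..<p}" using comb(1) by simp
  show "distr P borel (\<lambda>\<omega>. dot n (col (X \<omega>) j) v) = gaussian (sqrt (sq_norm n v / real n))"
    if "j < p" for j
    using comb(2)[of j] that
    by (simp add: sum sq_norm_def power_mult_distrib power_divide sum_divide_distrib)
qed

text \<open>
  This part of the response is independent of the columns in \<open>C\<close>. It is the
  whole response if \<open>C\<close> consists of noise variables.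
\<close>

definition response_without :: "nat set \<Rightarrow> 'a \<Rightarrow> nat \<Rightarrow> real" where
  "response_without C \<omega> i = (\<Sum>j\<in>{..<p} - C. X \<omega> i j * \<beta> j) + z \<omega> i"

text \<open>
  The columns in \<open>C\<close> and the remaining entries are independent, so a bound for
  each fixed vector \<open>v\<close> carries over to the random vector
  \<open>response_without C\<close>. The event \<open>B\<close> may depend on the
  correlations of the columns in \<open>C\<close> with that vector and on its norm.
\<close>

lemma columns_independent_of_rest:
  assumes C: "C \<subseteq> {..<p}"
    and B: "Measurable.pred (PiM C (\<lambda>_. borel) \<Otimes>\<^sub>M borel) (\<lambda>(f, s). B f s)"
    and bound: "\<And>v. prob {\<omega> \<in> space P. B (\<lambda>j\<in>C. dot n (col (X \<omega>) j) v) (sq_norm n v)} \<le> q"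
  shows "prob {\<omega> \<in> space P. B (\<lambda>j\<in>C. dot n (col (X \<omega>) j) (response_without C \<omega>))
    (sq_norm n (response_without C \<omega>))} \<le> q"
proof -
  define A where "A = (Inl ` ({..<n} \<times> C) :: (nat \<times> nat + nat) set)"
  \<comment> \<open>The vector \<open>response_without C\<close> as a function of the entries
    outside of \<open>C\<close>.\<close>
  define w where "w v i = (\<Sum>j\<in>{..<p} - C. v (Inl (i, j)) * \<beta> j) + v (Inr i)"
    for v :: "nat \<times> nat + nat \<Rightarrow> real" and i
  define F where "F = (\<lambda>(u :: nat \<times> nat + nat \<Rightarrow> real, v). (\<lambda>j\<in>C. \<Sum>i<n. u (Inl (i, j)) * w v i, \<Sum>i<n. (w v i)\<^sup>2))"
  define Q where "Q u v = (case F (u, v) of (f, s) \<Rightarrow> B f s)" for u v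
  let ?U = "\<lambda>\<omega>. restrict (\<lambda>x. entry x \<omega>) A" and ?V = "\<lambda>\<omega>. restrict (\<lambda>x. entry x \<omega>) (indices - A)"
  have A: "A \<subseteq> indices" using C by (auto simp: A_def)
  have ind: "indep_var (PiM A (\<lambda>_. borel)) ?U (PiM (indices - A) (\<lambda>_. borel)) ?V"
    using indep_var_restrict[OF indep_entries, of A "indices - A"] A by auto
  have w [measurable]: "(\<lambda>v. w v i) \<in> borel_measurable (PiM (indices - A) (\<lambda>_. borel))" if "i < n" for i
    unfolding w_def using that
    by (intro borel_measurable_add borel_measurable_sum borel_measurable_times
        measurable_component_singleton) (auto simp: A_def)
  have F: "F \<in> measurable (PiM A (\<lambda>_. borel) \<Otimes>\<^sub>M PiM (indices - A) (\<lambda>_. borel)) (PiM C (\<lambda>_. borel) \<Otimes>\<^sub>M borel)"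
    unfolding F_def case_prod_beta
    by (intro measurable_Pair measurable_restrict borel_measurable_sum borel_measurable_times
        borel_measurable_power measurable_compose[OF measurable_snd w]
        measurable_compose[OF measurable_fst measurable_component_singleton])
      (auto simp: A_def)
  have pred: "Measurable.pred (PiM A (\<lambda>_. borel) \<Otimes>\<^sub>M PiM (indices - A) (\<lambda>_. borel)) (\<lambda>(u, v). Q u v)"
    using measurable_compose[OF F B] by (simp add: Q_def case_prod_beta comp_def)
  have U: "(\<Sum>i<n. ?U \<omega> (Inl (i, j)) * v i) = dot n (col (X \<omega>) j) v" if "j \<in> C" for \<omega> v j
    using that by (auto simp: dot_def col_def A_def intro!: sum.cong)
  have Q_fixed: "Q (?U \<omega>) v = B (\<lambda>j\<in>C. dot n (col (X \<omega>) j) (w v)) (sq_norm n (w v))" for \<omega> v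
    unfolding Q_def F_def prod.case sq_norm_def using U by (simp cong: restrict_cong)
  have wV: "w (?V \<omega>) i = response_without C \<omega> i" if "i < n" for \<omega> i
    using that by (auto simp: w_def response_without_def A_def intro!: sum.cong)
  have "dot n u (w (?V \<omega>)) = dot n u (response_without C \<omega>)"
    "sq_norm n (w (?V \<omega>)) = sq_norm n (response_without C \<omega>)" for u \<omega>
    using wV by (simp_all add: dot_def sq_norm_def)
  moreover have "prob {\<omega> \<in> space P. Q (?U \<omega>) (?V \<omega>)} \<le> q"
    by (rule prob_independent_le[OF ind pred]) (simp only: Q_fixed bound)
  ultimately show ?thesis by (simp only: Q_fixed)
qed

lemma column_tail:
  assumes j: "j < p" and t: "0 \<le> t"
  shows "prob {\<omega> \<in> space P. t * sqrt (sq_norm n (response_without {j} \<omega>) / real n)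
      < \<bar>dot n (col (X \<omega>) j) (response_without {j} \<omega>)\<bar>} \<le> 2 * exp (- (t\<^sup>2) / 2)"
proof -
  have "prob {\<omega> \<in> space P. t * sqrt (sq_norm n v / real n) < \<bar>dot n (col (X \<omega>) j) v\<bar>}
      \<le> 2 * exp (- (t\<^sup>2) / 2)" for v
  proof -
    let ?Y = "\<lambda>\<omega>. dot n (col (X \<omega>) j) v" and ?s = "sqrt (sq_norm n v / real n)"
    have "prob {\<omega> \<in> space P. t * ?s < \<bar>?Y \<omega>\<bar>} = measure (distr P borel ?Y) {x. t * ?s < \<bar>x\<bar>}"
      using j unfolding dot_def col_def by (subst measure_distr) (auto intro!: arg_cong2[where f = measure])
    also have "\<dots> \<le> 2 * exp (- (t\<^sup>2) / 2)"
      unfolding column_combinations(2)[OF j] using t by (intro gaussian_tail_upper) auto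
    finally show ?thesis .
  qed
  moreover have "Measurable.pred (PiM {j} (\<lambda>_. borel) \<Otimes>\<^sub>M borel) (\<lambda>(f, s). t * sqrt (s / real n) < \<bar>f j :: real\<bar>)"
    by measurable
  ultimately show ?thesis
    using columns_independent_of_rest[of "{j}" "\<lambda>f s. t * sqrt (s / real n) < \<bar>f j\<bar>"] j by simp
qed

text \<open>
  For a fixed vector the correlations are independent, so the probability that all of them
  stay small is a product with one factor for each column, at most one minus the lower bound
  for the tail.
\<close>

lemma noise_columns_maximum:
  assumes C: "C \<subseteq> {..<p}" and a: "1 \<le> a"
  shows "prob {\<omega> \<in> space P. \<forall>j\<in>C. \<bar>dot n (col (X \<omega>) j) (response_without C \<omega>)\<bar>
      < a * sqrt (sq_norm n (response_without C \<omega>) / real n)}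
    \<le> exp (- (real (card C) * (exp (- 3 / 2) / sqrt (2 * pi) / a * exp (- (a\<^sup>2) / 2))))"
proof -
  let ?q = "exp (- 3 / 2) / sqrt (2 * pi) / a * exp (- (a\<^sup>2) / 2)"
  have fin: "finite C" using C finite_subset by blast
  have "prob {\<omega> \<in> space P. \<forall>j\<in>C. \<bar>dot n (col (X \<omega>) j) v\<bar> < a * sqrt (sq_norm n v / real n)}
      \<le> exp (- (real (card C) * ?q))" for v
  proof (cases "C = {}")
    case False
    let ?Y = "\<lambda>j \<omega>. dot n (col (X \<omega>) j) v" and ?s = "sqrt (sq_norm n v / real n)"
    let ?S = "{x. \<bar>x\<bar> < a * ?s}"
    have Y [measurable]: "?Y j \<in> borel_measurable P" if "j < p" for j
      using that unfolding dot_def col_def by measurable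
    have S: "?S \<in> sets borel" by measurable
    have ind: "indep_vars (\<lambda>_. borel) ?Y C"
      using indep_vars_subset[OF column_combinations(1) C] .
    have "{\<omega> \<in> space P. \<forall>j\<in>C. \<bar>?Y j \<omega>\<bar> < a * ?s} = (\<Inter>j\<in>C. ?Y j -` ?S \<inter> space P)"
      using False by auto
    hence "prob {\<omega> \<in> space P. \<forall>j\<in>C. \<bar>?Y j \<omega>\<bar> < a * ?s} = (\<Prod>j\<in>C. prob (?Y j -` ?S \<inter> space P))"
      using indep_varsD_finite[OF ind False fin, of "\<lambda>_. ?S"] S by simp
    also have "\<dots> \<le> (\<Prod>j\<in>C. exp (- ?q))"
    proof (intro prod_mono conjI)
      fix j assume "j \<in> C"
      hence j: "j < p" using C by auto
      have "prob (?Y j -` ?S \<inter> space P) = measure (gaussian ?s) ?S"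
        unfolding column_combinations(2)[OF j, symmetric] using j by (subst measure_distr) auto
      also have "\<dots> = 1 - measure (gaussian ?s) {x. a * ?s \<le> \<bar>x\<bar>}"
      proof -
        interpret g: real_distribution "gaussian ?s" by (rule real_distribution_gaussian) simp
        have "?S = space (gaussian ?s) - {x. a * ?s \<le> \<bar>x\<bar>}" by auto
        thus ?thesis using g.prob_compl[of "{x. a * ?s \<le> \<bar>x\<bar>}"] by simp
      qed
      also have "\<dots> \<le> 1 - ?q" using gaussian_tail_lower[OF _ a, of ?s] by simp
      also have "\<dots> \<le> exp (- ?q)" using exp_ge_add_one_self[of "- ?q"] by simp
      finally show "prob (?Y j -` ?S \<inter> space P) \<le> exp (- ?q)" .
    qed simp
    also have "\<dots> = exp (- (real (card C) * ?q))"
      by (simp add: exp_of_nat_mult[symmetric])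
    finally show ?thesis .
  qed simp
  moreover have "Measurable.pred (PiM C (\<lambda>_. borel) \<Otimes>\<^sub>M borel)
      (\<lambda>(f, s). \<forall>j\<in>C. \<bar>f j :: real\<bar> < a * sqrt (s / real n))"
    using fin by measurable
  ultimately show ?thesis
    using columns_independent_of_rest[of C "\<lambda>f s. \<forall>j\<in>C. \<bar>f j\<bar> < a * sqrt (s / real n)"] C by simp
qed

end

section \<open>Typical designs\<close>

lemma (in prob_space) prob_exists_le:
  assumes fin: "finite J" and meas: "\<And>j. j \<in> J \<Longrightarrow> {\<omega> \<in> space M. Q j \<omega>} \<in> events"
    and bound: "\<And>j. j \<in> J \<Longrightarrow> prob {\<omega> \<in> space M. Q j \<omega>} \<le> b"
  shows "prob {\<omega> \<in> space M. \<exists>j\<in>J. Q j \<omega>} \<le> real (card J) * b"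
    and "{\<omega> \<in> space M. \<exists>j\<in>J. Q j \<omega>} \<in> events"
proof -
  have eq: "{\<omega> \<in> space M. \<exists>j\<in>J. Q j \<omega>} = (\<Union>j\<in>J. {\<omega> \<in> space M. Q j \<omega>})" by auto
  show "{\<omega> \<in> space M. \<exists>j\<in>J. Q j \<omega>} \<in> events"
    unfolding eq using fin meas by (intro sets.finite_UN)
  have "prob (\<Union>j\<in>J. {\<omega> \<in> space M. Q j \<omega>}) \<le> (\<Sum>j\<in>J. prob {\<omega> \<in> space M. Q j \<omega>})"
    using fin meas by (intro finite_measure_subadditive_finite) auto
  also have "\<dots> \<le> (\<Sum>j\<in>J. b)" by (intro sum_mono bound)
  finally show "prob {\<omega> \<in> space M. \<exists>j\<in>J. Q j \<omega>} \<le> real (card J) * b" by (simp add: eq)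
qed

text \<open>
  Markov's inequality for the number of events that occur.
\<close>

lemma (in prob_space) prob_many_le:
  assumes fin: "finite J" and meas: "\<And>j. j \<in> J \<Longrightarrow> {\<omega> \<in> space M. Q j \<omega>} \<in> events" and N: "0 < N"
    and bound: "\<And>j. j \<in> J \<Longrightarrow> prob {\<omega> \<in> space M. Q j \<omega>} \<le> b"
  shows "prob {\<omega> \<in> space M. N < real (card {j \<in> J. Q j \<omega>})} \<le> real (card J) * b / N"
    and "(\<lambda>\<omega>. real (card {j \<in> J. Q j \<omega>})) \<in> borel_measurable M"
proof -
  let ?E = "\<lambda>j. {\<omega> \<in> space M. Q j \<omega>}"
  let ?count = "\<lambda>\<omega>. \<Sum>j\<in>J. indicator (?E j) \<omega> :: real"
  have count: "real (card {j \<in> J. Q j \<omega>}) = ?count \<omega>" if "\<omega> \<in> space M" for \<omega>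
    using fin that by (simp add: indicator_def sum.If_cases Int_def)
  have "?count \<in> borel_measurable M"
    using meas by (intro borel_measurable_sum borel_measurable_indicator)
  thus meas_count: "(\<lambda>\<omega>. real (card {j \<in> J. Q j \<omega>})) \<in> borel_measurable M"
    by (subst measurable_cong[OF count])
  let ?A = "{\<omega> \<in> space M. N < real (card {j \<in> J. Q j \<omega>})}"
  have A: "?A \<in> events" using meas_count by measurable
  have "N * prob ?A = (\<integral>\<omega>. N * indicator ?A \<omega> \<partial>M)" using A by simp
  also have "\<dots> \<le> (\<integral>\<omega>. ?count \<omega> \<partial>M)"
  proof (rule integral_mono)
    show "integrable M ?count"
      using meas by (intro Bochner_Integration.integrable_sum integrable_real_indicator) (auto simp: less_top[symmetric])
    show "integrable M (\<lambda>\<omega>. N * indicator ?A \<omega>)"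
      using A by (intro integrable_mult_right integrable_real_indicator) (auto simp: less_top[symmetric])
    show "N * indicator ?A \<omega> \<le> ?count \<omega>" if "\<omega> \<in> space M" for \<omega>
      unfolding count[OF that, symmetric] using N by (auto simp: indicator_def)
  qed
  also have "\<dots> = (\<Sum>j\<in>J. prob (?E j))"
    using meas by (subst Bochner_Integration.integral_sum)
      (auto simp: less_top[symmetric] intro!: integrable_real_indicator)
  also have "\<dots> \<le> (\<Sum>j\<in>J. b)" by (intro sum_mono bound)
  finally show "prob ?A \<le> real (card J) * b / N"
    using N by (simp add: pos_le_divide_eq mult.commute)
qed

text \<open>
  Below, \<open>scale\<close> is the standard deviation of the correlation of a noise
  variable given the response. For an arbitrary variable the corresponding quantity is
  \<open>rest_scale\<close>, where its own contribution is removed from the response in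
  order to restore independence.
\<close>

locale equal_signal_model = gaussian_model +
  fixes M :: real and k :: nat
  assumes M_nonzero: "M \<noteq> 0" and k_pos: "0 < k"
    and \<beta>_values: "\<And>j. j < p \<Longrightarrow> \<beta> j = M \<or> \<beta> j = 0"
    and sparsity: "card {j. j < p \<and> \<beta> j = M} = k"
begin

definition y :: "'a \<Rightarrow> nat \<Rightarrow> real" where
  "y \<omega> i = fitted p (X \<omega>) \<beta> i + z \<omega> i"

abbreviation corr :: "nat \<Rightarrow> 'a \<Rightarrow> real" where
  "corr j \<omega> \<equiv> dot n (col (X \<omega>) j) (y \<omega>)"

abbreviation scale :: "'a \<Rightarrow> real" where
  "scale \<omega> \<equiv> sqrt (sq_norm n (y \<omega>) / real n)"

abbreviation rest_corr :: "nat \<Rightarrow> 'a \<Rightarrow> real" where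
  "rest_corr j \<omega> \<equiv> dot n (col (X \<omega>) j) (response_without {j} \<omega>)"

abbreviation rest_scale :: "nat \<Rightarrow> 'a \<Rightarrow> real" where
  "rest_scale j \<omega> \<equiv> sqrt (sq_norm n (response_without {j} \<omega>) / real n)"

definition noise_vars :: "nat set" where
  "noise_vars = {j. j < p \<and> \<beta> j = 0}"

lemma card_noise_vars: "card noise_vars = p - k"
proof -
  have "noise_vars = {..<p} - {j. j < p \<and> \<beta> j = M}"
    using \<beta>_values M_nonzero by (auto simp: noise_vars_def)
  moreover have "{j. j < p \<and> \<beta> j = M} \<subseteq> {..<p}" by auto
  ultimately show ?thesis using sparsity by (simp add: card_Diff_subset)
qed

lemma measurable_y [measurable]: "i < n \<Longrightarrow> (\<lambda>\<omega>. y \<omega> i) \<in> borel_measurable P"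
  unfolding y_def fitted_def by measurable

lemma measurable_response_without [measurable]:
  "i < n \<Longrightarrow> (\<lambda>\<omega>. response_without C \<omega> i) \<in> borel_measurable P"
  unfolding response_without_def
  by (intro borel_measurable_add borel_measurable_sum borel_measurable_times measurable_X measurable_z) auto

lemma measurable_corr [measurable]: "j < p \<Longrightarrow> corr j \<in> borel_measurable P"
  unfolding dot_def col_def by measurable

lemma measurable_rest_corr [measurable]: "j < p \<Longrightarrow> rest_corr j \<in> borel_measurable P"
  unfolding dot_def col_def by measurable

lemma measurable_scale [measurable]: "scale \<in> borel_measurable P"
  unfolding sq_norm_def by measurable

lemma measurable_rest_scale [measurable]: "rest_scale j \<in> borel_measurable P"
  unfolding sq_norm_def by measurable

lemma response_without_noise: "response_without noise_vars \<omega> = y \<omega>"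
  unfolding response_without_def y_def fitted_def fun_eq_iff
  by (auto simp: noise_vars_def intro!: sum.mono_neutral_left)

lemma response_without_single:
  assumes "j < p"
  shows "response_without {j} \<omega> i = y \<omega> i - \<beta> j * col (X \<omega>) j i"
  using assms by (simp add: response_without_def y_def fitted_def col_def sum.remove[of "{..<p}" j] mult.commute)

text \<open>
  The conditions on the design and the noise under which the deterministic analysis applies:
  near orthogonality with \<open>\<mu>\<close>; a response with at least nearly the energy
  of the signal; a noise variable at level \<open>a\<close>; all correlations below level
  \<open>w\<close>; and at most \<open>N\<close> variables above level \<open>u\<close>. The
  last two conditions concern the correlations with the part of the response that is
  independent of the column.
\<close>

definition typical :: "real \<Rightarrow> real \<Rightarrow> real \<Rightarrow> real \<Rightarrow> real \<Rightarrow> 'a \<Rightarrow> bool" where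
  "typical \<mu> a w u N \<omega> \<longleftrightarrow>
     (\<forall>i<p. \<forall>j<p. i \<noteq> j \<longrightarrow> \<bar>dot n (col (X \<omega>) i) (col (X \<omega>) j)\<bar> \<le> \<mu>) \<and>
     (\<forall>j<p. \<bar>dot n (col (X \<omega>) j) (col (X \<omega>) j) - 1\<bar> \<le> \<mu>) \<and>
     (1 - \<mu>) * (real k * M\<^sup>2) \<le> sq_norm n (y \<omega>) \<and>
     (\<exists>j\<in>noise_vars. a * scale \<omega> \<le> \<bar>corr j \<omega>\<bar>) \<and>
     (\<forall>j<p. \<bar>rest_corr j \<omega>\<bar> \<le> w * rest_scale j \<omega>) \<and>
     real (card {j \<in> {..<p}. u * rest_scale j \<omega> < \<bar>rest_corr j \<omega>\<bar>}) \<le> N"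

lemma sum_squares_\<beta>: "(\<Sum>j<p. (\<beta> j)\<^sup>2) = real k * M\<^sup>2"
proof -
  have "(\<Sum>j<p. (\<beta> j)\<^sup>2) = (\<Sum>j\<in>{j. j < p \<and> \<beta> j = M}. (\<beta> j)\<^sup>2)"
    using \<beta>_values by (intro sum.mono_neutral_right) auto
  also have "\<dots> = (\<Sum>j\<in>{j. j < p \<and> \<beta> j = M}. M\<^sup>2)" by (intro sum.cong) auto
  finally show ?thesis using sparsity by simp
qed

lemma typical_sets: "{\<omega> \<in> space P. typical \<mu> a w u N \<omega>} \<in> sets P"
proof -
  have [measurable]: "(\<lambda>\<omega>. dot n (col (X \<omega>) i) (col (X \<omega>) j)) \<in> borel_measurable P"
    if "i < p" "j < p" for i j using that unfolding dot_def col_def by measurable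
  have [measurable]: "(\<lambda>\<omega>. sq_norm n (y \<omega>)) \<in> borel_measurable P"
    unfolding sq_norm_def by measurable
  have fin: "finite noise_vars" and sub: "noise_vars \<subseteq> {..<p}" by (auto simp: noise_vars_def)
  have 1: "Measurable.pred P (\<lambda>\<omega>. \<forall>i\<in>{..<p}. \<forall>j\<in>{..<p}. i \<noteq> j \<longrightarrow> \<bar>dot n (col (X \<omega>) i) (col (X \<omega>) j)\<bar> \<le> \<mu>)"
    by (intro pred_intros_finite) (auto intro: pred_intros_logic)
  have 2: "Measurable.pred P (\<lambda>\<omega>. \<forall>j\<in>{..<p}. \<bar>dot n (col (X \<omega>) j) (col (X \<omega>) j) - 1\<bar> \<le> \<mu>)"
    by (intro pred_intros_finite) auto
  have 3: "Measurable.pred P (\<lambda>\<omega>. \<exists>j\<in>noise_vars. a * scale \<omega> \<le> \<bar>corr j \<omega>\<bar>)"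
    using fin sub by (intro pred_intros_finite) auto
  have 4: "Measurable.pred P (\<lambda>\<omega>. \<forall>j\<in>{..<p}. \<bar>rest_corr j \<omega>\<bar> \<le> w * rest_scale j \<omega>)"
    by (intro pred_intros_finite) auto
  have 5: "Measurable.pred P (\<lambda>\<omega>. real (card {j \<in> {..<p}. u * rest_scale j \<omega> < \<bar>rest_corr j \<omega>\<bar>}) \<le> N)"
  proof -
    have "(\<lambda>\<omega>. real (card {j \<in> {..<p}. u * rest_scale j \<omega> < \<bar>rest_corr j \<omega>\<bar>})) \<in> borel_measurable P"
      by (rule prob_many_le(2)[where N = 1 and b = 1]) auto
    thus ?thesis by measurable
  qed
  show ?thesis unfolding typical_def using 1 2 3 4 5 by simp
qed

text \<open>
  A union bound over the six ways to fail, in the order of the definition.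
\<close>

lemma prob_not_typical:
  assumes \<mu>: "0 \<le> \<mu>" "\<mu> \<le> 1" and a: "1 \<le> a" and w: "0 \<le> w" and u: "0 \<le> u" and N: "0 < N"
    and p: "0 < p"
  shows "prob {\<omega> \<in> space P. \<not> typical \<mu> a w u N \<omega>} \<le>
    8 * (real p)\<^sup>2 * exp (- (real n * \<mu>\<^sup>2) / 16)
    + exp (- (real (p - k) * (exp (- 3 / 2) / sqrt (2 * pi) / a * exp (- (a\<^sup>2) / 2))))
    + real p * (2 * exp (- (w\<^sup>2) / 2)) + real p * (2 * exp (- (u\<^sup>2) / 2)) / N"
proof -
  define e where "e = exp (- (real n * \<mu>\<^sup>2) / 16)"
  define Pairs where "Pairs = {x \<in> {..<p} \<times> {..<p}. fst x \<noteq> snd x}"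
  have Pairs: "finite Pairs" "card Pairs \<le> p * p"
    using card_mono[of "{..<p} \<times> {..<p}" Pairs] by (auto simp: Pairs_def)
  have gram [measurable]: "(\<lambda>\<omega>. dot n (col (X \<omega>) i) (col (X \<omega>) j)) \<in> borel_measurable P"
    if "i < p" "j < p" for i j using that unfolding dot_def col_def by measurable
  have sq [measurable]: "(\<lambda>\<omega>. sq_norm n (y \<omega>)) \<in> borel_measurable P"
    unfolding sq_norm_def by measurable
  define F1 where "F1 = {\<omega> \<in> space P. \<exists>x\<in>Pairs. \<mu> < \<bar>dot n (col (X \<omega>) (fst x)) (col (X \<omega>) (snd x))\<bar>}"
  define F2 where "F2 = {\<omega> \<in> space P. \<exists>j\<in>{..<p}. \<mu> < \<bar>dot n (col (X \<omega>) j) (col (X \<omega>) j) - 1\<bar>}"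
  define V where "V = (\<Sum>j<p. (\<beta> j)\<^sup>2) + real n * (1 * \<sigma>)\<^sup>2"
  define F3 where "F3 = {\<omega> \<in> space P. \<mu> * V < \<bar>sq_norm n (\<lambda>i. row \<beta> 1 i \<omega>) - V\<bar>}"
  define F4 where "F4 = {\<omega> \<in> space P. \<forall>j\<in>noise_vars. \<bar>dot n (col (X \<omega>) j) (response_without noise_vars \<omega>)\<bar>
      < a * sqrt (sq_norm n (response_without noise_vars \<omega>) / real n)}"
  define F5 where "F5 = {\<omega> \<in> space P. \<exists>j\<in>{..<p}. w * rest_scale j \<omega> < \<bar>rest_corr j \<omega>\<bar>}"
  define F6 where "F6 = {\<omega> \<in> space P. N < real (card {j \<in> {..<p}. u * rest_scale j \<omega> < \<bar>rest_corr j \<omega>\<bar>})}"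
  have row_y: "(\<lambda>i. row \<beta> 1 i \<omega>) = y \<omega>" for \<omega>
    by (simp add: row_def y_def fun_eq_iff)
  have \<beta>_pos: "0 < (\<Sum>j<p. (\<beta> j)\<^sup>2)" using sum_squares_\<beta> k_pos M_nonzero by simp
  have rest_events: "{\<omega> \<in> space P. t * rest_scale j \<omega> < \<bar>rest_corr j \<omega>\<bar>} \<in> events" if "j < p" for t j
    using that by measurable
  have sets: "F1 \<in> events" "F2 \<in> events" "F3 \<in> events" "F4 \<in> events" "F5 \<in> events" "F6 \<in> events"
  proof -
    show "F1 \<in> events" unfolding F1_def using Pairs(1)
      by (rule prob_exists_le(2)[where b = 1]) (auto simp: Pairs_def)
    show "F2 \<in> events" unfolding F2_def by (rule prob_exists_le(2)[where b = 1]) auto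
    show "F3 \<in> events" unfolding F3_def row_y by measurable
    have "finite noise_vars" "noise_vars \<subseteq> {..<p}" by (auto simp: noise_vars_def)
    thus "F4 \<in> events" unfolding F4_def response_without_noise
      by (intro sets.sets_Collect_finite_All) auto
    show "F5 \<in> events" unfolding F5_def by (rule prob_exists_le(2)[where b = 1]) (auto intro: rest_events)
    have "(\<lambda>\<omega>. real (card {j \<in> {..<p}. u * rest_scale j \<omega> < \<bar>rest_corr j \<omega>\<bar>})) \<in> borel_measurable P"
      by (rule prob_many_le(2)[where N = 1 and b = 1]) (auto intro: rest_events)
    thus "F6 \<in> events" unfolding F6_def by measurable
  qed
  have p1: "prob F1 \<le> real p * real p * (4 * e)"
  proof -
    have "prob F1 \<le> real (card Pairs) * (4 * e)"
      unfolding e_def F1_def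
      by (rule prob_exists_le(1)[OF Pairs(1)])
        (use column_dot_concentration[OF _ _ _ \<mu>] in \<open>auto simp: Pairs_def\<close>)
    also have "\<dots> \<le> real (p * p) * (4 * e)"
      using Pairs(2) by (intro mult_right_mono) (auto simp: e_def simp del: of_nat_mult)
    finally show ?thesis by simp
  qed
  have p2: "prob F2 \<le> real p * (2 * e)"
  proof -
    have "prob F2 \<le> real (card {..<p}) * (2 * e)"
      unfolding F2_def e_def
      by (rule prob_exists_le(1)[OF finite_lessThan]) (use column_norm_concentration[OF _ \<mu>] in auto)
    thus ?thesis by simp
  qed
  have p3: "prob F3 \<le> 2 * e"
    unfolding F3_def V_def e_def by (rule sq_norm_row_concentration[OF \<beta>_pos \<mu>])
  have p4: "prob F4 \<le> exp (- (real (p - k) * (exp (- 3 / 2) / sqrt (2 * pi) / a * exp (- (a\<^sup>2) / 2))))"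
  proof -
    have "noise_vars \<subseteq> {..<p}" by (auto simp: noise_vars_def)
    from noise_columns_maximum[OF this a] show ?thesis unfolding card_noise_vars F4_def .
  qed
  have p5: "prob F5 \<le> real p * (2 * exp (- (w\<^sup>2) / 2))"
  proof -
    have "prob F5 \<le> real (card {..<p}) * (2 * exp (- (w\<^sup>2) / 2))"
      unfolding F5_def by (rule prob_exists_le(1)[OF finite_lessThan]) (use rest_events column_tail[OF _ w] in auto)
    thus ?thesis by simp
  qed
  have p6: "prob F6 \<le> real p * (2 * exp (- (u\<^sup>2) / 2)) / N"
  proof -
    have "prob F6 \<le> real (card {..<p}) * (2 * exp (- (u\<^sup>2) / 2)) / N"
      unfolding F6_def by (rule prob_many_le(1)[OF finite_lessThan _ N]) (use rest_events column_tail[OF _ u] in auto)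
    thus ?thesis by simp
  qed
  have "{\<omega> \<in> space P. \<not> typical \<mu> a w u N \<omega>} \<subseteq> F1 \<union> (F2 \<union> (F3 \<union> (F4 \<union> (F5 \<union> F6))))"
  proof
    fix \<omega> assume \<omega>: "\<omega> \<in> {\<omega> \<in> space P. \<not> typical \<mu> a w u N \<omega>}"
    \<comment> \<open>The noise only adds to the expected energy \<open>V\<close> of the
      response.\<close>
    have energy: "(1 - \<mu>) * (real k * M\<^sup>2) \<le> sq_norm n (y \<omega>)" if "\<omega> \<notin> F3"
    proof -
      have "(1 - \<mu>) * (real k * M\<^sup>2) \<le> (1 - \<mu>) * V"
        using \<mu> by (intro mult_left_mono) (auto simp: V_def sum_squares_\<beta>)
      moreover have "\<bar>sq_norm n (y \<omega>) - V\<bar> \<le> \<mu> * V" using that \<omega> by (simp add: F3_def row_y not_less)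
      ultimately show ?thesis by (simp add: algebra_simps abs_le_iff)
    qed
    show "\<omega> \<in> F1 \<union> (F2 \<union> (F3 \<union> (F4 \<union> (F5 \<union> F6))))"
    proof (rule ccontr)
      assume no: "\<omega> \<notin> F1 \<union> (F2 \<union> (F3 \<union> (F4 \<union> (F5 \<union> F6))))"
      hence no: "\<omega> \<notin> F1" "\<omega> \<notin> F2" "\<omega> \<notin> F3" "\<omega> \<notin> F4" "\<omega> \<notin> F5" "\<omega> \<notin> F6"
        unfolding Un_iff de_Morgan_disj by blast+
      have \<omega>s: "\<omega> \<in> space P" using \<omega> by blast
      have "typical \<mu> a w u N \<omega>"
        unfolding typical_def
      proof (intro conjI allI impI)
        show "\<bar>dot n (col (X \<omega>) i) (col (X \<omega>) j)\<bar> \<le> \<mu>" if "i < p" "j < p" "i \<noteq> j" for i j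
        proof -
          have "(i, j) \<in> Pairs" using that by (simp add: Pairs_def)
          thus ?thesis using no(1) \<omega>s unfolding F1_def by force
        qed
        show "\<bar>dot n (col (X \<omega>) j) (col (X \<omega>) j) - 1\<bar> \<le> \<mu>" if "j < p" for j
          using no(2) \<omega>s that by (auto simp: F2_def not_less)
        show "(1 - \<mu>) * (real k * M\<^sup>2) \<le> sq_norm n (y \<omega>)" using energy no(3) by blast
        show "\<exists>j\<in>noise_vars. a * scale \<omega> \<le> \<bar>corr j \<omega>\<bar>"
          using no(4) \<omega>s by (auto simp: F4_def response_without_noise not_less)
        show "\<bar>rest_corr j \<omega>\<bar> \<le> w * rest_scale j \<omega>" if "j < p" for j
          using no(5) \<omega>s that by (auto simp: F5_def not_less)
        show "real (card {j \<in> {..<p}. u * rest_scale j \<omega> < \<bar>rest_corr j \<omega>\<bar>}) \<le> N"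
          using no(6) \<omega>s by (simp add: F6_def not_less)
      qed
      thus False using \<omega> by simp
    qed
  qed
  hence "prob {\<omega> \<in> space P. \<not> typical \<mu> a w u N \<omega>} \<le> prob (F1 \<union> (F2 \<union> (F3 \<union> (F4 \<union> (F5 \<union> F6)))))"
    using sets by (intro finite_measure_mono) auto
  also have "\<dots> \<le> prob F1 + (prob F2 + (prob F3 + (prob F4 + (prob F5 + prob F6))))"
    using sets by (intro order_trans[OF measure_Un_le] add_left_mono sets.Un order_refl)
  also have "\<dots> \<le> real p * real p * (4 * e) + (real p * (2 * e) + (2 * e +
      (exp (- (real (p - k) * (exp (- 3 / 2) / sqrt (2 * pi) / a * exp (- (a\<^sup>2) / 2))))
      + (real p * (2 * exp (- (w\<^sup>2) / 2)) + real p * (2 * exp (- (u\<^sup>2) / 2)) / N))))"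
    by (intro add_mono p1 p2 p3 p4 p5 p6)
  finally have total: "prob {\<omega> \<in> space P. \<not> typical \<mu> a w u N \<omega>} \<le> \<dots>" .
  have p1: "1 \<le> real p" and e0: "0 \<le> e" using p by (simp_all add: e_def)
  have "e \<le> real p * e" using mult_right_mono[OF p1 e0] by simp
  moreover have "real p * e \<le> real p * (real p * e)" using mult_right_mono[OF p1, of "real p * e"] e0 by simp
  ultimately have "real p * real p * (4 * e) + real p * (2 * e) + 2 * e \<le> 8 * (real p)\<^sup>2 * e"
    by (simp add: power2_eq_square algebra_simps)
  with total show ?thesis unfolding e_def by linarith
qed

text \<open>
  The levels translate into multiples of \<open>scale\<close>. By the energy condition the
  mean \<open>\<beta> j\<close> of a correlation is at most \<open>\<kappa>\<close> in this
  unit, and removing one column from the response changes the unit by a factor of at most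
  \<open>1 + \<rho>\<close>. Condition \<open>C1\<close> then bounds all correlations, and
  \<open>C2\<close> says that a variable within \<open>\<theta>\<close> of level
  \<open>a\<close> is one of those above level \<open>u\<close>.
\<close>

lemma typical_separated:
  fixes N :: nat
  assumes T: "typical \<mu> a w u (real N) \<omega>"
    and \<mu>: "0 \<le> \<mu>" "\<mu> \<le> 1 / 4" and u: "0 \<le> u" and w: "0 \<le> w"
  defines "\<kappa> \<equiv> sqrt (real n / real k) / (1 - \<mu>)"
  defines "\<rho> \<equiv> 2 * \<kappa> / sqrt (real n)"
  assumes C1: "\<kappa> * (1 + \<mu>) + w * (1 + \<rho>) \<le> W"
    and C2: "u * (1 + \<rho>) < a - \<theta> - \<kappa> * (1 + \<mu>)"
    and C3: "(real N + 1) * \<mu> \<le> 1 / 4" "10 * (real N + 1) * \<mu> * W \<le> \<theta>" "0 < \<theta>" "\<theta> < a"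
  shows "\<exists>i0. separated_noise n p (X \<omega>) \<mu> (y \<omega>) \<beta> (a * scale \<omega>) (W * scale \<omega>) (\<theta> * scale \<omega>) N i0"
proof -
  let ?s = "scale \<omega>"
  note T = T[unfolded typical_def]
  have energy: "(1 - \<mu>) * (real k * M\<^sup>2) \<le> sq_norm n (y \<omega>)" using T by blast
  have kM: "0 < real k * M\<^sup>2" using k_pos M_nonzero by simp
  have \<kappa>0: "0 \<le> \<kappa>" and \<rho>0: "0 \<le> \<rho>" using \<mu> by (auto simp: \<kappa>_def \<rho>_def)
  have s0: "0 < ?s"
  proof -
    have "0 < (1 - \<mu>) * (real k * M\<^sup>2)" using kM \<mu> by (intro mult_pos_pos[OF _ kM]) simp
    thus ?thesis using energy n_pos by simp
  qed
  have M_le: "\<bar>M\<bar> \<le> \<kappa> * ?s"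
  proof -
    have "(1 - \<mu>)\<^sup>2 \<le> 1 - \<mu>"
      using \<mu> mult_left_mono[of "1 - \<mu>" 1 "1 - \<mu>"] by (simp add: power2_eq_square)
    hence "(1 - \<mu>)\<^sup>2 * (real k * M\<^sup>2) \<le> (1 - \<mu>) * (real k * M\<^sup>2)"
      using kM by (intro mult_right_mono) auto
    also note energy
    finally have "((1 - \<mu>)\<^sup>2 * M\<^sup>2) * real k \<le> sq_norm n (y \<omega>)" by (simp only: mult_ac)
    hence "(1 - \<mu>)\<^sup>2 * M\<^sup>2 \<le> sq_norm n (y \<omega>) / real k"
      using k_pos by (simp add: pos_le_divide_eq)
    moreover have "sq_norm n (y \<omega>) / real k = (real n / real k) * ?s\<^sup>2" using n_pos by simp
    ultimately have "((1 - \<mu>) * \<bar>M\<bar>)\<^sup>2 \<le> (real n / real k) * ?s\<^sup>2"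
      unfolding power_mult_distrib power2_abs by linarith
    hence "((1 - \<mu>) * \<bar>M\<bar>)\<^sup>2 \<le> (sqrt (real n / real k) * ?s)\<^sup>2"
      by (simp add: power_mult_distrib)
    hence "(1 - \<mu>) * \<bar>M\<bar> \<le> sqrt (real n / real k) * ?s"
      by (rule power2_le_imp_le) (use s0 in auto)
    thus ?thesis using \<mu> by (simp add: \<kappa>_def field_simps)
  qed
  have diag: "\<bar>dot n (col (X \<omega>) j) (col (X \<omega>) j) - 1\<bar> \<le> \<mu>" if "j < p" for j using T that by blast
  have \<beta>_le: "\<bar>\<beta> j\<bar> \<le> \<bar>M\<bar>" if "j < p" for j using \<beta>_values[OF that] by auto
  have rest: "rest_corr j \<omega> = corr j \<omega> - \<beta> j * dot n (col (X \<omega>) j) (col (X \<omega>) j)" if "j < p" for j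
    by (simp add: dot_def response_without_single[OF that] sum_distrib_left sum_subtractf algebra_simps)
  have mean: "\<bar>\<beta> j * dot n (col (X \<omega>) j) (col (X \<omega>) j)\<bar> \<le> \<kappa> * (1 + \<mu>) * ?s" if "j < p" for j
  proof -
    have "\<bar>\<beta> j * dot n (col (X \<omega>) j) (col (X \<omega>) j)\<bar> \<le> (\<kappa> * ?s) * (1 + \<mu>)"
      unfolding abs_mult using \<beta>_le[OF that] M_le diag[OF that] by (intro mult_mono) auto
    thus ?thesis by (simp add: mult_ac)
  qed
  have rest_scale_le: "rest_scale j \<omega> \<le> (1 + \<rho>) * ?s" if j: "j < p" for j
  proof -
    have L2: "sqrt (sq_norm n v) = L2_set v {..<n}" for v by (simp add: sq_norm_def L2_set_def)
    have "sqrt (sq_norm n (response_without {j} \<omega>)) \<le> sqrt (sq_norm n (y \<omega>)) + sqrt (sq_norm n (\<lambda>i. - \<beta> j * col (X \<omega>) j i))"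
      using L2_set_triangle_ineq[of "y \<omega>" "\<lambda>i. - \<beta> j * col (X \<omega>) j i" "{..<n}"]
      by (simp add: L2 response_without_single[OF j] cong: L2_set_cong)
    also have "sq_norm n (\<lambda>i. - \<beta> j * col (X \<omega>) j i) = (\<beta> j)\<^sup>2 * dot n (col (X \<omega>) j) (col (X \<omega>) j)"
      by (simp add: sq_norm_def dot_def sum_distrib_left power2_eq_square mult_ac)
    also have "sqrt \<dots> \<le> sqrt ((2 * (\<kappa> * ?s))\<^sup>2)"
    proof (intro real_sqrt_le_mono)
      have "(\<beta> j)\<^sup>2 \<le> (\<kappa> * ?s)\<^sup>2"
        using \<beta>_le[OF j] M_le by (subst abs_le_square_iff[symmetric]) (use \<kappa>0 s0 in simp)
      moreover have "dot n (col (X \<omega>) j) (col (X \<omega>) j) \<le> 4" using diag[OF j] \<mu> by linarith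
      ultimately have "(\<beta> j)\<^sup>2 * dot n (col (X \<omega>) j) (col (X \<omega>) j) \<le> (\<kappa> * ?s)\<^sup>2 * 4"
        using sq_norm_nonneg[of n "col (X \<omega>) j"] unfolding sq_norm_eq_dot by (intro mult_mono) auto
      thus "(\<beta> j)\<^sup>2 * dot n (col (X \<omega>) j) (col (X \<omega>) j) \<le> (2 * (\<kappa> * ?s))\<^sup>2"
        by (simp add: power_mult_distrib mult_ac)
    qed
    also have "sqrt ((2 * (\<kappa> * ?s))\<^sup>2) = 2 * (\<kappa> * ?s)"
      unfolding real_sqrt_abs using \<kappa>0 s0 by (intro abs_of_nonneg mult_nonneg_nonneg) auto
    finally have "sqrt (sq_norm n (response_without {j} \<omega>)) / sqrt (real n)
        \<le> (sqrt (sq_norm n (y \<omega>)) + 2 * (\<kappa> * ?s)) / sqrt (real n)"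
      by (intro divide_right_mono) auto
    thus ?thesis by (simp add: real_sqrt_divide add_divide_distrib \<rho>_def algebra_simps)
  qed
  have corr_le: "\<bar>corr j \<omega>\<bar> \<le> W * ?s" if j: "j < p" for j
  proof -
    have "\<bar>rest_corr j \<omega>\<bar> \<le> w * rest_scale j \<omega>" using T j by blast
    also have "\<dots> \<le> w * ((1 + \<rho>) * ?s)" using rest_scale_le[OF j] w by (intro mult_left_mono)
    finally have "\<bar>corr j \<omega>\<bar> \<le> (\<kappa> * (1 + \<mu>) + w * (1 + \<rho>)) * ?s"
      using rest[OF j] mean[OF j] by (simp add: algebra_simps abs_le_iff)
    also have "\<dots> \<le> W * ?s" using C1 s0 by (intro mult_right_mono) auto
    finally show ?thesis .
  qed
  have few: "card {j. j < p \<and> a * ?s - \<theta> * ?s \<le> \<bar>corr j \<omega>\<bar>} \<le> N"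
  proof -
    have "{j. j < p \<and> a * ?s - \<theta> * ?s \<le> \<bar>corr j \<omega>\<bar>}
        \<subseteq> {j \<in> {..<p}. u * rest_scale j \<omega> < \<bar>rest_corr j \<omega>\<bar>}"
    proof safe
      fix j assume j: "j < p" and large: "a * ?s - \<theta> * ?s \<le> \<bar>corr j \<omega>\<bar>"
      have "u * rest_scale j \<omega> \<le> u * ((1 + \<rho>) * ?s)" using rest_scale_le[OF j] u by (intro mult_left_mono)
      also have "\<dots> = (u * (1 + \<rho>)) * ?s" by simp
      also have "\<dots> < (a - \<theta> - \<kappa> * (1 + \<mu>)) * ?s" using C2 s0 by (rule mult_strict_right_mono)
      also have "\<dots> = a * ?s - \<theta> * ?s - \<kappa> * (1 + \<mu>) * ?s" by (simp add: left_diff_distrib)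
      also have "\<dots> \<le> \<bar>rest_corr j \<omega>\<bar>" using large rest[OF j] mean[OF j] by linarith
      finally show "u * rest_scale j \<omega> < \<bar>rest_corr j \<omega>\<bar>" .
    qed
    hence "card {j. j < p \<and> a * ?s - \<theta> * ?s \<le> \<bar>corr j \<omega>\<bar>}
        \<le> card {j \<in> {..<p}. u * rest_scale j \<omega> < \<bar>rest_corr j \<omega>\<bar>}" by (intro card_mono) auto
    also have "\<dots> \<le> N" using T by simp
    finally show ?thesis .
  qed
  obtain i0 where i0: "i0 \<in> noise_vars" "a * ?s \<le> \<bar>corr i0 \<omega>\<bar>" using T by blast
  have "separated_noise n p (X \<omega>) \<mu> (y \<omega>) \<beta> (a * ?s) (W * ?s) (\<theta> * ?s) N i0"
  proof
    show "\<bar>dot n (col (X \<omega>) i) (col (X \<omega>) j)\<bar> \<le> \<mu>" if "i < p" "j < p" "i \<noteq> j" for i j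
      using T that by blast
    show "10 * (real N + 1) * \<mu> * (W * ?s) \<le> \<theta> * ?s"
      using mult_right_mono[OF C3(2), of ?s] s0 by (simp add: mult.assoc)
    show "0 < \<theta> * ?s" "\<theta> * ?s < a * ?s" using C3 s0 by simp_all
  qed (use i0 diag corr_le few C3 in \<open>auto simp: noise_vars_def\<close>)
  thus ?thesis by blast
qed

end

section \<open>Asymptotics\<close>

lemma inverse_sqrt_eq_powr:
  fixes x :: real
  assumes "0 \<le> x"
  shows "1 / sqrt x = x powr (- 1 / 2)"
proof -
  have "x powr (- 1 / 2) = x powr (- (1 / 2))" by (rule arg_cong[of _ _ "\<lambda>t. x powr t"]) simp
  also have "\<dots> = inverse (x powr (1 / 2))" by (rule powr_minus)
  also have "\<dots> = 1 / sqrt x" unfolding powr_half_sqrt[OF assms] by (rule inverse_eq_divide)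
  finally show ?thesis by (rule sym)
qed

locale proportional_regime =
  fixes k n p :: "nat \<Rightarrow> nat" and c1 c2 c3 c4 c5 :: real
  assumes n_lim: "filterlim n at_top sequentially"
    and p_lim: "filterlim p at_top sequentially"
    and const_pos: "c1 > 0" "c2 > 0" "c3 > 0" "c4 > 0" "c5 > 0"
    and n_lower: "\<And>l. c1 * real (p l) / ln (real (p l)) powr c2 \<le> real (n l)"
    and n_upper: "\<And>l. real (n l) \<le> c3 * real (p l)"
    and k_lower: "\<And>l. c4 * real (n l) \<le> real (k l)"
    and k_upper: "\<And>l. real (k l) \<le>
                    min (0.99 * real (p l)) (c5 * real (n l) * ln (real (p l)) powr 0.99)"
begin

abbreviation lp :: "nat \<Rightarrow> real" where "lp l \<equiv> ln (real (p l))"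

definition snr :: "nat \<Rightarrow> real" where "snr l = sqrt (real (n l) / real (k l))"
text \<open>
  The dominant part of \<open>rate\<close>, which is the bracket in the theorem. Without
  noise in the response, \<open>snr\<close> is close to the mean size of the correlation of
  a signal variable in the unit \<open>scale\<close>.
\<close>

definition leading_term :: "nat \<Rightarrow> real" where "leading_term l = sqrt (2 * lp l) * snr l"
definition rate :: "nat \<Rightarrow> real" where
  "rate l = sqrt (2 * real (n l) * ln (real (p l)) / real (k l)) - real (n l) / (2 * real (k l))
    + ln (real (n l) / (2 * real (p l) * ln (real (p l))))"
definition mu :: "nat \<Rightarrow> real" where "mu l = real (n l) powr (- 1 / 4)"
text \<open>
  Chosen such that \<open>exp (- noise_level\<^sup>2 / 2)\<close> is \<open>(ln p)\<^sup>2 /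
  p\<close>: the expected number of noise variables above this level tends to infinity.
\<close>

definition noise_level :: "nat \<Rightarrow> real" where "noise_level l = sqrt (2 * lp l - 4 * ln (lp l))"
text \<open>
  A variable at \<open>noise_level\<close> must have its Gaussian part above this level. The
  term \<open>1 / ln p\<close> leaves room for the errors, and changes the exponent of the
  tail bound by \<open>o(1)\<close> only.
\<close>

definition signal_level :: "nat \<Rightarrow> real" where "signal_level l = noise_level l - snr l - 1 / lp l"
text \<open>
  The expected number of variables above \<open>signal_level\<close> is \<open>O(exp
  leading_term * (ln p)\<^sup>2)\<close>; one more logarithm makes it unlikely that there
  are more than \<open>rank_bound\<close>.
\<close>

definition rank_bound :: "nat \<Rightarrow> nat" where "rank_bound l = nat \<lfloor>exp (leading_term l) * lp l ^ 3\<rfloor>"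
text \<open>
  Deterministic bounds for \<open>snr\<close> and \<open>mu\<close>, the latter as a
  function of the number of variables.
\<close>

definition snr_max :: real where "snr_max = 1 / sqrt c4"
definition mu_max :: "real \<Rightarrow> real" where "mu_max x = (c1 * x / ln x powr c2) powr (- 1 / 4)"

lemma snr_max_pos: "0 < snr_max" using const_pos by (simp add: snr_max_def)

lemma p_real_lim: "filterlim (\<lambda>l. real (p l)) at_top sequentially"
  by (rule filterlim_compose[OF filterlim_real_sequentially p_lim])

text \<open>
  All estimates are reduced to statements about one real variable, in place of the number of
  variables.
\<close>

lemma eventually_p: "eventually Q at_top \<Longrightarrow> \<forall>\<^sub>F l in sequentially. Q (real (p l))"
  using eventually_compose_filterlim p_real_lim by blast

lemma eventually_n_pos: "\<forall>\<^sub>F l in sequentially. 0 < n l"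
  by (rule eventually_compose_filterlim[OF eventually_gt_at_top n_lim])

lemma k_pos:
  assumes "0 < n l"
  shows "0 < k l"
proof -
  have "0 < c4 * real (n l)" using assms const_pos by simp
  with k_lower[of l] have "0 < real (k l)" by linarith
  thus ?thesis by simp
qed

lemma snr_nonneg: "0 \<le> snr l" by (simp add: snr_def)

lemma snr_le: "snr l \<le> snr_max"
proof (cases "n l = 0")
  case False
  hence k: "0 < k l" using k_pos by simp
  have "real (n l) / real (k l) \<le> 1 / c4"
    using k_lower[of l] const_pos k by (simp add: field_simps)
  hence "snr l \<le> sqrt (1 / c4)" unfolding snr_def by (rule real_sqrt_le_mono)
  thus ?thesis by (simp add: snr_max_def real_sqrt_divide)
qed (use const_pos in \<open>simp add: snr_def snr_max_def\<close>)

lemma mu_le: "\<forall>\<^sub>F l in sequentially. mu l \<le> mu_max (real (p l))"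
proof -
  have "eventually (\<lambda>x::real. 1 < x) at_top" by (rule eventually_gt_at_top)
  from eventually_p[OF this] show ?thesis
  proof eventually_elim
    case (elim l)
    have pos: "0 < c1 * real (p l) / lp l powr c2"
      using elim const_pos by (intro divide_pos_pos mult_pos_pos) auto
    show ?case unfolding mu_def mu_max_def
      using n_lower[of l] pos by (intro powr_mono2') auto
  qed
qed

lemma leading_term_eq: "leading_term l = sqrt (2 * real (n l) * lp l / real (k l))"
  unfolding leading_term_def snr_def real_sqrt_mult[symmetric] by (simp add: mult_ac)

lemma leading_term_nonneg: "1 \<le> real (p l) \<Longrightarrow> 0 \<le> leading_term l"
  by (simp add: leading_term_eq)

lemma leading_term_le: "1 \<le> real (p l) \<Longrightarrow> leading_term l \<le> snr_max * sqrt (2 * lp l)"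
  unfolding leading_term_def using snr_le[of l] mult_left_mono[of "snr l" snr_max "sqrt (2 * lp l)"]
  by (simp add: mult.commute)

text \<open>
  This is where the upper bound on \<open>k\<close> enters; the exponent \<open>1 /
  200\<close> is half of \<open>1 - 0.99\<close>.
\<close>

lemma leading_term_ge: "\<forall>\<^sub>F l in sequentially. sqrt (2 / c5) * lp l powr (1 / 200) \<le> leading_term l"
proof -
  have "eventually (\<lambda>x::real. 1 < ln x) at_top" by real_asymp
  from eventually_p[OF this] eventually_n_pos show ?thesis
  proof eventually_elim
    case (elim l)
    have k: "0 < k l" using elim k_pos by blast
    have "real (k l) \<le> c5 * real (n l) * lp l powr (99 / 100)" using k_upper[of l] by simp
    hence "real (k l) * (2 / c5 * lp l powr (1 / 100))
        \<le> (c5 * real (n l) * lp l powr (99 / 100)) * (2 / c5 * lp l powr (1 / 100))"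
      using const_pos by (intro mult_right_mono) auto
    also have "\<dots> = 2 * real (n l) * (lp l powr (99 / 100) * lp l powr (1 / 100))"
      using const_pos by simp
    also have "lp l powr (99 / 100) * lp l powr (1 / 100) = lp l"
      using elim by (simp add: powr_add[symmetric])
    finally have "2 / c5 * lp l powr (1 / 100) \<le> 2 * real (n l) * lp l / real (k l)"
      using k by (simp add: pos_le_divide_eq mult_ac)
    hence "sqrt (2 / c5 * lp l powr (1 / 100)) \<le> leading_term l"
      unfolding leading_term_eq by (rule real_sqrt_le_mono)
    moreover have "sqrt (lp l powr (1 / 100)) = lp l powr (1 / 200)"
      using elim by (simp add: powr_half_sqrt[symmetric] powr_powr)
    ultimately show ?case by (simp only: real_sqrt_mult)
  qed
qed

lemma rank_bound_bounds:
  assumes "1 \<le> lp l"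
  shows "real (rank_bound l) \<le> exp (leading_term l) * lp l ^ 3" "exp (leading_term l) * lp l ^ 3 / 2 \<le> real (rank_bound l)"
    "exp (leading_term l) * lp l ^ 3 < real (rank_bound l) + 1"
proof -
  have p1: "1 \<le> real (p l)"
  proof (rule ccontr)
    assume "\<not> 1 \<le> real (p l)"
    hence "p l = 0" by auto
    thus False using assms by simp
  qed
  have "1 \<le> lp l ^ 3" using assms by (rule one_le_power)
  moreover have "1 \<le> exp (leading_term l)" using leading_term_nonneg[OF p1] by simp
  ultimately have ge1: "1 \<le> exp (leading_term l) * lp l ^ 3" using mult_mono[of 1 "exp (leading_term l)" 1 "lp l ^ 3"] by simp
  have eq: "real (rank_bound l) = real_of_int \<lfloor>exp (leading_term l) * lp l ^ 3\<rfloor>"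
    unfolding rank_bound_def using ge1 by simp
  show "real (rank_bound l) \<le> exp (leading_term l) * lp l ^ 3" "exp (leading_term l) * lp l ^ 3 < real (rank_bound l) + 1"
    unfolding eq by linarith+
  moreover have "1 \<le> real (rank_bound l)" unfolding eq using ge1 by simp
  ultimately show "exp (leading_term l) * lp l ^ 3 / 2 \<le> real (rank_bound l)" by linarith
qed

text \<open>
  The decisive comparison: \<open>rank_bound\<close> is \<open>exp (O(sqrt (ln p)))\<close>,
  whereas \<open>mu\<close> decays like a power of the number of variables.
\<close>

lemma rank_bound_mu_small:
  "\<forall>\<^sub>F l in sequentially. 10 * (real (rank_bound l) + 1) * mu l * lp l \<le> 1 / lp l ^ 2
     \<and> (real (rank_bound l) + 1) * mu l \<le> 1 / 4"
proof -
  let ?f = "\<lambda>x. 10 * ((exp (snr_max * sqrt (2 * ln x)) * ln x ^ 3 + 1) * mu_max x) * ln x ^ 3"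
  have "(?f \<longlongrightarrow> 0) at_top"
    unfolding mu_max_def using const_pos snr_max_pos by real_asymp
  hence "eventually (\<lambda>x. ?f x < 1) at_top" by (rule order_tendstoD) simp
  moreover have "eventually (\<lambda>x::real. 1 \<le> x \<and> 1 \<le> ln x) at_top"
    by (intro eventually_conj; real_asymp)
  ultimately have "eventually (\<lambda>x. ?f x < 1 \<and> 1 \<le> x \<and> 1 \<le> ln x) at_top"
    by (rule eventually_conj)
  from eventually_p[OF this] mu_le show ?thesis
  proof eventually_elim
    case (elim l)
    have mu0: "0 \<le> mu l" by (simp add: mu_def)
    have "real (rank_bound l) + 1 \<le> exp (leading_term l) * lp l ^ 3 + 1"
      using rank_bound_bounds(1) elim by simp
    also have "\<dots> \<le> exp (snr_max * sqrt (2 * lp l)) * lp l ^ 3 + 1"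
      using leading_term_le[of l] elim by (intro add_right_mono mult_right_mono) auto
    finally have "(real (rank_bound l) + 1) * mu l \<le>
        (exp (snr_max * sqrt (2 * lp l)) * lp l ^ 3 + 1) * mu_max (real (p l))"
      using elim mu0 by (intro mult_mono) auto
    hence "10 * ((real (rank_bound l) + 1) * mu l) * lp l ^ 3 \<le>
        10 * ((exp (snr_max * sqrt (2 * lp l)) * lp l ^ 3 + 1) * mu_max (real (p l))) * lp l ^ 3"
      using elim by (intro mult_right_mono mult_left_mono) auto
    hence le: "10 * ((real (rank_bound l) + 1) * mu l) * lp l ^ 3 \<le> 1" using elim by linarith
    hence "10 * (real (rank_bound l) + 1) * mu l * lp l * lp l ^ 2 \<le> 1"
      by (simp add: power2_eq_square power3_eq_cube mult_ac)
    moreover have "0 < lp l ^ 2" using elim by (intro zero_less_power) linarith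
    ultimately have 1: "10 * (real (rank_bound l) + 1) * mu l * lp l \<le> 1 / lp l ^ 2"
      by (simp only: pos_le_divide_eq)
    have "10 * ((real (rank_bound l) + 1) * mu l) * 1 \<le> 10 * ((real (rank_bound l) + 1) * mu l) * lp l ^ 3"
      using elim mu0 by (intro mult_left_mono one_le_power) auto
    with le have "(real (rank_bound l) + 1) * mu l \<le> 1 / 4" by linarith
    with 1 show ?case by blast
  qed
qed

lemma level_facts:
  "\<forall>\<^sub>F l in sequentially. 1 \<le> lp l \<and> 0 \<le> mu l \<and> mu l \<le> 1 / 4 \<and> 1 < noise_level l \<and>
     noise_level l \<le> sqrt (2 * lp l) \<and> (noise_level l)\<^sup>2 = 2 * lp l - 4 * ln (lp l) \<and> 0 \<le> signal_level l"
proof -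
  have "(mu_max \<longlongrightarrow> 0) at_top" unfolding mu_max_def using const_pos by real_asymp
  hence ev: "eventually (\<lambda>x. mu_max x < 1 / 4) at_top" by (rule order_tendstoD) simp
  have ev2: "eventually (\<lambda>x. 1 < sqrt (2 * ln x - 4 * ln (ln x)) \<and> 1 \<le> ln x \<and>
      0 \<le> sqrt (2 * ln x - 4 * ln (ln x)) - snr_max - 1 / ln x) at_top"
    using snr_max_pos by (intro eventually_conj; real_asymp)
  from eventually_p[OF ev] eventually_p[OF ev2] mu_le show ?thesis
  proof eventually_elim
    case (elim l)
    have "0 \<le> 2 * lp l - 4 * ln (lp l)"
      using elim by (smt (verit) real_sqrt_le_0_iff)
    moreover have "0 \<le> ln (lp l)" using elim by simp
    moreover have "0 \<le> signal_level l"
      unfolding signal_level_def noise_level_def using elim snr_le[of l] by linarith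
    ultimately show ?case using elim by (auto simp: noise_level_def mu_def intro: real_sqrt_le_mono)
  qed
qed

text \<open>
  The conditions \<open>C1\<close> and \<open>C2\<close> of
  \<open>typical_separated\<close>, for \<open>w = 2 * sqrt (ln p)\<close>, \<open>W = ln
  p\<close> and \<open>\<theta> = 1 / (ln p)\<^sup>2\<close>. In the second one
  \<open>snr\<close> cancels, and \<open>1 / ln p\<close> outweighs \<open>\<theta>\<close>
  and the errors, which are of order \<open>mu\<close> up to powers of \<open>ln p\<close>.
\<close>

lemma level_conditions:
  "\<forall>\<^sub>F l in sequentially.
     (let \<kappa> = sqrt (real (n l) / real (k l)) / (1 - mu l); \<rho> = 2 * \<kappa> / sqrt (real (n l)) in
       \<kappa> * (1 + mu l) + 2 * sqrt (lp l) * (1 + \<rho>) \<le> lp l \<and>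
       signal_level l * (1 + \<rho>) < noise_level l - 1 / lp l ^ 2 - \<kappa> * (1 + mu l))"
proof -
  define c where "c = snr_max"
  have c: "0 < c" using snr_max_pos by (simp add: c_def)
  have ev1: "eventually (\<lambda>x. 5 / 3 * c + 2 * sqrt (ln x) * (1 + 3 * c) \<le> ln x) at_top"
    using c by real_asymp
  have ev2: "eventually (\<lambda>x. 3 * c * mu_max x * sqrt (2 * ln x) + 1 / ln x ^ 2 + 4 * c * mu_max x < 1 / ln x) at_top"
    unfolding mu_max_def using c const_pos by real_asymp
  from eventually_p[OF ev1] eventually_p[OF ev2] level_facts mu_le eventually_n_pos show ?thesis
  proof eventually_elim
    case (elim l)
    define m where "m = mu l"
    define \<kappa> where "\<kappa> = snr l / (1 - m)"
    define \<rho> where "\<rho> = 2 * \<kappa> / sqrt (real (n l))"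
    have m: "0 \<le> m" "m \<le> 1 / 4" "m \<le> mu_max (real (p l))" using elim by (auto simp: m_def)
    have \<kappa>0: "0 \<le> \<kappa>" using m snr_nonneg[of l] by (simp add: \<kappa>_def)
    have s: "snr l \<le> c" using snr_le[of l] by (simp add: c_def)
    have "\<kappa> * (1 - m) = snr l" using m by (simp add: \<kappa>_def)
    moreover have "\<kappa> * (3 / 4) \<le> \<kappa> * (1 - m)" using m \<kappa>0 by (intro mult_left_mono) auto
    ultimately have \<kappa>: "\<kappa> \<le> 4 / 3 * c" using s by linarith
    have \<kappa>m: "\<kappa> * (1 + m) \<le> snr l + 4 * c * m"
    proof -
      have "1 + m \<le> (1 + 4 * m) * (1 - m)"
        using m mult_left_mono[of m "1 / 4" m] by (simp add: algebra_simps)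
      hence "\<kappa> * (1 + m) \<le> \<kappa> * ((1 + 4 * m) * (1 - m))" using \<kappa>0 by (rule mult_left_mono)
      also have "\<dots> = (\<kappa> * (1 - m)) * (1 + 4 * m)" by simp
      also have "\<dots> = snr l + 4 * (snr l * m)" unfolding \<open>\<kappa> * (1 - m) = snr l\<close> by (simp add: algebra_simps)
      also have "snr l * m \<le> c * m" using s m by (intro mult_right_mono)
      finally show ?thesis by simp
    qed
    have n1: "1 \<le> real (n l)" using elim(5) by simp
    have inv_sqrt: "1 / sqrt (real (n l)) \<le> m"
    proof -
      have "1 / sqrt (real (n l)) = real (n l) powr (- 1 / 2)"
        by (rule inverse_sqrt_eq_powr) simp
      also have "\<dots> \<le> real (n l) powr (- 1 / 4)" using n1 by (intro powr_mono) auto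
      finally show ?thesis by (simp add: m_def mu_def)
    qed
    have \<rho>: "0 \<le> \<rho>" "\<rho> \<le> 3 * c * m" "\<rho> \<le> 3 * c"
    proof -
      show "0 \<le> \<rho>" using \<kappa>0 by (simp add: \<rho>_def)
      have "\<rho> = 2 * \<kappa> * (1 / sqrt (real (n l)))" by (simp add: \<rho>_def)
      also have "\<dots> \<le> (3 * c) * m" by (rule mult_mono) (use \<kappa> \<kappa>0 inv_sqrt c in auto)
      finally show "\<rho> \<le> 3 * c * m" .
      also have "\<dots> \<le> 3 * c * 1" using c m by (intro mult_left_mono) auto
      finally show "\<rho> \<le> 3 * c" by simp
    qed
    have "\<kappa> * (1 + m) \<le> 4 / 3 * c * (5 / 4)" by (rule mult_mono) (use \<kappa> \<kappa>0 m c in auto)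
    moreover have "2 * sqrt (lp l) * (1 + \<rho>) \<le> 2 * sqrt (lp l) * (1 + 3 * c)"
      using \<rho> elim by (intro mult_left_mono) auto
    ultimately have C1: "\<kappa> * (1 + m) + 2 * sqrt (lp l) * (1 + \<rho>) \<le> lp l" using elim by linarith
    have "1 \<le> lp l" using elim by blast
    hence "0 \<le> 1 / lp l" by simp
    hence "signal_level l \<le> noise_level l"
      unfolding signal_level_def using snr_nonneg[of l] by linarith
    hence "signal_level l * \<rho> \<le> sqrt (2 * lp l) * (3 * c * m)"
      using \<rho> elim by (intro mult_mono) auto
    also have "\<dots> \<le> sqrt (2 * lp l) * (3 * c * mu_max (real (p l)))"
      using m c elim by (intro mult_left_mono) auto
    finally have "signal_level l * \<rho> \<le> 3 * c * mu_max (real (p l)) * sqrt (2 * lp l)" by (simp add: mult_ac)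
    moreover have "4 * c * m \<le> 4 * c * mu_max (real (p l))" using m c by (intro mult_left_mono) auto
    ultimately have "signal_level l * \<rho> + 1 / lp l ^ 2 + 4 * c * m < 1 / lp l" using elim by linarith
    hence C2: "signal_level l * (1 + \<rho>) < noise_level l - 1 / lp l ^ 2 - \<kappa> * (1 + m)"
      using \<kappa>m unfolding distrib_left mult_1_right by (simp add: signal_level_def)
    show ?case
      unfolding Let_def snr_def[symmetric] m_def[symmetric] \<kappa>_def[symmetric] \<rho>_def[symmetric]
      using C1 C2 by blast
  qed
qed

text \<open>
  The bound of \<open>prob_not_typical\<close> for these levels.
\<close>

definition failure_bound :: "nat \<Rightarrow> real" where
  "failure_bound l = 8 * (real (p l))\<^sup>2 * exp (- (real (n l) * (mu l)\<^sup>2) / 16)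
    + exp (- (real (p l - k l) * (exp (- 3 / 2) / sqrt (2 * pi) / noise_level l * exp (- ((noise_level l)\<^sup>2) / 2))))
    + real (p l) * (2 * exp (- ((2 * sqrt (lp l))\<^sup>2) / 2))
    + real (p l) * (2 * exp (- ((signal_level l)\<^sup>2) / 2)) / real (rank_bound l)"

lemma failure_bound_tendsto_0: "(failure_bound \<longlongrightarrow> 0) sequentially"
proof -
  define C :: real where "C = exp (- 3 / 2) / sqrt (2 * pi)"
  have C: "0 < C" by (simp add: C_def)
  let ?g = "\<lambda>x. 8 * x\<^sup>2 * exp (- sqrt (c1 * x / ln x powr c2) / 16)
    + exp (- (1 / 100 * C * (ln x)\<^sup>2 / sqrt (2 * ln x))) + 2 / x + 4 * exp 2 / ln x"
  have "(?g \<longlongrightarrow> 0) at_top" using const_pos C by real_asymp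
  hence lim: "((\<lambda>l. ?g (real (p l))) \<longlongrightarrow> 0) sequentially"
    by (rule filterlim_compose[OF _ p_real_lim])
  have ev: "eventually (\<lambda>x::real. 1 < x) at_top" by (rule eventually_gt_at_top)
  have le: "\<forall>\<^sub>F l in sequentially. failure_bound l \<le> ?g (real (p l))"
    using level_facts eventually_p[OF ev] eventually_n_pos
  proof eventually_elim
    case (elim l)
    define P where "P = real (p l)"
    define a where "a = noise_level l"
    have P: "1 < P" "exp (lp l) = P" "0 < P" using elim by (auto simp: P_def)
    have a: "1 < a" "a \<le> sqrt (2 * lp l)" "a\<^sup>2 = 2 * lp l - 4 * ln (lp l)" using elim by (auto simp: a_def)
    have lp1: "1 \<le> lp l" using elim by blast
    have gram: "8 * P\<^sup>2 * exp (- (real (n l) * (mu l)\<^sup>2) / 16) \<le> 8 * P\<^sup>2 * exp (- sqrt (c1 * P / lp l powr c2) / 16)"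
    proof -
      have "real (n l) * (mu l)\<^sup>2 = real (n l) powr 1 * real (n l) powr (- 1 / 2)"
        using elim unfolding mu_def by (subst powr_power) auto
      also have "\<dots> = sqrt (real (n l))"
        unfolding powr_add[symmetric] by (simp add: powr_half_sqrt)
      also have "\<dots> \<ge> sqrt (c1 * P / lp l powr c2)"
        unfolding P_def by (intro real_sqrt_le_mono n_lower)
      finally show ?thesis by (intro mult_left_mono) auto
    qed
    have expa: "exp (- a\<^sup>2 / 2) = (lp l)\<^sup>2 / P"
    proof -
      have "exp (- a\<^sup>2 / 2) = exp (2 * ln (lp l)) / exp (lp l)"
        unfolding a(3) exp_diff[symmetric] by (simp add: field_simps)
      also have "exp (2 * ln (lp l)) = (exp (ln (lp l)))\<^sup>2" by (simp add: exp_double)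
      finally show ?thesis using lp1 P by simp
    qed
    have noise: "exp (- (real (p l - k l) * (C / a * exp (- a\<^sup>2 / 2)))) \<le> exp (- (1 / 100 * C * (lp l)\<^sup>2 / sqrt (2 * lp l)))"
    proof -
      have "P / 100 \<le> real (p l - k l)"
        using k_upper[of l] by (simp add: P_def)
      moreover have "C / sqrt (2 * lp l) * ((lp l)\<^sup>2 / P) \<le> C / a * exp (- a\<^sup>2 / 2)"
        unfolding expa using a C P lp1 by (intro mult_right_mono divide_left_mono) auto
      ultimately have "P / 100 * (C / sqrt (2 * lp l) * ((lp l)\<^sup>2 / P)) \<le> real (p l - k l) * (C / a * exp (- a\<^sup>2 / 2))"
        by (rule mult_mono) (use C P lp1 in auto)
      moreover have "P / 100 * (C / sqrt (2 * lp l) * ((lp l)\<^sup>2 / P)) = 1 / 100 * C * (lp l)\<^sup>2 / sqrt (2 * lp l)"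
        using P by simp
      ultimately show ?thesis by simp
    qed
    have tail: "P * (2 * exp (- ((2 * sqrt (lp l))\<^sup>2) / 2)) = 2 / P"
    proof -
      have "exp (- ((2 * sqrt (lp l))\<^sup>2) / 2) = exp (- lp l + - lp l)"
        using lp1 by (simp add: power_mult_distrib)
      also have "\<dots> = 1 / (P * P)" unfolding exp_add exp_minus P(2) using P by (simp add: divide_inverse)
      finally show ?thesis using P by simp
    qed
    have signal: "P * (2 * exp (- ((signal_level l)\<^sup>2) / 2)) / real (rank_bound l) \<le> 4 * exp 2 / lp l"
    proof -
      have "a * (snr l + 1 / lp l) \<le> sqrt (2 * lp l) * (snr l + 1 / lp l)"
        using a snr_nonneg[of l] lp1 by (intro mult_right_mono) auto
      also have "\<dots> = leading_term l + sqrt (2 * lp l) / lp l" by (simp add: leading_term_def distrib_left)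
      also have "sqrt (2 * lp l) / lp l \<le> 2"
      proof -
        have "sqrt (2 * lp l) \<le> sqrt ((2 * lp l)\<^sup>2)"
          using lp1 by (intro real_sqrt_le_mono) (simp add: power2_eq_square)
        also have "\<dots> = 2 * lp l" unfolding real_sqrt_abs using lp1 by (intro abs_of_nonneg) simp
        finally show ?thesis using lp1 by (simp add: pos_divide_le_eq)
      qed
      \<comment> \<open>The product of \<open>sqrt (2 * lp l)\<close> and \<open>snr l\<close>
        is where the leading term comes from.\<close>
      finally have cross: "a * (snr l + 1 / lp l) \<le> leading_term l + 2" by simp
      have "(signal_level l)\<^sup>2 = a\<^sup>2 - 2 * (a * (snr l + 1 / lp l)) + (snr l + 1 / lp l)\<^sup>2"
        unfolding signal_level_def a_def[symmetric] by (simp add: power2_eq_square algebra_simps)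
      hence "- (signal_level l)\<^sup>2 / 2 \<le> - a\<^sup>2 / 2 + (leading_term l + 2)"
        using cross zero_le_power2[of "snr l + 1 / lp l"] by linarith
      hence "exp (- (signal_level l)\<^sup>2 / 2) \<le> exp (- a\<^sup>2 / 2 + (leading_term l + 2))" by simp
      also have "\<dots> = (lp l)\<^sup>2 / P * (exp (leading_term l) * exp 2)" by (simp only: exp_add expa)
      finally have "P * (2 * exp (- ((signal_level l)\<^sup>2) / 2)) \<le> P * (2 * ((lp l)\<^sup>2 / P * (exp (leading_term l) * exp 2)))"
        using P by (intro mult_left_mono) auto
      also have "\<dots> = 4 * exp 2 / lp l * (exp (leading_term l) * lp l ^ 3 / 2)"
        using P lp1 by (simp add: power2_eq_square power3_eq_cube)
      also have "\<dots> \<le> 4 * exp 2 / lp l * real (rank_bound l)"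
        using rank_bound_bounds(2)[OF lp1] lp1 by (intro mult_left_mono) auto
      finally have bound: "P * (2 * exp (- ((signal_level l)\<^sup>2) / 2)) \<le> 4 * exp 2 / lp l * real (rank_bound l)" .
      have "0 < exp (leading_term l) * lp l ^ 3 / 2" using lp1 by simp
      hence "0 < real (rank_bound l)" using rank_bound_bounds(2)[OF lp1] by linarith
      with bound show ?thesis by (simp only: pos_divide_le_eq)
    qed
    show ?case
      unfolding failure_bound_def C_def[symmetric] a_def[symmetric]
      by (intro add_mono gram[unfolded P_def] noise[unfolded P_def]
          order_eq_refl[OF tail[unfolded P_def]] signal[unfolded P_def])
  qed
  have nonneg: "\<forall>\<^sub>F l in sequentially. 0 \<le> failure_bound l"
    unfolding failure_bound_def by (intro always_eventually allI add_nonneg_nonneg) auto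
  show ?thesis by (rule tendsto_sandwich[OF nonneg le tendsto_const lim])
qed

text \<open>
  The two other terms of the bracket are \<open>O(ln (ln p))\<close>, because $n$ and $p$
  agree up to powers of $\log p$.
\<close>

lemma rate_minus_leading_term:
  assumes "1 \<le> lp l" "0 < n l"
  shows "\<bar>rate l - leading_term l\<bar> \<le> snr_max\<^sup>2 + \<bar>ln c1\<bar> + \<bar>ln c3\<bar> + ln 2 + (c2 + 1) * ln (lp l)"
proof -
  define P where "P = real (p l)"
  have P: "0 < P"
  proof (rule ccontr)
    assume "\<not> 0 < P"
    thus False using assms by (simp add: P_def)
  qed
  define x where "x = real (n l) / (2 * P * lp l)"
  have n: "0 < real (n l)" using assms by simp
  have lpp: "0 < lp l" using assms by simp
  have x0: "0 < x" using P n lpp by (simp add: x_def)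
  have "real (n l) / (2 * real (k l)) = (snr l)\<^sup>2 / 2" by (simp add: snr_def)
  moreover have "(snr l)\<^sup>2 \<le> snr_max\<^sup>2" using snr_le[of l] snr_nonneg[of l] by (rule power_mono)
  ultimately have 1: "0 \<le> real (n l) / (2 * real (k l))" "real (n l) / (2 * real (k l)) \<le> snr_max\<^sup>2"
    using zero_le_power2[of "snr l"] by linarith+
  have ln_lp: "0 \<le> ln (lp l)" using assms by simp
  have "x \<le> c3 / (2 * lp l)"
    using n_upper[of l] P lpp unfolding x_def P_def[symmetric] by (simp add: field_simps)
  hence "ln x \<le> ln (c3 / (2 * lp l))" using x0 by (intro ln_mono) auto
  also have "\<dots> = ln c3 - (ln 2 + ln (lp l))" using const_pos lpp by (simp add: ln_div ln_mult)
  finally have "ln x \<le> ln c3 - (ln 2 + ln (lp l))" .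
  moreover have ln2: "(0::real) \<le> ln 2" by simp
  ultimately have up: "ln x \<le> \<bar>ln c3\<bar>" using ln_lp abs_ge_self[of "ln c3"] by linarith
  have "c1 / (2 * (lp l powr c2 * lp l)) \<le> x"
  proof -
    have "c1 / (2 * (lp l powr c2 * lp l)) = (c1 * P / lp l powr c2) / (2 * P * lp l)"
      using P by simp
    also have "\<dots> \<le> x" unfolding x_def P_def
      using n_lower[of l] P lpp by (intro divide_right_mono) (auto simp: P_def)
    finally show ?thesis .
  qed
  hence "ln (c1 / (2 * (lp l powr c2 * lp l))) \<le> ln x"
    using const_pos lpp by (intro ln_mono) auto
  moreover have "ln (c1 / (2 * (lp l powr c2 * lp l))) = ln c1 - (ln 2 + (c2 * ln (lp l) + ln (lp l)))"
    using const_pos lpp by (simp add: ln_div ln_mult ln_powr)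
  ultimately have "ln c1 - ln 2 - (c2 + 1) * ln (lp l) \<le> ln x" by (simp add: algebra_simps)
  hence low: "- (\<bar>ln c1\<bar> + ln 2 + (c2 + 1) * ln (lp l)) \<le> ln x"
    using abs_ge_minus_self[of "ln c1"] by linarith
  have "0 \<le> (c2 + 1) * ln (lp l)" using const_pos ln_lp by simp
  moreover have "rate l - leading_term l = - (real (n l) / (2 * real (k l))) + ln x"
    by (simp add: rate_def leading_term_eq x_def P_def)
  ultimately show ?thesis using 1 up low ln2 abs_ge_zero[of "ln c1"] abs_ge_zero[of "ln c3"]
    unfolding abs_le_iff by linarith
qed

lemma rank_log_tendsto:
  "((\<lambda>l. ln (real (rank_bound l) + 1) / rate l) \<longlongrightarrow> 1) sequentially"
  and rate_pos: "\<forall>\<^sub>F l in sequentially. 0 < rate l"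
proof -
  define K where "K = snr_max\<^sup>2 + \<bar>ln c1\<bar> + \<bar>ln c3\<bar> + ln 2"
  let ?r = "\<lambda>l. (rate l - leading_term l) / leading_term l" and ?t = "\<lambda>l. (ln (real (rank_bound l) + 1) - leading_term l) / leading_term l"
  let ?R = "\<lambda>x. (K + (c2 + 4) * ln (ln x)) / (sqrt (2 / c5) * ln x powr (1 / 200))"
  have K: "0 \<le> K" "ln 2 \<le> K" by (auto simp: K_def)
  have c: "0 < sqrt (2 / c5)" using const_pos by simp
  have "(?R \<longlongrightarrow> 0) at_top" using const_pos by real_asymp
  hence lim: "((\<lambda>l. ?R (real (p l))) \<longlongrightarrow> 0) sequentially"
    by (rule filterlim_compose[OF _ p_real_lim])
  have bounds: "\<forall>\<^sub>F l in sequentially. 0 < leading_term l \<and> \<bar>?r l\<bar> \<le> ?R (real (p l)) \<and> \<bar>?t l\<bar> \<le> ?R (real (p l))"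
    using level_facts eventually_n_pos leading_term_ge
  proof eventually_elim
    case (elim l)
    have lp1: "1 \<le> lp l" using elim by blast
    have ln0: "0 \<le> ln (lp l)" using lp1 by simp
    let ?d = "sqrt (2 / c5) * lp l powr (1 / 200)"
    have d: "0 < ?d" using lp1 c by (intro mult_pos_pos) auto
    have Lpos: "0 < leading_term l" using d elim by linarith
    have quot: "\<bar>v / leading_term l\<bar> \<le> (K + (c2 + 4) * ln (lp l)) / ?d" if "\<bar>v\<bar> \<le> K + (c2 + 4) * ln (lp l)" for v
      unfolding abs_divide using that elim d Lpos by (intro frac_le) auto
    have "\<bar>rate l - leading_term l\<bar> \<le> K + (c2 + 1) * ln (lp l)"
      using rate_minus_leading_term[OF lp1] elim by (simp add: K_def)
    also have "\<dots> \<le> K + (c2 + 4) * ln (lp l)" using ln0 by (intro add_left_mono mult_right_mono) auto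
    finally have 1: "\<bar>?r l\<bar> \<le> ?R (real (p l))" by (rule quot)
    have E0: "0 < exp (leading_term l) * lp l ^ 3" using lp1 by simp
    have lnE: "ln (exp (leading_term l) * lp l ^ 3) = leading_term l + 3 * ln (lp l)"
      using lp1 by (simp add: ln_mult ln_realpow)
    have "ln (exp (leading_term l) * lp l ^ 3) \<le> ln (real (rank_bound l) + 1)"
      using rank_bound_bounds(3)[OF lp1] E0 by (intro ln_mono) auto
    hence lower: "leading_term l + 3 * ln (lp l) \<le> ln (real (rank_bound l) + 1)" by (simp only: lnE)
    have "1 \<le> exp (leading_term l) * lp l ^ 3"
      using mult_mono[of 1 "exp (leading_term l)" 1 "lp l ^ 3"] Lpos one_le_power[OF lp1, of 3] by simp
    hence "real (rank_bound l) + 1 \<le> 2 * (exp (leading_term l) * lp l ^ 3)"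
      using rank_bound_bounds(1)[OF lp1] by linarith
    hence "ln (real (rank_bound l) + 1) \<le> ln (2 * (exp (leading_term l) * lp l ^ 3))"
      by (intro ln_mono) auto
    also have "\<dots> = ln 2 + ln (exp (leading_term l) * lp l ^ 3)" using E0 by (intro ln_mult_pos) auto
    finally have upper: "ln (real (rank_bound l) + 1) \<le> ln 2 + (leading_term l + 3 * ln (lp l))" by (simp only: lnE)
    have "3 * ln (lp l) \<le> (c2 + 4) * ln (lp l)" using ln0 const_pos by (intro mult_right_mono) auto
    hence "\<bar>ln (real (rank_bound l) + 1) - leading_term l\<bar> \<le> K + (c2 + 4) * ln (lp l)"
      using lower upper K ln0 by (simp add: abs_le_iff)
    hence "\<bar>?t l\<bar> \<le> ?R (real (p l))" by (rule quot)
    with 1 Lpos show ?case by blast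
  qed
  have r0: "(?r \<longlongrightarrow> 0) sequentially"
    by (rule Lim_null_comparison[OF _ lim]) (use bounds in \<open>auto elim: eventually_mono\<close>)
  have t0: "(?t \<longlongrightarrow> 0) sequentially"
    by (rule Lim_null_comparison[OF _ lim]) (use bounds in \<open>auto elim: eventually_mono\<close>)
  have "((\<lambda>l. (1 + ?t l) / (1 + ?r l)) \<longlongrightarrow> (1 + 0) / (1 + 0)) sequentially"
    by (intro tendsto_intros r0 t0) auto
  moreover have "\<forall>\<^sub>F l in sequentially. (1 + ?t l) / (1 + ?r l) = ln (real (rank_bound l) + 1) / rate l"
    using bounds
  proof eventually_elim
    case (elim l)
    have "1 + ?t l = ln (real (rank_bound l) + 1) / leading_term l" "1 + ?r l = rate l / leading_term l"
      using elim by (auto simp: field_simps)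
    thus ?case using elim by simp
  qed
  ultimately show "((\<lambda>l. ln (real (rank_bound l) + 1) / rate l) \<longlongrightarrow> 1) sequentially"
    by (simp add: filterlim_cong)
  have "\<forall>\<^sub>F l in sequentially. - 1 < ?r l" using r0 by (rule order_tendstoD) simp
  thus "\<forall>\<^sub>F l in sequentially. 0 < rate l" using bounds
  proof eventually_elim
    case (elim l)
    hence "- leading_term l < rate l - leading_term l" by (simp add: less_divide_eq)
    thus ?case by simp
  qed
qed

end

section \<open>The rank of the first noise variable\<close>

lemma ln_enat_le:
  assumes "T \<le> enat m" "1 \<le> m"
  shows "ln_enat T \<le> ereal (ln (real m))"
proof (cases T)
  case (enat t)
  hence "t \<le> m" using assms by simp
  have "ln (real t) \<le> ln (real m)"
  proof (cases "t = 0")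
    case False
    thus ?thesis using \<open>t \<le> m\<close> by (intro ln_mono) auto
  qed (use assms in simp)
  thus ?thesis by (simp add: ln_enat_def enat)
qed (use assms in simp)

text \<open>
  Stated for all models at once: the probability space changes with \<open>l\<close>, which
  is bound by \<open>eventually\<close>.
\<close>

lemma (in proportional_regime) prob_not_typical_eventually:
  "\<forall>\<^sub>F l in sequentially. \<forall>P \<sigma> X z \<beta> M.
     equal_signal_model (P :: 'a measure) (n l) (p l) \<sigma> X z \<beta> M (k l) \<longrightarrow>
       measure P {\<omega> \<in> space P. \<not> equal_signal_model.typical (n l) (p l) X z \<beta> M (k l)
           (mu l) (noise_level l) (2 * sqrt (lp l)) (signal_level l) (real (rank_bound l)) \<omega>} \<le> failure_bound l"
proof -
  have ev: "eventually (\<lambda>x::real. 0 < x) at_top" by (rule eventually_gt_at_top)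
  show ?thesis
    using level_facts eventually_p[OF ev]
  proof eventually_elim
    case (elim l)
    have "1 \<le> lp l" using elim by blast
    hence "0 < exp (leading_term l) * lp l ^ 3 / 2" by simp
    hence "0 < real (rank_bound l)" using rank_bound_bounds(2)[of l] elim by linarith
    thus ?case
      using elim unfolding failure_bound_def
      by (intro allI impI equal_signal_model.prob_not_typical) auto
  qed
qed

theorem theorem1:
  fixes k n p :: "nat \<Rightarrow> nat"
    and \<sigma> M :: "nat \<Rightarrow> real"
    and \<beta> :: "nat \<Rightarrow> nat \<Rightarrow> real"
    and c1 c2 c3 c4 c5 :: real
    and P :: "nat \<Rightarrow> 'a measure"
    and X :: "nat \<Rightarrow> 'a \<Rightarrow> nat \<Rightarrow> nat \<Rightarrow> real"
    and z y :: "nat \<Rightarrow> 'a \<Rightarrow> nat \<Rightarrow> real"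
  assumes k_lim: "filterlim k at_top sequentially"
    and n_lim: "filterlim n at_top sequentially"
    and p_lim: "filterlim p at_top sequentially"
    and const_pos: "c1 > 0" "c2 > 0" "c3 > 0" "c4 > 0" "c5 > 0"
    and n_lower: "\<And>l. c1 * real (p l) / ln (real (p l)) powr c2 \<le> real (n l)"
    and n_upper: "\<And>l. real (n l) \<le> c3 * real (p l)"
    and k_lower: "\<And>l. c4 * real (n l) \<le> real (k l)"
    and k_upper: "\<And>l. real (k l) \<le>
                    min (0.99 * real (p l)) (c5 * real (n l) * ln (real (p l)) powr 0.99)"
    and \<sigma>_nonneg: "\<And>l. \<sigma> l \<ge> 0"
    and M_nonzero: "\<And>l. M l \<noteq> 0"
    and \<beta>_values: "\<And>l j. j < p l \<Longrightarrow> \<beta> l j = M l \<or> \<beta> l j = 0"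
    and \<beta>_sparsity: "\<And>l. card {j. j < p l \<and> \<beta> l j = M l} = k l"
    and model: "\<And>l. gaussian_design_and_noise (P l) (n l) (p l) (\<sigma> l) (X l) (z l)"
    and response: "\<And>l \<omega> i. y l \<omega> i = fitted (p l) (X l \<omega>) (\<beta> l) i + z l \<omega> i"
  shows "\<forall>entry \<in> {fs_entry, lasso_entry, lar_entry}.
    \<exists>\<epsilon>. vanishes_in_probability P \<epsilon> \<and>
      (\<forall>\<^sub>F l in sequentially. AE \<omega> in P l.
         ln_enat (first_noise_rank (p l) (\<beta> l) (entry (n l) (p l) (X l \<omega>) (y l \<omega>)))
         \<le> (1 + \<epsilon> l \<omega>) *
            ereal (sqrt (2 * real (n l) * ln (real (p l)) / real (k l))
                   - real (n l) / (2 * real (k l))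
                   + ln (real (n l) / (2 * real (p l) * ln (real (p l))))))"
proof
  fix entry assume entry: "entry \<in> {fs_entry, lasso_entry, lar_entry}"
  interpret proportional_regime k n p c1 c2 c3 c4 c5
    using n_lim p_lim const_pos n_lower n_upper k_lower k_upper by unfold_locales
  have esm: "equal_signal_model (P l) (n l) (p l) (\<sigma> l) (X l) (z l) (\<beta> l) (M l) (k l)" if "0 < n l" for l
  proof -
    have "prob_space (P l)" using model[of l] by (simp add: gaussian_design_and_noise_def)
    thus ?thesis
      unfolding equal_signal_model_def equal_signal_model_axioms_def gaussian_model_def gaussian_model_axioms_def
      using model[of l] that \<sigma>_nonneg[of l] M_nonzero[of l] k_pos[OF that] \<beta>_values[of _ l] \<beta>_sparsity[of l]
      by blast
  qed
  define regular where "regular l = equal_signal_model.typical (n l) (p l) (X l) (z l) (\<beta> l) (M l) (k l)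
      (mu l) (noise_level l) (2 * sqrt (lp l)) (signal_level l) (real (rank_bound l))" for l
  define good where "good l = {\<omega> \<in> space (P l). 0 < n l \<and> regular l \<omega>}" for l
  define e where "e l = ln (real (rank_bound l) + 1) / rate l - 1" for l
  define \<epsilon> where "\<epsilon> l \<omega> = (if \<omega> \<in> good l then ereal (e l) else \<infinity>)" for l \<omega>
  have good_sets: "good l \<in> sets (P l)" for l
  proof (cases "0 < n l")
    case True
    thus ?thesis using equal_signal_model.typical_sets[OF esm[OF True]] by (simp add: good_def regular_def)
  qed (simp add: good_def)
  have "(e \<longlongrightarrow> 1 - 1) sequentially"
    unfolding e_def[abs_def] by (intro tendsto_diff rank_log_tendsto tendsto_const)
  hence e_lim: "(e \<longlongrightarrow> 0) sequentially" by simp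
  have "vanishes_in_probability P \<epsilon>"
    unfolding vanishes_in_probability_def
  proof (intro conjI allI impI)
    show "\<epsilon> l \<in> borel_measurable (P l)" for l
      unfolding \<epsilon>_def[abs_def] using good_sets[of l] by (intro measurable_If_set) auto
    fix \<delta> :: real assume \<delta>: "0 < \<delta>"
    let ?m = "\<lambda>l. measure (P l) {\<omega> \<in> space (P l). ereal \<delta> < \<bar>\<epsilon> l \<omega>\<bar>}"
    have "\<forall>\<^sub>F l in sequentially. \<bar>e l\<bar> < \<delta>"
      using order_tendstoD(2)[OF tendsto_rabs_zero[OF e_lim] \<delta>] .
    hence "\<forall>\<^sub>F l in sequentially. ?m l \<le> failure_bound l"
      using prob_not_typical_eventually[where 'a = 'a] eventually_n_pos
    proof eventually_elim
      case (elim l)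
      have "{\<omega> \<in> space (P l). ereal \<delta> < \<bar>\<epsilon> l \<omega>\<bar>} = {\<omega> \<in> space (P l). \<not> regular l \<omega>}"
        using elim by (auto simp: \<epsilon>_def good_def)
      thus ?case using elim esm[of l] unfolding regular_def by auto
    qed
    moreover have "\<forall>\<^sub>F l in sequentially. 0 \<le> ?m l" by simp
    ultimately show "(?m \<longlongrightarrow> 0) sequentially"
      by (intro tendsto_sandwich[OF _ _ tendsto_const failure_bound_tendsto_0])
  qed
  moreover have "\<forall>\<^sub>F l in sequentially. AE \<omega> in P l.
      ln_enat (first_noise_rank (p l) (\<beta> l) (entry (n l) (p l) (X l \<omega>) (y l \<omega>)))
      \<le> (1 + \<epsilon> l \<omega>) * ereal (rate l)"
    using eventually_n_pos level_facts level_conditions rank_bound_mu_small rate_pos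
  proof eventually_elim
    case (elim l)
    let ?N = "rank_bound l"
    interpret model: equal_signal_model "P l" "n l" "p l" "\<sigma> l" "X l" "z l" "\<beta> l" "M l" "k l"
      using elim by (intro esm)
    have y: "y l \<omega> = model.y \<omega>" for \<omega>
      by (simp add: fun_eq_iff response model.y_def)
    have "ln_enat (first_noise_rank (p l) (\<beta> l) (entry (n l) (p l) (X l \<omega>) (y l \<omega>)))
      \<le> (1 + \<epsilon> l \<omega>) * ereal (rate l)" for \<omega>
    proof (cases "\<omega> \<in> good l")
      case True
      hence T: "regular l \<omega>" by (simp add: good_def)
      have levels: "1 \<le> lp l" "0 \<le> mu l" "mu l \<le> 1 / 4" "1 < noise_level l" "0 \<le> signal_level l"
        using elim(2) by blast+
      have theta: "0 < 1 / lp l ^ 2" "1 / lp l ^ 2 < noise_level l"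
      proof -
        have "1 \<le> lp l ^ 2" using levels(1) by (rule one_le_power)
        hence "0 < 1 / lp l ^ 2" "1 / lp l ^ 2 \<le> 1" using levels(1) by (auto simp: divide_le_eq_1)
        with levels(4) show "0 < 1 / lp l ^ 2" "1 / lp l ^ 2 < noise_level l" by linarith+
      qed
      have w: "0 \<le> 2 * sqrt (lp l)" using levels(1) by simp
      note conditions = elim(3)[unfolded Let_def]
      obtain i0 where "separated_noise (n l) (p l) (X l \<omega>) (mu l) (y l \<omega>) (\<beta> l) (noise_level l * model.scale \<omega>)
          (lp l * model.scale \<omega>) (1 / lp l ^ 2 * model.scale \<omega>) ?N i0"
        unfolding y
        using model.typical_separated[OF T[unfolded regular_def] levels(2,3,5) w conjunct1[OF conditions]
            conjunct2[OF conditions] conjunct2[OF elim(4)] conjunct1[OF elim(4)] theta] by (elim exE)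
      then interpret sep: separated_noise "n l" "p l" "X l \<omega>" "mu l" "y l \<omega>" "\<beta> l" "noise_level l * model.scale \<omega>"
          "lp l * model.scale \<omega>" "1 / lp l ^ 2 * model.scale \<omega>" ?N i0 .
      from entry consider "entry = fs_entry" | "entry = lasso_entry" | "entry = lar_entry" by blast
      hence "first_noise_rank (p l) (\<beta> l) (entry (n l) (p l) (X l \<omega>) (y l \<omega>)) \<le> enat (?N + 1)"
        by cases (simp_all only: sep.forward_stepwise_rank sep.lasso_rank sep.lar_rank)
      hence "ln_enat (first_noise_rank (p l) (\<beta> l) (entry (n l) (p l) (X l \<omega>) (y l \<omega>))) \<le> ereal (ln (real (?N + 1)))"
        by (rule ln_enat_le) simp
      also have "ln (real (?N + 1)) = (1 + e l) * rate l" unfolding e_def using elim(5) by (simp add: add.commute)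
      finally show ?thesis using True by (simp only: \<epsilon>_def if_True plus_ereal.simps one_ereal_def times_ereal.simps)
    next
      case False
      have "0 < rate l" using elim(5) .
      thus ?thesis using False by (simp add: \<epsilon>_def)
    qed
    thus ?case by simp
  qed
  ultimately show "\<exists>\<epsilon>. vanishes_in_probability P \<epsilon> \<and>
      (\<forall>\<^sub>F l in sequentially. AE \<omega> in P l.
         ln_enat (first_noise_rank (p l) (\<beta> l) (entry (n l) (p l) (X l \<omega>) (y l \<omega>)))
         \<le> (1 + \<epsilon> l \<omega>) *
            ereal (sqrt (2 * real (n l) * ln (real (p l)) / real (k l))
                   - real (n l) / (2 * real (k l))
                   + ln (real (n l) / (2 * real (p l) * ln (real (p l))))))"
    unfolding rate_def by blast
qed

end
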